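(* Let $N\in\mathbb{N}$, $N\ge 2$, $k,l\in\mathbb{R}$, $\alpha>0$ and $l+N+\alpha>0$. Assume further that $$l+1\le k .$$ Then $$\int_{\partial\Omega}|x|^k x_N^\alpha\,\mathcal{H}_{N-1}(dx)\ \ge\ C^{rad}_{k,l,N,\alpha}\left(\int_\Omega |x|^l x_N^\alpha\,dx\right)^{(k+N+\alpha-1)/(l+N+\alpha)}$$ for all smooth sets $\Omega\subset\mathbb{R}^N_+$ with $\int_\Omega |x|^l x_N^\alpha\,dx<+\infty$, where $$C^{rad}_{k,l,N,\alpha}:=\frac{\int_{\partial B_1\cap\mathbb{R}^N_+}|x|^k x_N^\alpha\,\mathcal{H}_{N-1}(dx)}{\left(\int_{B_1\cap\mathbb{R}^N_+}|x|^l x_N^\alpha\,dx\right)^{(k+N+\alpha-1)/(l+N+\alpha)}} =(l+\alpha+N)^{\frac{k+N+\alpha-1}{l+N+\alpha}}\left(B\left(\tfrac{N-1}{2},\tfrac{\alpha+1}{2}\right)\frac{\pi^{\frac{N-1}{2}}}{\Gamma\left(\frac{N-1}{2}\right)}\right)^{\frac{l-k+1}{l+N+\alpha}} .$$ Equality holds in the inequality if $\Omega=B_R\cap\mathbb{R}^N_+$ for some $R>0$.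
   Context: $\mathbb{R}^N_+=\{x\in\mathbb{R}^N: x_N>0\}$; $B_R=\{x\in\mathbb{R}^N:|x|<R\}$ is the ball of radius $R$ centered at the origin; $\mathcal{H}_{N-1}$ is the $(N-1)$-dimensional Hausdorff measure; $B(\cdot,\cdot)$ and $\Gamma(\cdot)$ are the Euler Beta and Gamma functions. *)

theory Defs
  imports "HOL-Analysis.Analysis"
begin

section \<open>Hausdorff measure\<close>

text \<open>
  The size-\<open>\<delta>\<close> approximation of the \<open>d\<close>-dimensional Hausdorff measure, normalised by
  \<open>\<omega>\<^sub>d / 2\<^sup>d\<close> as usual, so that \<open>\<H>\<^sub>d\<close> agrees with Lebesgue measure on
  \<open>d\<close>-dimensional Euclidean space. Boundedness is required because \<^const>\<open>diameter\<close>
  is only meaningful for bounded sets; the empty set is treated separately because of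
  \<open>0 ^ 0 = 1\<close>.
\<close>

definition hausdorff_size :: "nat \<Rightarrow> 'a::metric_space set \<Rightarrow> ennreal" where
  "hausdorff_size d C =
     (if C = {} then 0 else ennreal (unit_ball_vol (real d) * (diameter C / 2) ^ d))"

definition hausdorff_pre :: "nat \<Rightarrow> real \<Rightarrow> 'a::metric_space set \<Rightarrow> ennreal" where
  "hausdorff_pre d \<delta> A =
     (INF C \<in> {C :: nat \<Rightarrow> 'a set. A \<subseteq> (\<Union>i. C i) \<and> (\<forall>i. bounded (C i) \<and> diameter (C i) \<le> \<delta>)}.
        \<Sum>i. hausdorff_size d (C i))"

definition hausdorff_outer :: "nat \<Rightarrow> 'a::metric_space set \<Rightarrow> ennreal" where
  "hausdorff_outer d A = (SUP \<delta>\<in>{0<..}. hausdorff_pre d \<delta> A)"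

definition hausdorff_measure :: "nat \<Rightarrow> 'a::metric_space measure" where
  "hausdorff_measure d = measure_of UNIV (sets borel) (hausdorff_outer d)"

lemma space_hausdorff_measure [simp]: "space (hausdorff_measure d) = UNIV"
  by (simp add: hausdorff_measure_def space_measure_of_conv)

lemma sets_hausdorff_measure [simp, measurable_cong]:
  "sets (hausdorff_measure d) = sets borel"
  unfolding hausdorff_measure_def
  using sets.sigma_sets_eq[of borel] by (simp add: sets_measure_of_conv)

text \<open>
  \<^const>\<open>measure_of\<close> yields the null measure if it is given a set function that is not
  countably additive. The rest of this section shows that this does not happen here.
\<close>

lemma hausdorff_size_empty [simp]: "hausdorff_size d {} = 0"
  by (simp add: hausdorff_size_def)

lemma hausdorff_pre_le:
  assumes "A \<subseteq> (\<Union>i. C i)" "\<And>i. bounded (C i)" "\<And>i. diameter (C i) \<le> \<delta>"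
  shows "hausdorff_pre d \<delta> A \<le> (\<Sum>i. hausdorff_size d (C i))"
  unfolding hausdorff_pre_def using assms by (intro INF_lower) auto

lemma hausdorff_pre_mono: "A \<subseteq> B \<Longrightarrow> hausdorff_pre d \<delta> A \<le> hausdorff_pre d \<delta> B"
  unfolding hausdorff_pre_def by (intro INF_superset_mono) auto

lemma hausdorff_pre_antimono: "\<delta> \<le> \<epsilon> \<Longrightarrow> hausdorff_pre d \<epsilon> A \<le> hausdorff_pre d \<delta> A"
  unfolding hausdorff_pre_def by (intro INF_superset_mono) (auto intro: order_trans)

lemma hausdorff_outer_mono: "A \<subseteq> B \<Longrightarrow> hausdorff_outer d A \<le> hausdorff_outer d B"
  unfolding hausdorff_outer_def by (intro SUP_mono') (rule hausdorff_pre_mono)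

lemma hausdorff_outer_empty [simp]: "hausdorff_outer d {} = 0"
proof -
  have "hausdorff_pre d \<delta> ({} :: 'a set) \<le> 0" if "\<delta> > 0" for \<delta>
    using hausdorff_pre_le[of "{} :: 'a set" "\<lambda>_. {}" \<delta> d] that by simp
  then have "hausdorff_outer d ({} :: 'a set) \<le> 0"
    unfolding hausdorff_outer_def by (intro SUP_least) auto
  then show ?thesis by simp
qed

lemma hausdorff_pre_UN:
  "hausdorff_pre d \<delta> (\<Union>n::nat. A n) \<le> (\<Sum>n. hausdorff_pre d \<delta> (A n))"
proof (cases "\<exists>n. hausdorff_pre d \<delta> (A n) = \<infinity>")
  case True
  then obtain n where "hausdorff_pre d \<delta> (A n) = \<infinity>" by blast
  moreover have "hausdorff_pre d \<delta> (A n) \<le> (\<Sum>n. hausdorff_pre d \<delta> (A n))"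
    using sum_le_suminf[of "\<lambda>n. hausdorff_pre d \<delta> (A n)" "{n}"] by simp
  ultimately show ?thesis by (simp add: top_unique)
next
  case fin: False
  show ?thesis
  proof (rule ennreal_le_epsilon)
    fix e :: real assume e: "0 < e"
    have "\<exists>C. A n \<subseteq> (\<Union>i. C i) \<and> (\<forall>i. bounded (C i) \<and> diameter (C i) \<le> \<delta>) \<and>
        (\<Sum>i. hausdorff_size d (C i)) < hausdorff_pre d \<delta> (A n) + ennreal (e * (1/2) ^ Suc n)" for n
    proof -
      have "hausdorff_pre d \<delta> (A n) < hausdorff_pre d \<delta> (A n) + ennreal (e * (1/2) ^ Suc n)"
        using fin e by (cases "hausdorff_pre d \<delta> (A n)")
          (auto simp: ennreal_plus[symmetric] ennreal_less_iff simp del: ennreal_plus)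
      then have "\<exists>C\<in>{C. A n \<subseteq> (\<Union>i. C i) \<and> (\<forall>i. bounded (C i) \<and> diameter (C i) \<le> \<delta>)}.
          (\<Sum>i. hausdorff_size d (C i)) < hausdorff_pre d \<delta> (A n) + ennreal (e * (1/2) ^ Suc n)"
        by (subst (asm) hausdorff_pre_def) (simp only: INF_less_iff)
      then show ?thesis by blast
    qed
    then obtain C where C: "\<And>n. A n \<subseteq> (\<Union>i. C n i)"
        "\<And>n i. bounded (C n i)" "\<And>n i. diameter (C n i) \<le> \<delta>"
        "\<And>n. (\<Sum>i. hausdorff_size d (C n i)) < hausdorff_pre d \<delta> (A n) + ennreal (e * (1/2) ^ Suc n)"
      by metis
    define D where "D = (\<lambda>(n, i). C n i) \<circ> prod_decode"
    have "(\<Union>n. A n) \<subseteq> (\<Union>i. D i)"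
    proof
      fix x assume "x \<in> (\<Union>n. A n)"
      then obtain n i where "x \<in> C n i" using C(1) by blast
      then have "x \<in> D (prod_encode (n, i))" by (simp add: D_def)
      then show "x \<in> (\<Union>i. D i)" by blast
    qed
    then have "hausdorff_pre d \<delta> (\<Union>n. A n) \<le> (\<Sum>i. hausdorff_size d (D i))"
      using C(2,3) by (intro hausdorff_pre_le) (auto simp: D_def split_beta)
    also have "\<dots> = (\<Sum>n. \<Sum>i. hausdorff_size d (C n i))"
      using suminf_ennreal_2dimen[of "\<lambda>n. \<Sum>i. hausdorff_size d (C n i)"
          "\<lambda>(n, i). hausdorff_size d (C n i)"]
      by (simp add: D_def split_beta)
    also have "\<dots> \<le> (\<Sum>n. hausdorff_pre d \<delta> (A n) + ennreal (e * (1/2) ^ Suc n))"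
      using C(4) by (intro suminf_le less_imp_le) auto
    also have "\<dots> = (\<Sum>n. hausdorff_pre d \<delta> (A n)) + (\<Sum>n. ennreal (e * (1/2) ^ Suc n))"
      by (intro suminf_add[symmetric]) auto
    also have "(\<Sum>n. ennreal (e * (1/2) ^ Suc n)) = ennreal e"
      using e sums_mult[OF power_half_series, of e]
      by (intro suminf_ennreal_eq) auto
    finally show "hausdorff_pre d \<delta> (\<Union>n. A n) \<le> (\<Sum>n. hausdorff_pre d \<delta> (A n)) + ennreal e" .
  qed
qed

lemma hausdorff_outer_UN:
  "hausdorff_outer d (\<Union>n::nat. A n) \<le> (\<Sum>n. hausdorff_outer d (A n))"
proof -
  have "hausdorff_pre d \<delta> (\<Union>n. A n) \<le> (\<Sum>n. hausdorff_outer d (A n))" if "\<delta> > 0" for \<delta>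
  proof -
    have "(\<Sum>n. hausdorff_pre d \<delta> (A n)) \<le> (\<Sum>n. hausdorff_outer d (A n))"
      using that by (intro suminf_le) (auto simp: hausdorff_outer_def intro!: SUP_upper)
    with hausdorff_pre_UN show ?thesis by (rule order_trans)
  qed
  then show ?thesis
    unfolding hausdorff_outer_def[of d "\<Union>n. A n"] by (intro SUP_least) auto
qed

lemma hausdorff_outer_Un:
  "hausdorff_outer d (A \<union> B) \<le> hausdorff_outer d A + hausdorff_outer d B"
proof -
  have "hausdorff_outer d (\<Union>n. binaryset A B n) \<le> (\<Sum>n. hausdorff_outer d (binaryset A B n))"
    by (rule hausdorff_outer_UN)
  also have "\<dots> = hausdorff_outer d A + hausdorff_outer d B"
    by (intro suminf_binaryset_eq) auto
  finally show ?thesis by (simp add: UN_binaryset_eq)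
qed

lemma outer_measure_space_hausdorff: "outer_measure_space UNIV (hausdorff_outer d)"
  by (auto simp: outer_measure_space_def positive_def increasing_def countably_subadditive_def
      intro: hausdorff_outer_mono hausdorff_outer_UN)

lemma hausdorff_pre_separated:
  assumes sep: "\<And>a b. a \<in> A \<Longrightarrow> b \<in> B \<Longrightarrow> e \<le> dist a b" and "\<delta> < e" "0 \<le> \<delta>"
  shows "hausdorff_pre d \<delta> A + hausdorff_pre d \<delta> B \<le> hausdorff_pre d \<delta> (A \<union> B)"
  unfolding hausdorff_pre_def[of d \<delta> "A \<union> B"]
proof (rule INF_greatest)
  fix C :: "nat \<Rightarrow> 'a set"
  assume "C \<in> {C. A \<union> B \<subseteq> (\<Union>i. C i) \<and> (\<forall>i. bounded (C i) \<and> diameter (C i) \<le> \<delta>)}"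
  then have C: "A \<subseteq> (\<Union>i. C i)" "B \<subseteq> (\<Union>i. C i)" "\<And>i. bounded (C i)" "\<And>i. diameter (C i) \<le> \<delta>"
    by auto
  define D where "D S i = (if C i \<inter> S = {} then {} else C i)" for S i
  have le: "hausdorff_pre d \<delta> S \<le> (\<Sum>i. hausdorff_size d (D S i))" if "S \<subseteq> (\<Union>i. C i)" for S
    using that C(3,4) \<open>0 \<le> \<delta>\<close> by (intro hausdorff_pre_le) (fastforce simp: D_def)+
  have "hausdorff_size d (D A i) + hausdorff_size d (D B i) \<le> hausdorff_size d (C i)" for i
  proof -
    have "C i \<inter> A = {} \<or> C i \<inter> B = {}"
    proof (rule ccontr)
      assume "\<not> ?thesis"
      then obtain a b where ab: "a \<in> C i" "a \<in> A" "b \<in> C i" "b \<in> B" by blast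
      have "dist a b \<le> diameter (C i)"
        using diameter_bounded_bound[OF C(3) ab(1,3)] .
      then show False using sep[OF ab(2,4)] C(4)[of i] \<open>\<delta> < e\<close> by linarith
    qed
    then show ?thesis by (auto simp: D_def)
  qed
  then have "(\<Sum>i. hausdorff_size d (D A i) + hausdorff_size d (D B i))
      \<le> (\<Sum>i. hausdorff_size d (C i))"
    by (intro suminf_le) auto
  then have "(\<Sum>i. hausdorff_size d (D A i)) + (\<Sum>i. hausdorff_size d (D B i))
      \<le> (\<Sum>i. hausdorff_size d (C i))"
    by (simp add: suminf_add[symmetric])
  then show "hausdorff_pre d \<delta> A + hausdorff_pre d \<delta> B \<le> (\<Sum>i. hausdorff_size d (C i))"
    using add_mono[OF le[OF C(1)] le[OF C(2)]] by (rule order_trans[rotated])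
qed

lemma hausdorff_outer_separated:
  assumes sep: "\<And>a b. a \<in> A \<Longrightarrow> b \<in> B \<Longrightarrow> e \<le> dist a b" and "0 < e"
  shows "hausdorff_outer d A + hausdorff_outer d B \<le> hausdorff_outer d (A \<union> B)"
proof -
  have *: "hausdorff_pre d x A + hausdorff_pre d y B \<le> hausdorff_outer d (A \<union> B)"
    if "0 < x" "0 < y" for x y
  proof -
    define \<delta> where "\<delta> = min (min x y) (e / 2)"
    have \<delta>: "0 < \<delta>" "\<delta> < e" "\<delta> \<le> x" "\<delta> \<le> y"
      using that \<open>0 < e\<close> by (auto simp: \<delta>_def min_def)
    have "hausdorff_pre d x A + hausdorff_pre d y B \<le> hausdorff_pre d \<delta> A + hausdorff_pre d \<delta> B"
      using \<delta> by (intro add_mono hausdorff_pre_antimono)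
    also have "\<dots> \<le> hausdorff_pre d \<delta> (A \<union> B)"
      using \<delta> by (intro hausdorff_pre_separated[OF sep]) auto
    also have "\<dots> \<le> hausdorff_outer d (A \<union> B)"
      unfolding hausdorff_outer_def using \<delta> by (intro SUP_upper) auto
    finally show ?thesis .
  qed
  have 1: "hausdorff_pre d x A + hausdorff_outer d B \<le> hausdorff_outer d (A \<union> B)" if "0 < x" for x
    unfolding hausdorff_outer_def[of d B]
    by (subst ennreal_SUP_add_right) (auto intro!: SUP_least * that)
  show ?thesis
    unfolding hausdorff_outer_def[of d A]
    by (subst ennreal_SUP_add_left[symmetric]) (auto intro!: SUP_least 1)
qed

lemma sum_ennreal_pairs:
  fixes f :: "nat \<Rightarrow> ennreal"
  shows "(\<Sum>j<2 * m. f j) = (\<Sum>j<m. f (2 * j)) + (\<Sum>j<m. f (2 * j + 1))"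
  by (induction m) (auto simp: ac_simps)

lemma closed_in_lambda_system_hausdorff:
  assumes "closed F"
  shows "F \<in> lambda_system UNIV UNIV (hausdorff_outer d)"
proof (cases "F = {}")
  case True
  then show ?thesis by (auto simp: lambda_system_def)
next
  case ne: False
  let ?h = "hausdorff_outer d"
  have main: "?h (A \<inter> F) + ?h (A - F) \<le> ?h A" for A
  proof (cases "?h A = \<infinity>")
    case True then show ?thesis by simp
  next
    case fin: False
    define G where "G n = {x \<in> A. 1 / real (Suc n) \<le> infdist x F}" for n
    define R where "R j = {x \<in> A. 1 / real (Suc (Suc j)) \<le> infdist x F
                              \<and> infdist x F < 1 / real (Suc j)}" for j
    have infd: "infdist x F \<le> infdist y F + dist x y" for x y
      using infdist_triangle by blast
    have sepR: "1 / real (Suc (Suc i)) - 1 / real (Suc j) \<le> dist a b"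
      if "a \<in> R i" "b \<in> R j" for a b i j
      using that infd[of a b] by (auto simp: R_def)
    have odd_even: "(\<Sum>j<m. ?h (R (2 * j + c))) \<le> ?h (\<Union>j<m. R (2 * j + c))" for m c
    proof (induction m)
      case (Suc m)
      define e where "e = 1 / real (2 * m + c) - 1 / real (Suc (2 * m + c))"
      show ?case
      proof (cases "m = 0")
        case True then show ?thesis by (simp add: lessThan_Suc)
      next
        case False
        have "0 < e" using False unfolding e_def by (simp add: frac_less2)
        have "e \<le> dist a b" if "a \<in> (\<Union>j<m. R (2 * j + c))" "b \<in> R (2 * m + c)" for a b
        proof -
          from that obtain j where j: "j < m" "a \<in> R (2 * j + c)" by auto
          have "real (Suc (Suc (2 * j + c))) \<le> real (2 * m + c)" using j by simp
          then have "1 / real (2 * m + c) \<le> 1 / real (Suc (Suc (2 * j + c)))"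
            by (intro divide_left_mono) auto
          then show ?thesis using sepR[OF j(2) that(2)] by (simp add: e_def)
        qed
        from hausdorff_outer_separated[OF this \<open>0 < e\<close>, where d = d]
        have "?h (\<Union>j<m. R (2 * j + c)) + ?h (R (2 * m + c))
            \<le> ?h ((\<Union>j<m. R (2 * j + c)) \<union> R (2 * m + c))" .
        also have "(\<Union>j<m. R (2 * j + c)) \<union> R (2 * m + c) = (\<Union>j<Suc m. R (2 * j + c))"
          by (simp add: lessThan_Suc Un_commute)
        finally have "?h (\<Union>j<m. R (2 * j + c)) + ?h (R (2 * m + c))
            \<le> ?h (\<Union>j<Suc m. R (2 * j + c))" .
        from order_trans[OF add_right_mono[OF Suc.IH] this] show ?thesis by simp
      qed
    qed simp
    have part: "(\<Sum>j<n. ?h (R (2 * j + c))) \<le> ?h A" for c n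
      by (rule order_trans[OF odd_even], rule hausdorff_outer_mono) (auto simp: R_def)
    have "(\<Sum>j<n. ?h (R j)) \<le> ?h A + ?h A" for n
    proof -
      have "(\<Sum>j<n. ?h (R j)) \<le> (\<Sum>j<2 * n. ?h (R j))"
        by (intro sum_mono2) auto
      also have "\<dots> \<le> ?h A + ?h A"
        unfolding sum_ennreal_pairs using part[of 0 n] part[of 1 n] by (intro add_mono) auto
      finally show ?thesis .
    qed
    then have "(\<Sum>j. ?h (R j)) \<le> ?h A + ?h A"
      by (intro suminf_le_const) auto
    then have R_fin: "(\<Sum>j. ?h (R j)) \<noteq> \<infinity>"
      using fin by (metis ennreal_add_eq_top infinity_ennreal_def top_unique)
    have G: "?h (A \<inter> F) + ?h (G n) \<le> ?h A" for n
    proof -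
      have "1 / real (Suc n) \<le> dist a b" if "a \<in> A \<inter> F" "b \<in> G n" for a b
        using that infdist_le[of a F b] by (auto simp: G_def dist_commute)
      then have "?h (A \<inter> F) + ?h (G n) \<le> ?h (A \<inter> F \<union> G n)"
        by (rule hausdorff_outer_separated) auto
      also have "\<dots> \<le> ?h A" by (intro hausdorff_outer_mono) (auto simp: G_def)
      finally show ?thesis .
    qed
    have bound: "?h (A \<inter> F) + ?h (A - F) \<le> ?h A + (\<Sum>j. ?h (R (j + n)))" for n
    proof -
      have "A - F \<subseteq> G n \<union> (\<Union>j. R (j + n))"
      proof
        fix x assume x: "x \<in> A - F"
        then have pos: "0 < infdist x F"
          using in_closed_iff_infdist_zero[OF assms ne, of x] infdist_nonneg[of x F] by auto
        then obtain m0 where m0: "1 / real (Suc m0) < infdist x F"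
          using nat_approx_posE by blast
        show "x \<in> G n \<union> (\<Union>j. R (j + n))"
        proof (cases "x \<in> G n")
          case notG: False
          define m where "m = (LEAST m. 1 / real (Suc m) \<le> infdist x F)"
          have m: "1 / real (Suc m) \<le> infdist x F"
            unfolding m_def by (rule LeastI[of _ m0]) (use m0 in simp)
          have less: "infdist x F < 1 / real (Suc i)" if "i < m" for i
            using not_less_Least[of i "\<lambda>m. 1 / real (Suc m) \<le> infdist x F"] that
            by (auto simp: m_def not_le)
          have "n < m"
          proof (rule ccontr)
            assume "\<not> n < m"
            then have "1 / real (Suc n) \<le> 1 / real (Suc m)"
              by (intro divide_left_mono) auto
            then show False using m notG x by (auto simp: G_def)
          qed
          then obtain j where j: "m = Suc (j + n)"
            by (metis add.commute less_imp_Suc_add)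
          then have "x \<in> R (j + n)"
            using m less[of "j + n"] x by (auto simp: R_def)
          then show ?thesis by blast
        qed simp
      qed
      then have "?h (A - F) \<le> ?h (G n \<union> (\<Union>j. R (j + n)))" by (rule hausdorff_outer_mono)
      also have "\<dots> \<le> ?h (G n) + ?h (\<Union>j. R (j + n))" by (rule hausdorff_outer_Un)
      also have "\<dots> \<le> ?h (G n) + (\<Sum>j. ?h (R (j + n)))"
        by (intro add_left_mono hausdorff_outer_UN)
      finally have "?h (A \<inter> F) + ?h (A - F) \<le> ?h (A \<inter> F) + (?h (G n) + (\<Sum>j. ?h (R (j + n))))"
        by (rule add_left_mono)
      also have "\<dots> \<le> ?h A + (\<Sum>j. ?h (R (j + n)))"
        unfolding add.assoc[symmetric] by (intro add_right_mono G)
      finally show ?thesis .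
    qed
    have "(\<lambda>n. \<Sum>j. ?h (R (j + n))) \<longlonglongrightarrow> 0"
    proof -
      have hf: "?h (R j) \<noteq> \<infinity>" for j
        using R_fin sum_le_suminf[of "\<lambda>j. ?h (R j)" "{j}"] by (auto simp: top_unique)
      define r where "r j = enn2real (?h (R j))" for j
      have hr: "?h (R j) = ennreal (r j)" "0 \<le> r j" for j
        using hf[of j] by (auto simp: r_def less_top)
      have sr: "summable r"
        using R_fin hr by (auto intro!: summable_suminf_not_top)
      have tail: "(\<Sum>j. ?h (R (j + n))) = ennreal (\<Sum>j. r (j + n))" for n
        unfolding hr(1) using sr hr(2) by (intro suminf_ennreal2) (auto simp: summable_iff_shift)
      have "(\<lambda>n. \<Sum>j. r (j + n)) \<longlonglongrightarrow> 0"
        using suminf_exist_split2[OF sr] .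
      then show ?thesis unfolding tail using tendsto_ennrealI by fastforce
    qed
    then have "(\<lambda>n. ?h A + (\<Sum>j. ?h (R (j + n)))) \<longlonglongrightarrow> ?h A + 0"
      by (intro tendsto_intros) auto
    then show ?thesis
      by (intro LIMSEQ_le_const[where X = "\<lambda>n. ?h A + (\<Sum>j. ?h (R (j + n)))"]) (auto simp: bound)
  qed
  have "?h A \<le> ?h (A \<inter> F) + ?h (A - F)" for A
    using hausdorff_outer_Un[of d "A \<inter> F" "A - F"] by (simp add: Int_Diff_Un)
  with main have "?h (A \<inter> F) + ?h (A - F) = ?h A" for A
    by (rule antisym)
  then show ?thesis
    by (auto simp: lambda_system_def Int_commute Diff_eq Collect_neg_eq)
qed

theorem emeasure_hausdorff_measure:
  assumes "A \<in> sets borel"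
  shows "emeasure (hausdorff_measure d) A = hausdorff_outer d A"
proof -
  let ?L = "lambda_system UNIV UNIV (hausdorff_outer d) :: 'a set set"
  have L: "measure_space UNIV ?L (hausdorff_outer d)"
    using sigma_algebra.caratheodory_lemma[OF sigma_algebra_Pow, of UNIV "hausdorff_outer d :: 'a set \<Rightarrow> ennreal"]
      outer_measure_space_hausdorff[of d, where 'a = 'a] by simp
  then have "sigma_algebra UNIV ?L" by (simp add: measure_space_def)
  then have "sigma_sets UNIV (Collect closed) \<subseteq> ?L"
    by (intro sigma_algebra.sigma_sets_subset) (auto intro: closed_in_lambda_system_hausdorff)
  then have "sets borel \<subseteq> ?L" by (simp add: borel_eq_closed)
  with L have "measure_space UNIV (sets borel) (hausdorff_outer d :: 'a set \<Rightarrow> ennreal)"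
    using sets.sigma_algebra_axioms[of borel] by (intro measure_down[OF L]) auto
  then show ?thesis
    using assms unfolding hausdorff_measure_def measure_space_def
    by (intro emeasure_measure_of_sigma) auto
qed


section \<open>Weights and smooth sets in the upper half-space\<close>

text \<open>
  The ambient space is \<open>real ^ 'n\<close>, with \<open>N = CARD('n)\<close>. As index types carry no
  order, the coordinate \<open>x\<^sub>N\<close> is \<open>x $ m\<close> for a distinguished index \<open>m\<close>.
\<close>

definition upper_half :: "'n::finite \<Rightarrow> (real ^ 'n) set" where
  "upper_half m = {x. 0 < x $ m}"

definition weight :: "'n::finite \<Rightarrow> real \<Rightarrow> real \<Rightarrow> real ^ 'n \<Rightarrow> real" where
  "weight m \<alpha> p x = norm x powr p * (x $ m) powr \<alpha>"

text \<open>
  A smooth subset of the half-space: an open set that near each of its boundary points inside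
  the half-space is, in suitable rotated coordinates, the region on one side of the graph of a
  \<open>C\<^sup>1\<close> function \<open>g\<close> over the hyperplane orthogonal to a unit vector \<open>\<nu>\<close>. (The values of
  \<open>g\<close> off that hyperplane are irrelevant.) Nothing is required at boundary points on
  \<open>{x\<^sub>N = 0}\<close>, where the weight vanishes; in particular half-balls are smooth. The set need
  not be bounded or connected.
\<close>

definition smooth_in_half :: "'n::finite \<Rightarrow> (real ^ 'n) set \<Rightarrow> bool" where
  "smooth_in_half m \<Omega> \<longleftrightarrow>
     open \<Omega> \<and> \<Omega> \<subseteq> upper_half m \<and>
     (\<forall>x0 \<in> frontier \<Omega> \<inter> upper_half m.
        \<exists>r > 0. \<exists>\<nu> g G. norm \<nu> = 1 \<and>
          (\<forall>y. GDERIV g y :> G y) \<and> continuous_on UNIV G \<and>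
          (\<forall>x \<in> ball x0 r. x \<in> \<Omega> \<longleftrightarrow> x \<bullet> \<nu> < g (x - (x \<bullet> \<nu>) *\<^sub>R \<nu>)))"

text \<open>
  The boundary integral takes values in \<open>[0, \<infinity>]\<close>, since it may diverge. It ranges over the
  whole topological boundary, including the part on \<open>{x\<^sub>N = 0}\<close>.
\<close>

definition weighted_perimeter :: "'n::finite \<Rightarrow> real \<Rightarrow> real \<Rightarrow> (real ^ 'n) set \<Rightarrow> ennreal" where
  "weighted_perimeter m \<alpha> k \<Omega> =
     (\<integral>\<^sup>+ x \<in> frontier \<Omega>. ennreal (weight m \<alpha> k x) \<partial>hausdorff_measure (CARD('n) - 1))"

definition weighted_volume :: "'n::finite \<Rightarrow> real \<Rightarrow> real \<Rightarrow> (real ^ 'n) set \<Rightarrow> real" where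
  "weighted_volume m \<alpha> l \<Omega> = (LINT x:\<Omega>|lborel. weight m \<alpha> l x)"

definition C_rad :: "'n::finite \<Rightarrow> real \<Rightarrow> real \<Rightarrow> real \<Rightarrow> real" where
  "C_rad m \<alpha> k l =
     (LINT x : sphere 0 1 \<inter> upper_half m | hausdorff_measure (CARD('n) - 1). weight m \<alpha> k x)
     / weighted_volume m \<alpha> l (ball 0 1 \<inter> upper_half m)
         powr ((k + real CARD('n) + \<alpha> - 1) / (l + real CARD('n) + \<alpha>))"

end

theory Submission
  imports Defs "HOL-Library.Nat_Bijection"
begin

text \<open>
  The proof rests on a weighted divergence identity. The field \<open>F x = (norm x powr (k - 1) * (x $
  m) powr \<alpha>) *\<^sub>R x\<close> is homogeneous, and its divergence is \<open>c * weight m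
  \<alpha> (k - 1) x\<close> with \<open>c = k + CARD('n) + \<alpha> - 1\<close>. Its flux through the
  boundary of \<open>\<Omega>\<close> is at most the weighted perimeter, since \<open>norm (F x) =
  weight m \<alpha> k x\<close>. Hence the perimeter is at least \<open>c\<close> times the integral of
  \<open>weight m \<alpha> (k - 1)\<close> over \<open>\<Omega>\<close> (theorem
  \<open>perimeter_ge_volume\<close>), with equality for half-balls, where the field is normal to the
  spherical part of the boundary. Because \<open>l \<le> k - 1\<close>, among all subsets of the
  half-space with a given finite integral of \<open>weight m \<alpha> l\<close> the half-ball has the
  least integral of \<open>weight m \<alpha> (k - 1)\<close> (lemma
  \<open>half_ball_minimizes_moment\<close>). Together these reduce the claim to half-balls, on which
  both sides are explicit.

  The inequality between perimeter and volume is obtained without a divergence theorem. The field is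
  radial, so everything happens ray by ray: since the weighted volume is finite, almost every ray is
  outside \<open>\<Omega>\<close> at arbitrarily large distances. Hence each point of
  \<open>\<Omega>\<close> on it has a boundary point behind it, and the farthest boundary points
  dominate the integral along the ray. What remains is to bound the perimeter below by an integral over
  directions. This follows from the remark that \<open>x \<mapsto> x / norm x\<close> is Lipschitz with
  constant \<open>1 / \<rho>\<close> outside the ball of radius \<open>\<rho>\<close>, and that
  Lipschitz maps expand Hausdorff measure in a controlled way, applied in thin shells (lemmas
  \<open>radial_projection_le\<close> and \<open>perimeter_ge_volume_shells\<close>).

  To connect volumes with Hausdorff measure one needs polar coordinates in which the measure on the unit
  sphere is Hausdorff measure with the right constant. First, in an \<open>n\<close>-dimensional
  Euclidean space the \<open>n\<close>-dimensional Hausdorff measure is Lebesgue measure (theorem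
  \<open>hausdorff_measure_eq_lborel\<close>): one inequality is the isodiametric inequality, proved by
  Steiner symmetrization, and the other is Vitali's covering theorem. Second, near its pole the sphere
  is almost isometric to the tangent hyperplane through the gnomonic projection, which also relates the
  volumes of the cones over both. In the limit of small caps the Hausdorff measure of a subset of the
  sphere is the dimension times the volume of the cone over it (theorem
  \<open>hausdorff_outer_sphere\<close>), and polar coordinates follow (theorem
  \<open>nn_integral_polar\<close>). The total mass of the weight on the half-sphere is a Beta integral
  (theorem \<open>emeasure_angular_measure\<close>).
\<close>

section \<open>Hausdorff measure and Lipschitz maps\<close>

lemma bounded_if_dist_le:
  fixes A :: "'a::metric_space set"
  assumes "\<And>x y. x \<in> A \<Longrightarrow> y \<in> A \<Longrightarrow> dist x y \<le> D"
  shows "bounded A"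
proof (cases "A = {}")
  case False
  then obtain a where "a \<in> A" by blast
  then show ?thesis using assms unfolding bounded_def by blast
qed simp

lemma diameter_le_if_dist_le:
  fixes A :: "'a::metric_space set"
  assumes "\<And>x y. x \<in> A \<Longrightarrow> y \<in> A \<Longrightarrow> dist x y \<le> D" "0 \<le> D"
  shows "diameter A \<le> D"
  using assms by (auto simp: diameter_def intro!: cSUP_least)

lemma hausdorff_size_Lipschitz_image:
  fixes f :: "'a::metric_space \<Rightarrow> 'b::metric_space"
  assumes "L > 0" "bounded C"
    and "\<And>x y. x \<in> C \<Longrightarrow> y \<in> C \<Longrightarrow> dist (f x) (f y) \<le> L * dist x y"
  shows "bounded (f ` C)" "diameter (f ` C) \<le> L * diameter C"
    "hausdorff_size d (f ` C) \<le> ennreal (L ^ d) * hausdorff_size d C"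
proof -
  have *: "dist u v \<le> L * diameter C" if "u \<in> f ` C" "v \<in> f ` C" for u v
  proof -
    from that obtain x y where xy: "x \<in> C" "y \<in> C" "u = f x" "v = f y" by blast
    have "dist (f x) (f y) \<le> L * dist x y" using assms(3) xy by blast
    also have "\<dots> \<le> L * diameter C"
      using \<open>L > 0\<close> diameter_bounded_bound[OF assms(2) xy(1,2)] by simp
    finally show ?thesis using xy by simp
  qed
  show "bounded (f ` C)" using * by (rule bounded_if_dist_le)
  show le: "diameter (f ` C) \<le> L * diameter C"
    by (rule diameter_le_if_dist_le, rule *)
      (assumption | intro mult_nonneg_nonneg less_imp_le[OF assms(1)] diameter_ge_0 assms(2))+
  have "(diameter (f ` C) / 2) ^ d \<le> (L * (diameter C / 2)) ^ d"
    using le \<open>bounded (f ` C)\<close> by (intro power_mono) (auto simp: diameter_ge_0)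
  also have "\<dots> = L ^ d * (diameter C / 2) ^ d" by (rule power_mult_distrib)
  finally have "unit_ball_vol (real d) * (diameter (f ` C) / 2) ^ d
      \<le> L ^ d * (unit_ball_vol (real d) * (diameter C / 2) ^ d)"
    using mult_left_mono[of _ _ "unit_ball_vol (real d)"] by (fastforce simp: mult_ac)
  then show "hausdorff_size d (f ` C) \<le> ennreal (L ^ d) * hausdorff_size d C"
    using \<open>L > 0\<close> by (auto simp: hausdorff_size_def ennreal_mult'[symmetric] intro!: ennreal_leI)
qed

text \<open>
  Each piece of a cover of \<open>A\<close> may be cut down to \<open>A\<close>, where \<open>f\<close> is Lipschitz, and then mapped
  forward. Isometries, scalings and projections are all handled through this estimate.
\<close>

lemma hausdorff_outer_Lipschitz_image:
  fixes f :: "'a::metric_space \<Rightarrow> 'b::metric_space"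
  assumes "L > 0"
    and lip: "\<And>x y. x \<in> A \<Longrightarrow> y \<in> A \<Longrightarrow> dist (f x) (f y) \<le> L * dist x y"
  shows "hausdorff_outer d (f ` A) \<le> ennreal (L ^ d) * hausdorff_outer d A"
proof -
  have pre: "hausdorff_pre d (L * \<delta>) (f ` A) \<le> ennreal (L ^ d) * hausdorff_pre d \<delta> A"
    if "\<delta> > 0" for \<delta>
  proof -
    have "hausdorff_pre d (L * \<delta>) (f ` A) \<le> ennreal (L ^ d) * (\<Sum>i. hausdorff_size d (C i))"
      if C: "A \<subseteq> (\<Union>i. C i)" "\<And>i. bounded (C i)" "\<And>i. diameter (C i) \<le> \<delta>"
      for C :: "nat \<Rightarrow> 'a set"
    proof -
      have *: "bounded (f ` (C i \<inter> A))" "diameter (f ` (C i \<inter> A)) \<le> L * \<delta>"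
        "hausdorff_size d (f ` (C i \<inter> A)) \<le> ennreal (L ^ d) * hausdorff_size d (C i)" for i
      proof -
        have b: "bounded (C i \<inter> A)" using C(2) by blast
        note L = hausdorff_size_Lipschitz_image[OF \<open>L > 0\<close> b, of f]
        have dle: "diameter (C i \<inter> A) \<le> diameter (C i)"
          using C(2) by (intro diameter_subset) auto
        show "bounded (f ` (C i \<inter> A))" using L(1) lip by blast
        have "diameter (f ` (C i \<inter> A)) \<le> L * diameter (C i \<inter> A)" using L(2) lip by blast
        also have "\<dots> \<le> L * \<delta>" using dle C(3)[of i] \<open>L > 0\<close> by simp
        finally show "diameter (f ` (C i \<inter> A)) \<le> L * \<delta>" .
        have "hausdorff_size d (f ` (C i \<inter> A)) \<le> ennreal (L ^ d) * hausdorff_size d (C i \<inter> A)"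
          using L(3) lip by blast
        also have "hausdorff_size d (C i \<inter> A) \<le> hausdorff_size d (C i)"
          using dle b by (auto simp: hausdorff_size_def diameter_ge_0
              intro!: ennreal_leI mult_left_mono power_mono)
        finally show "hausdorff_size d (f ` (C i \<inter> A)) \<le> ennreal (L ^ d) * hausdorff_size d (C i)"
          by (simp add: mult_left_mono)
      qed
      have "hausdorff_pre d (L * \<delta>) (f ` A) \<le> (\<Sum>i. hausdorff_size d (f ` (C i \<inter> A)))"
        using * C(1) by (intro hausdorff_pre_le) fastforce+
      also have "\<dots> \<le> (\<Sum>i. ennreal (L ^ d) * hausdorff_size d (C i))"
        using * by (intro suminf_le) auto
      finally show ?thesis by simp
    qed
    then have "ennreal (1 / L ^ d) * hausdorff_pre d (L * \<delta>) (f ` A)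
        \<le> ennreal (1 / L ^ d) * (ennreal (L ^ d) * (\<Sum>i. hausdorff_size d (C i)))"
      if "A \<subseteq> (\<Union>i. C i) \<and> (\<forall>i. bounded (C i) \<and> diameter (C i) \<le> \<delta>)" for C
      using that by (intro mult_left_mono) auto
    moreover have inv: "ennreal (1 / L ^ d) * ennreal (L ^ d) = 1"
      using \<open>L > 0\<close> by (simp flip: ennreal_mult')
    ultimately have "ennreal (1 / L ^ d) * hausdorff_pre d (L * \<delta>) (f ` A) \<le> hausdorff_pre d \<delta> A"
      unfolding hausdorff_pre_def[of d \<delta> A] by (intro INF_greatest) (simp flip: mult.assoc)
    then have "ennreal (L ^ d) * (ennreal (1 / L ^ d) * hausdorff_pre d (L * \<delta>) (f ` A))
        \<le> ennreal (L ^ d) * hausdorff_pre d \<delta> A"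
      by (rule mult_left_mono) simp
    then show ?thesis using inv by (simp add: mult.assoc[symmetric] mult.commute[of "ennreal (L ^ d)" "ennreal (1 / L ^ d)"])
  qed
  show ?thesis
    unfolding hausdorff_outer_def[of d "f ` A"]
  proof (rule SUP_least)
    fix \<delta> :: real assume "\<delta> \<in> {0<..}"
    then have "\<delta> / L > 0" using \<open>L > 0\<close> by simp
    from pre[OF this] have "hausdorff_pre d \<delta> (f ` A) \<le> ennreal (L ^ d) * hausdorff_pre d (\<delta> / L) A"
      using \<open>L > 0\<close> by simp
    also have "\<dots> \<le> ennreal (L ^ d) * hausdorff_outer d A"
      unfolding hausdorff_outer_def using \<open>\<delta> / L > 0\<close> by (intro mult_left_mono SUP_upper) auto
    finally show "hausdorff_pre d \<delta> (f ` A) \<le> ennreal (L ^ d) * hausdorff_outer d A" .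
  qed
qed

lemma hausdorff_outer_isometry_image:
  fixes f :: "'a::metric_space \<Rightarrow> 'b::metric_space"
  assumes "\<And>x y. dist (f x) (f y) = dist x y"
  shows "hausdorff_outer d (f ` A) = hausdorff_outer d A"
proof (rule antisym)
  show "hausdorff_outer d (f ` A) \<le> hausdorff_outer d A"
    using hausdorff_outer_Lipschitz_image[of 1 A f d] assms by simp
  have "inj f" by (metis assms dist_eq_0_iff injI)
  then show "hausdorff_outer d A \<le> hausdorff_outer d (f ` A)"
    using hausdorff_outer_Lipschitz_image[of 1 "f ` A" "inv f" d] assms
    by (force simp: image_comp)
qed

section \<open>The isodiametric inequality\<close>

text \<open>
  The points of \<open>A\<close> on the line through \<open>x\<close> in direction \<open>i\<close> are recorded by their \<open>i\<close>-th coordinate,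
  so that parallel chords can be compared as sets of reals.
\<close>

definition chord :: "'a::euclidean_space \<Rightarrow> 'a set \<Rightarrow> 'a \<Rightarrow> real set" where
  "chord i A x = {t. x + (t - x \<bullet> i) *\<^sub>R i \<in> A}"

text \<open>
  Steiner symmetrization: every chord is replaced by an open interval of the same measure centred
  on the hyperplane orthogonal to \<open>i\<close>.
\<close>

definition steiner :: "'a::euclidean_space \<Rightarrow> 'a set \<Rightarrow> 'a set" where
  "steiner i A = {x. ennreal (2 * \<bar>x \<bullet> i\<bar>) < emeasure lborel (chord i A x)}"

definition reflect :: "'a::euclidean_space \<Rightarrow> 'a \<Rightarrow> 'a" where
  "reflect i x = x - (2 * (x \<bullet> i)) *\<^sub>R i"

lemma chord_shift:
  assumes "i \<in> Basis"
  shows "chord i A (x + t *\<^sub>R i) = chord i A x"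
  using assms by (auto simp: chord_def algebra_simps)

lemma borel_measurable_emeasure_chord [measurable]:
  assumes [measurable]: "A \<in> sets borel"
  shows "(\<lambda>x. emeasure lborel (chord i A x)) \<in> borel_measurable borel"
proof -
  have [measurable]: "(\<lambda>(x, t). x + (t - x \<bullet> i) *\<^sub>R i) \<in> borel \<Otimes>\<^sub>M lborel \<rightarrow>\<^sub>M borel"
    by (simp add: split_beta)
  have "{p. fst p + (snd p - fst p \<bullet> i) *\<^sub>R i \<in> A} \<in> sets (borel \<Otimes>\<^sub>M lborel)"
    using measurable_sets[OF \<open>(\<lambda>(x, t). x + (t - x \<bullet> i) *\<^sub>R i) \<in> borel \<Otimes>\<^sub>M lborel \<rightarrow>\<^sub>M borel\<close> assms]
    by (simp add: space_pair_measure vimage_def split_beta)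
  from lborel.measurable_emeasure_Pair[OF this] show ?thesis
    by (simp add: chord_def vimage_def)
qed

lemma sets_steiner [measurable]:
  assumes "A \<in> sets borel"
  shows "steiner i A \<in> sets borel"
proof -
  define c where "c = (\<lambda>x. emeasure lborel (chord i A x))"
  have [measurable]: "c \<in> borel_measurable borel"
    unfolding c_def using assms by (rule borel_measurable_emeasure_chord)
  have "{x. ennreal (2 * \<bar>x \<bullet> i\<bar>) < c x} \<in> sets borel" by measurable
  then show ?thesis by (simp add: steiner_def c_def)
qed

text \<open>
  Fubini for a single coordinate direction of an arbitrary Euclidean space, via the description
  of Lebesgue measure as a product measure over the basis.
\<close>

lemma emeasure_lborel_chord:
  fixes A :: "'a::euclidean_space set"
  assumes i: "i \<in> Basis" and [measurable]: "A \<in> sets borel"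
  shows "emeasure lborel A =
    (\<integral>\<^sup>+g. emeasure lborel (chord i A (\<Sum>b\<in>Basis - {i}. g b *\<^sub>R b)) \<partial>PiM (Basis - {i}) (\<lambda>_. lborel))"
proof -
  interpret product_sigma_finite "\<lambda>_::'a. lborel :: real measure" ..
  have [measurable]: "(\<lambda>f. \<Sum>b\<in>Basis. f b *\<^sub>R b) \<in> PiM Basis (\<lambda>_. lborel) \<rightarrow>\<^sub>M (borel :: 'a measure)"
    by measurable
  have meas: "(\<lambda>f. indicator A (\<Sum>b\<in>Basis. f b *\<^sub>R b) :: ennreal) \<in> borel_measurable (PiM Basis (\<lambda>_. lborel))"
    by measurable
  have sum: "(\<Sum>b\<in>Basis. (g(i := t)) b *\<^sub>R b) = (\<Sum>b\<in>Basis - {i}. g b *\<^sub>R b) + t *\<^sub>R i" for g t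
  proof -
    have "(\<Sum>b\<in>Basis - {i}. (g(i := t)) b *\<^sub>R b) = (\<Sum>b\<in>Basis - {i}. g b *\<^sub>R b)"
      by (intro sum.cong) auto
    then show ?thesis using i by (simp add: sum.remove add.commute)
  qed
  have "emeasure lborel A = (\<integral>\<^sup>+x. indicator A x \<partial>distr (PiM Basis (\<lambda>_. lborel)) borel (\<lambda>f. \<Sum>b\<in>Basis. f b *\<^sub>R b))"
    by (subst lborel_eq[symmetric]) simp
  also have "\<dots> = (\<integral>\<^sup>+f. indicator A (\<Sum>b\<in>Basis. f b *\<^sub>R b) \<partial>PiM Basis (\<lambda>_. lborel))"
    by (subst nn_integral_distr) auto
  also have "\<dots> = (\<integral>\<^sup>+f. indicator A (\<Sum>b\<in>Basis. f b *\<^sub>R b) \<partial>PiM (insert i (Basis - {i})) (\<lambda>_. lborel))"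
    by (simp only: insert_Diff[OF i])
  also have "\<dots> = (\<integral>\<^sup>+g. (\<integral>\<^sup>+t. indicator A (\<Sum>b\<in>Basis. (g(i := t)) b *\<^sub>R b) \<partial>lborel)
      \<partial>PiM (Basis - {i}) (\<lambda>_. lborel))"
    using meas by (intro product_nn_integral_insert) (simp_all only: insert_Diff[OF i], simp_all)
  also have "\<dots> = (\<integral>\<^sup>+g. emeasure lborel (chord i A (\<Sum>b\<in>Basis - {i}. g b *\<^sub>R b)) \<partial>PiM (Basis - {i}) (\<lambda>_. lborel))"
  proof (rule nn_integral_cong)
    fix g
    let ?z = "\<Sum>b\<in>Basis - {i}. g b *\<^sub>R b"
    have z: "?z \<bullet> i = 0"
      using i by (auto simp: inner_sum_left inner_Basis intro!: sum.neutral)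
    have [measurable]: "chord i A ?z \<in> sets borel"
      unfolding chord_def by measurable
    have "(\<integral>\<^sup>+t. indicator A (\<Sum>b\<in>Basis. (g(i := t)) b *\<^sub>R b) \<partial>lborel) = (\<integral>\<^sup>+t. indicator (chord i A ?z) t \<partial>lborel)"
      unfolding sum by (intro nn_integral_cong) (simp add: chord_def z indicator_def)
    then show "(\<integral>\<^sup>+t. indicator A (\<Sum>b\<in>Basis. (g(i := t)) b *\<^sub>R b) \<partial>lborel) = emeasure lborel (chord i A ?z)"
      by simp
  qed
  finally show ?thesis .
qed

lemma emeasure_centered_interval: "emeasure lborel {t::real. ennreal (2 * \<bar>t\<bar>) < c} = c"
proof (cases c)
  case (real r)
  have "{t::real. ennreal (2 * \<bar>t\<bar>) < c} = {- r / 2 <..< r / 2}"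
    using real by (auto simp: ennreal_less_iff)
  then show ?thesis using real by simp
qed (simp add: top_unique)

lemma emeasure_steiner:
  assumes i: "i \<in> Basis" and A: "A \<in> sets borel"
  shows "emeasure lborel (steiner i A) = emeasure lborel A"
proof -
  have "chord i (steiner i A) x = {t. ennreal (2 * \<bar>t\<bar>) < emeasure lborel (chord i A x)}" for x
  proof -
    have "(x + (t - x \<bullet> i) *\<^sub>R i) \<bullet> i = t" for t
      using i by (simp add: inner_add_left)
    then have "x + (t - x \<bullet> i) *\<^sub>R i \<in> steiner i A
        \<longleftrightarrow> ennreal (2 * \<bar>t\<bar>) < emeasure lborel (chord i A x)" for t
      by (simp add: steiner_def chord_shift[OF i])
    then show ?thesis by (simp add: chord_def[of i "steiner i A"])
  qed
  then show ?thesis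
    using A i by (simp add: emeasure_lborel_chord[of i] emeasure_centered_interval)
qed

lemma steiner_reflect_self:
  assumes "i \<in> Basis"
  shows "reflect i x \<in> steiner i A \<longleftrightarrow> x \<in> steiner i A"
proof -
  have "chord i A (reflect i x) = chord i A x"
    using chord_shift[OF assms, of A x "- (2 * (x \<bullet> i))"] by (simp add: reflect_def)
  then show ?thesis using assms by (simp add: steiner_def reflect_def inner_diff_left)
qed

text \<open>
  A reflection symmetry gained in an earlier symmetrization survives later ones, because the
  reflection permutes chords of equal length.
\<close>

lemma steiner_reflect_other:
  assumes ij: "i \<in> Basis" "j \<in> Basis" "i \<noteq> j" and sym: "\<And>x. reflect j x \<in> A \<longleftrightarrow> x \<in> A"
  shows "reflect j x \<in> steiner i A \<longleftrightarrow> x \<in> steiner i A"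
proof -
  have o: "i \<bullet> j = 0" "j \<bullet> i = 0" using ij by (auto simp: inner_Basis)
  have "reflect j x + (t - reflect j x \<bullet> i) *\<^sub>R i = reflect j (x + (t - x \<bullet> i) *\<^sub>R i)" for t
    using o by (simp add: reflect_def inner_diff_left inner_add_left algebra_simps)
  then have "chord i A (reflect j x) = chord i A x"
    by (simp add: chord_def sym)
  then show ?thesis using o by (simp add: steiner_def reflect_def inner_diff_left)
qed

text \<open>
  Symmetrization does not increase the diameter. Only the numbers \<open>s\<close>, \<open>s'\<close>, \<open>t\<close>, \<open>t'\<close> on two chords
  matter: centring two intervals cannot increase the largest distance between their points.
\<close>

lemma steiner_dist_le:
  fixes A :: "'a::euclidean_space set"
  assumes i: "i \<in> Basis" and D: "\<And>x y. x \<in> A \<Longrightarrow> y \<in> A \<Longrightarrow> dist x y \<le> D"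
    and xy: "x \<in> steiner i A" "y \<in> steiner i A"
  shows "dist x y \<le> D"
proof -
  have norm2: "(norm z)\<^sup>2 = (z \<bullet> i)\<^sup>2 + (norm (z - (z \<bullet> i) *\<^sub>R i))\<^sup>2" for z
    using i unfolding power2_norm_eq_inner
    by (simp add: inner_diff_left inner_diff_right inner_commute power2_eq_square)
  define w where "w = (x - y) - ((x - y) \<bullet> i) *\<^sub>R i"
  \<comment> \<open>Two points on the two chords differ by \<open>w\<close> across the direction \<open>i\<close>, whatever their heights.\<close>
  have chords: "(s - t)\<^sup>2 + (norm w)\<^sup>2 \<le> D\<^sup>2" if "s \<in> chord i A x" "t \<in> chord i A y" for s t
  proof -
    let ?z = "(x + (s - x \<bullet> i) *\<^sub>R i) - (y + (t - y \<bullet> i) *\<^sub>R i)"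
    have zi: "?z \<bullet> i = s - t" using i by (simp add: inner_diff_left inner_add_left)
    have "?z - (?z \<bullet> i) *\<^sub>R i = w"
      unfolding zi by (simp add: w_def algebra_simps inner_diff_left)
    then have "(norm ?z)\<^sup>2 = (s - t)\<^sup>2 + (norm w)\<^sup>2" using norm2[of ?z] zi by simp
    moreover have "norm ?z \<le> D"
      using D that by (fastforce simp: chord_def dist_norm)
    then have "(norm ?z)\<^sup>2 \<le> D\<^sup>2" by (intro power_mono) auto
    ultimately show ?thesis by simp
  qed
  \<comment> \<open>A chord of measure more than \<open>2 * \<bar>z \<bullet> i\<bar>\<close> has two points that far apart: otherwise it
      would fit between its infimum and its supremum.\<close>
  have ne: "\<exists>s t. s \<in> chord i A z \<and> t \<in> chord i A z \<and> 2 * \<bar>z \<bullet> i\<bar> < t - s" if "z \<in> steiner i A" for z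
  proof (rule ccontr)
    assume neg: "\<not> ?thesis"
    from that have less: "ennreal (2 * \<bar>z \<bullet> i\<bar>) < emeasure lborel (chord i A z)"
      by (simp add: steiner_def)
    then have "chord i A z \<noteq> {}" by auto
    then obtain s0 where s0: "s0 \<in> chord i A z" by blast
    have le: "t - s \<le> 2 * \<bar>z \<bullet> i\<bar>" if "s \<in> chord i A z" "t \<in> chord i A z" for s t
      using neg that by (meson not_le)
    have bdd: "bdd_below (chord i A z)" "bdd_above (chord i A z)"
      using le[OF _ s0] le[OF s0] by (force intro!: bdd_belowI[of _ "s0 - 2 * \<bar>z \<bullet> i\<bar>"]
          bdd_aboveI[of _ "s0 + 2 * \<bar>z \<bullet> i\<bar>"])+
    have sub: "chord i A z \<subseteq> {Inf (chord i A z) .. Sup (chord i A z)}"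
      using bdd by (auto intro: cInf_lower cSup_upper)
    have "Sup (chord i A z) \<le> 2 * \<bar>z \<bullet> i\<bar> + s" if "s \<in> chord i A z" for s
      using s0 le[OF that] by (intro cSup_least) (auto simp: algebra_simps)
    then have "Sup (chord i A z) - 2 * \<bar>z \<bullet> i\<bar> \<le> Inf (chord i A z)"
      using s0 by (intro cInf_greatest) (auto simp: algebra_simps)
    moreover have "emeasure lborel (chord i A z) \<le> emeasure lborel {Inf (chord i A z) .. Sup (chord i A z)}"
      using sub by (intro emeasure_mono) auto
    ultimately have "emeasure lborel (chord i A z) \<le> ennreal (2 * \<bar>z \<bullet> i\<bar>)"
      by (auto simp: emeasure_lborel_Icc_eq split: if_splits elim!: order_trans intro!: ennreal_leI)
    then show False using less by simp
  qed
  obtain s s' where s: "s \<in> chord i A x" "s' \<in> chord i A x" "2 * \<bar>x \<bullet> i\<bar> < s' - s" using ne xy by blast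
  obtain t t' where t: "t \<in> chord i A y" "t' \<in> chord i A y" "2 * \<bar>y \<bullet> i\<bar> < t' - t" using ne xy by blast
  \<comment> \<open>Pair the top of one chord with the bottom of the other. The two gaps add up to the sum of
      the two lengths, so the larger one is at least the mean.\<close>
  have "\<bar>x \<bullet> i - y \<bullet> i\<bar> \<le> \<bar>s' - t\<bar> \<or> \<bar>x \<bullet> i - y \<bullet> i\<bar> \<le> \<bar>s - t'\<bar>" using s(3) t(3) by linarith
  then have "(x \<bullet> i - y \<bullet> i)\<^sup>2 + (norm w)\<^sup>2 \<le> D\<^sup>2"
    using chords[OF s(2) t(1)] chords[OF s(1) t(2)] unfolding abs_le_square_iff by linarith
  then have "(dist x y)\<^sup>2 \<le> D\<^sup>2"
    using norm2[of "x - y"] by (simp add: w_def dist_norm inner_diff_left)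
  moreover have "D \<ge> 0"
  proof -
    have "x + (s - x \<bullet> i) *\<^sub>R i \<in> A" using s(1) by (simp add: chord_def)
    from D[OF this this] show ?thesis by simp
  qed
  ultimately show ?thesis by (simp add: abs_le_square_iff[symmetric])
qed

text \<open>
  Symmetrizing in all coordinate directions keeps the measure, does not increase the diameter and
  makes the set symmetric about the origin. A centrally symmetric set of diameter at most \<open>D\<close> lies
  in the ball of radius \<open>D / 2\<close>.
\<close>

lemma isodiametric:
  fixes A :: "'a::euclidean_space set"
  assumes A: "A \<in> sets borel" and D: "\<And>x y. x \<in> A \<Longrightarrow> y \<in> A \<Longrightarrow> dist x y \<le> D" and "0 \<le> D"
  shows "emeasure lborel A \<le> ennreal (unit_ball_vol DIM('a) * (D / 2) ^ DIM('a))"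
proof -
  have "\<exists>S. S \<in> sets borel \<and> emeasure lborel S = emeasure lborel A \<and> (\<forall>x\<in>S. \<forall>y\<in>S. dist x y \<le> D)
      \<and> (\<forall>j\<in>J. \<forall>x. reflect j x \<in> S \<longleftrightarrow> x \<in> S)" if "finite J" "J \<subseteq> (Basis :: 'a set)" for J
    using that
  proof (induction J)
    case empty
    then show ?case using A D by blast
  next
    case (insert i J)
    then obtain S where S: "S \<in> sets borel" "emeasure lborel S = emeasure lborel A"
        "\<And>x y. x \<in> S \<Longrightarrow> y \<in> S \<Longrightarrow> dist x y \<le> D" "\<And>j x. j \<in> J \<Longrightarrow> reflect j x \<in> S \<longleftrightarrow> x \<in> S"
      by auto
    have i: "i \<in> Basis" using insert by simp
    have sym: "reflect j x \<in> steiner i S \<longleftrightarrow> x \<in> steiner i S" if "j \<in> insert i J" for j x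
    proof (cases "j = i")
      case True
      then show ?thesis using steiner_reflect_self[OF i] by simp
    next
      case False
      then show ?thesis using that insert.prems S(4) i by (intro steiner_reflect_other) auto
    qed
    show ?case
      using S sym i emeasure_steiner[OF i S(1)] steiner_dist_le[OF i S(3)]
      by (intro exI[of _ "steiner i S"]) auto
  qed
  from this[OF finite_Basis subset_refl] obtain S :: "'a set"
    where S: "S \<in> sets borel" "emeasure lborel S = emeasure lborel A"
      "\<And>x y. x \<in> S \<Longrightarrow> y \<in> S \<Longrightarrow> dist x y \<le> D" "\<And>j x. j \<in> Basis \<Longrightarrow> reflect j x \<in> S \<longleftrightarrow> x \<in> S"
    by blast
  \<comment> \<open>The reflections in all coordinate hyperplanes compose to \<open>x \<mapsto> - x\<close>.\<close>
  have neg: "- x \<in> S" if "x \<in> S" for x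
  proof -
    have "x - (\<Sum>j\<in>J. (2 * (x \<bullet> j)) *\<^sub>R j) \<in> S" if "finite J" "J \<subseteq> Basis" for J
      using that
    proof (induction J)
      case (insert j J)
      let ?z = "x - (\<Sum>j\<in>J. (2 * (x \<bullet> j)) *\<^sub>R j)"
      have "(\<Sum>k\<in>J. (2 * (x \<bullet> k)) *\<^sub>R k) \<bullet> j = 0"
        using insert by (auto simp: inner_sum_left inner_Basis intro!: sum.neutral)
      then have "reflect j ?z = x - (\<Sum>j\<in>insert j J. (2 * (x \<bullet> j)) *\<^sub>R j)"
        using insert by (simp add: reflect_def inner_diff_left)
      then show ?case using insert S(4)[of j ?z] by auto
    qed (simp add: \<open>x \<in> S\<close>)
    from this[OF finite_Basis subset_refl]
    have "x - 2 *\<^sub>R (\<Sum>j\<in>Basis. (x \<bullet> j) *\<^sub>R j) \<in> S"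
      by (simp add: scaleR_sum_right)
    then show ?thesis by (simp add: euclidean_representation scaleR_2)
  qed
  have "S \<subseteq> cball 0 (D / 2)"
  proof
    fix x assume "x \<in> S"
    with neg have "dist x (- x) \<le> D" using S(3) by blast
    moreover have "dist x (- x) = 2 * norm x" by (simp add: dist_norm flip: scaleR_2)
    ultimately show "x \<in> cball 0 (D / 2)" by simp
  qed
  then have "emeasure lborel S \<le> emeasure lborel (cball (0::'a) (D / 2))"
    by (intro emeasure_mono) auto
  also have "\<dots> = ennreal (unit_ball_vol DIM('a) * (D / 2) ^ DIM('a))"
    using \<open>0 \<le> D\<close> by (intro emeasure_cball) simp
  finally show ?thesis using S(2) by simp
qed

section \<open>Hausdorff measure of full dimension\<close>

text \<open>
  This is where the normalisation of Hausdorff measure is felt from below: the isodiametric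
  inequality says that a piece of a cover is counted with at least its volume.
\<close>

lemma lborel_le_hausdorff_outer:
  fixes A :: "'a::euclidean_space set"
  assumes A: "A \<in> sets borel"
  shows "emeasure lborel A \<le> hausdorff_outer DIM('a) A"
proof -
  have "emeasure lborel A \<le> (\<Sum>i. hausdorff_size DIM('a) (C i))"
    if C: "A \<subseteq> (\<Union>i. C i)" "\<And>i. bounded (C i)" for C :: "nat \<Rightarrow> 'a set"
  proof -
    have "emeasure lborel (closure (C i)) \<le> hausdorff_size DIM('a) (C i)" for i
    proof (cases "C i = {}")
      case False
      have "dist x y \<le> diameter (C i)" if "x \<in> closure (C i)" "y \<in> closure (C i)" for x y
        using diameter_bounded_bound[OF _ that] C(2)[of i] by (simp add: bounded_closure diameter_closure)
      then have "emeasure lborel (closure (C i))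
          \<le> ennreal (unit_ball_vol DIM('a) * (diameter (C i) / 2) ^ DIM('a))"
        using C(2)[of i] by (intro isodiametric) (auto simp: diameter_ge_0)
      then show ?thesis using False by (simp add: hausdorff_size_def)
    qed simp
    note size = this
    have "emeasure lborel A \<le> emeasure lborel (\<Union>i. closure (C i))"
      using C(1) closure_subset by (intro emeasure_mono) (blast, auto)
    also have "\<dots> \<le> (\<Sum>i. emeasure lborel (closure (C i)))"
      by (intro emeasure_subadditive_countably) auto
    also have "\<dots> \<le> (\<Sum>i. hausdorff_size DIM('a) (C i))"
      using size by (intro suminf_le) auto
    finally show ?thesis .
  qed
  then have "emeasure lborel A \<le> hausdorff_pre DIM('a) 1 A"
    unfolding hausdorff_pre_def by (intro INF_greatest) auto
  also have "\<dots> \<le> hausdorff_outer DIM('a) A"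
    unfolding hausdorff_outer_def by (intro SUP_upper) auto
  finally show ?thesis .
qed

lemma hausdorff_pre_countable_cover:
  fixes A :: "'a::metric_space set"
  assumes "countable \<C>" "A \<subseteq> \<Union>\<C>" "\<And>C. C \<in> \<C> \<Longrightarrow> bounded C \<and> diameter C \<le> \<delta>" "0 \<le> \<delta>"
  shows "hausdorff_pre d \<delta> A \<le> (\<integral>\<^sup>+C. hausdorff_size d C \<partial>count_space \<C>)"
proof -
  obtain e :: "'a set \<Rightarrow> nat" where e: "inj_on e \<C>" using assms(1) by (auto simp: countable_def)
  define D where "D n = (if n \<in> e ` \<C> then inv_into \<C> e n else {})" for n
  have D: "bounded (D n) \<and> diameter (D n) \<le> \<delta>" for n
  proof (cases "n \<in> e ` \<C>")
    case True
    then have "D n \<in> \<C>" unfolding D_def by (simp add: inv_into_into)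
    then show ?thesis using assms(3) by blast
  next
    case False
    then show ?thesis using assms(4) by (simp add: D_def)
  qed
  have "C \<subseteq> D (e C)" if "C \<in> \<C>" for C using that e by (simp add: D_def)
  then have "\<Union>\<C> \<subseteq> (\<Union>n. D n)" by fast
  with assms(2) have "A \<subseteq> (\<Union>n. D n)" by (rule order_trans)
  then have "hausdorff_pre d \<delta> A \<le> (\<Sum>n. hausdorff_size d (D n))"
    using D by (intro hausdorff_pre_le) auto
  also have "\<dots> = (\<integral>\<^sup>+n. hausdorff_size d (D n) \<partial>count_space UNIV)"
    by (simp add: nn_integral_count_space_nat)
  also have "\<dots> = (\<integral>\<^sup>+n. hausdorff_size d (inv_into \<C> e n) \<partial>count_space (e ` \<C>))"
    by (subst nn_integral_count_space_indicator)
       (auto simp: D_def indicator_def intro!: nn_integral_cong)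
  also have "\<dots> = (\<integral>\<^sup>+C. hausdorff_size d (inv_into \<C> e (e C)) \<partial>count_space \<C>)"
    by (rule nn_integral_bij_count_space[symmetric]) (rule inj_on_imp_bij_betw[OF e])
  also have "\<dots> = (\<integral>\<^sup>+C. hausdorff_size d C \<partial>count_space \<C>)"
    using e by (intro nn_integral_cong) simp
  finally show ?thesis .
qed

lemma nn_integral_emeasure_disjoint_family:
  assumes "countable \<C>" "\<And>C. C \<in> \<C> \<Longrightarrow> C \<in> sets M" "disjoint \<C>"
  shows "(\<integral>\<^sup>+C. emeasure M C \<partial>count_space \<C>) = emeasure M (\<Union>\<C>)"
  using emeasure_UN_countable[of \<C> "\<lambda>C. C" M] assms
  by (auto simp: disjoint_family_on_def disjoint_def)

text \<open>
  A Lebesgue null set is covered by dyadic cubes of small total volume. For a cube the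
  Hausdorff size is a constant multiple of the volume, and a small volume forces a small diameter.
\<close>

lemma hausdorff_pre_negligible:
  fixes Z :: "'a::euclidean_space set"
  assumes Z: "negligible Z" "bounded Z" and "\<delta> > 0"
  shows "hausdorff_pre DIM('a) \<delta> Z = 0"
proof -
  let ?n = "DIM('a)"
  let ?c = "unit_ball_vol ?n * (real ?n / 2) ^ ?n"
  have c: "?c \<ge> 0" by simp
  obtain R where R: "\<And>x. x \<in> Z \<Longrightarrow> norm x \<le> R" "R > 0" using Z(2) by (auto simp: bounded_pos)
  let ?b = "R *\<^sub>R One :: 'a"
  have Zb: "Z \<subseteq> cbox (- ?b) ?b"
  proof
    fix x assume "x \<in> Z"
    have "\<bar>x \<bullet> i\<bar> \<le> R" if "i \<in> Basis" for i using Basis_le_norm[OF that, of x] R(1)[OF \<open>x \<in> Z\<close>] by simp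
    then show "x \<in> cbox (- ?b) ?b" by (auto simp: mem_box abs_le_iff) (metis minus_le_iff)
  qed
  have "hausdorff_pre ?n \<delta> Z \<le> ennreal (?c * e)" if e: "0 < e" "e \<le> (\<delta> / ?n) ^ ?n" for e
  proof -
    have "Z \<in> lmeasurable" "measure lebesgue Z = 0"
      using Z(1) by (simp_all add: negligible_imp_measurable negligible_imp_measure0)
    with measurable_outer_intervals_bounded[OF _ Zb e(1)] obtain \<D> where D: "countable \<D>"
        "\<And>K. K \<in> \<D> \<Longrightarrow> K \<noteq> {} \<and> (\<exists>c d. K = cbox c d)"
        "pairwise (\<lambda>A B. interior A \<inter> interior B = {}) \<D>"
        "\<And>u v. cbox u v \<in> \<D> \<Longrightarrow> \<exists>n. \<forall>i \<in> Basis. v \<bullet> i - u \<bullet> i = (?b \<bullet> i - (- ?b) \<bullet> i)/2^n"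
        "Z \<subseteq> \<Union>\<D>" "\<Union>\<D> \<in> lmeasurable" "measure lebesgue (\<Union>\<D>) \<le> e"
      by (metis (no_types, lifting) add_0)
    have cube: "\<exists>s u. 0 \<le> s \<and> K = cbox u (u + s *\<^sub>R One) \<and> emeasure lborel (interior K) = ennreal (s ^ ?n)"
      if KD: "K \<in> \<D>" for K
    proof -
      obtain u v where K: "K = cbox u v" using D(2)[OF KD] by blast
      obtain n where n: "\<And>i. i \<in> Basis \<Longrightarrow> v \<bullet> i - u \<bullet> i = (?b \<bullet> i - (- ?b) \<bullet> i)/2^n"
        using D(4) KD K by blast
      define s where "s = 2 * R / 2 ^ n"
      have v: "v = u + s *\<^sub>R One"
      proof (rule euclidean_eqI)
        fix i :: 'a assume i: "i \<in> Basis"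
        then show "v \<bullet> i = (u + s *\<^sub>R One) \<bullet> i"
          using n[OF i] by (simp add: inner_add_left s_def inner_sum_left_Basis)
      qed
      have "s \<ge> 0" using R by (simp add: s_def)
      have "emeasure lborel (interior K) = ennreal (\<Prod>i\<in>(Basis::'a set). s)"
        using \<open>s \<ge> 0\<close> unfolding K v interior_cbox
        by (subst emeasure_lborel_box) (auto simp: inner_add_left inner_sum_left_Basis)
      then show ?thesis using K v \<open>s \<ge> 0\<close> by auto
    qed
    have intsub: "emeasure lborel (interior K) \<le> ennreal e" if "K \<in> \<D>" for K
    proof -
      have "emeasure lebesgue (interior K) \<le> emeasure lebesgue (\<Union>\<D>)"
        using that D(6) interior_subset by (intro emeasure_mono) (blast, auto)
      also have "\<dots> \<le> ennreal e" using D(6,7) by (simp add: emeasure_eq_measure2 ennreal_leI)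
      finally show ?thesis by simp
    qed
    have K: "bounded K \<and> diameter K \<le> \<delta>"
      "hausdorff_size ?n K \<le> ennreal ?c * emeasure lborel (interior K)" if KD: "K \<in> \<D>" for K
    proof -
      obtain s u where s: "0 \<le> s" "K = cbox u (u + s *\<^sub>R One)" "emeasure lborel (interior K) = ennreal (s ^ ?n)"
        using cube[OF KD] by blast
      have "dist x y \<le> real ?n * s" if "x \<in> K" "y \<in> K" for x y
      proof -
        have "dist x y \<le> (\<Sum>i\<in>Basis. \<bar>(x - y) \<bullet> i\<bar>)" unfolding dist_norm by (rule norm_le_l1)
        also have "\<dots> \<le> (\<Sum>i\<in>(Basis::'a set). s)"
          using that unfolding s(2) mem_box
          by (intro sum_mono) (force simp: inner_diff_left inner_add_left inner_sum_left_Basis abs_le_iff)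
        finally show ?thesis by simp
      qed
      then have dia: "diameter K \<le> real ?n * s" using s(1) by (intro diameter_le_if_dist_le) auto
      have bK: "bounded K" using s by simp
      have "s ^ ?n \<le> (\<delta> / ?n) ^ ?n"
        using intsub[OF KD] e s by (simp add: ennreal_le_iff)
      then have "s \<le> \<delta> / ?n" using \<open>\<delta> > 0\<close> by (intro power_le_imp_le_base[of s "?n - 1"]) (auto simp: DIM_positive)
      then have "real ?n * s \<le> \<delta>" by (simp add: field_simps)
      then show "bounded K \<and> diameter K \<le> \<delta>" using dia bK by simp
      have "(diameter K / 2) ^ ?n \<le> (real ?n / 2 * s) ^ ?n"
        using dia bK by (intro power_mono) (auto simp: diameter_ge_0)
      also have "\<dots> = (real ?n / 2) ^ ?n * s ^ ?n" by (rule power_mult_distrib)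
      finally have "unit_ball_vol ?n * (diameter K / 2) ^ ?n \<le> ?c * s ^ ?n"
        using mult_left_mono[of _ _ "unit_ball_vol ?n"] by (fastforce simp: mult.assoc)
      then show "hausdorff_size ?n K \<le> ennreal ?c * emeasure lborel (interior K)"
        unfolding s(3) using c by (auto simp: hausdorff_size_def ennreal_mult'[symmetric] intro!: ennreal_leI)
    qed
    have "hausdorff_pre ?n \<delta> Z \<le> (\<integral>\<^sup>+K. hausdorff_size ?n K \<partial>count_space \<D>)"
      using D K(1) \<open>\<delta> > 0\<close> by (intro hausdorff_pre_countable_cover) auto
    also have "\<dots> \<le> (\<integral>\<^sup>+K. ennreal ?c * emeasure lborel (interior K) \<partial>count_space \<D>)"
      using K(2) by (intro nn_integral_mono) simp
    also have "\<dots> = ennreal ?c * (\<integral>\<^sup>+K. emeasure lborel (interior K) \<partial>count_space \<D>)"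
      by (rule nn_integral_cmult) simp
    also have "(\<integral>\<^sup>+K. emeasure lborel (interior K) \<partial>count_space \<D>) = emeasure lborel (\<Union>K\<in>\<D>. interior K)"
      using D(1,3) by (intro emeasure_UN_countable[symmetric]) (auto simp: disjoint_family_on_def pairwise_def)
    also have "\<dots> = emeasure lebesgue (\<Union>K\<in>\<D>. interior K)"
    proof -
      have "open (\<Union>K\<in>\<D>. interior K)" by auto
      then show ?thesis by simp
    qed
    also have "\<dots> \<le> emeasure lebesgue (\<Union>\<D>)"
      using D(6) interior_subset by (intro emeasure_mono) (blast, auto)
    also have "\<dots> \<le> ennreal e" using D(6,7) by (simp add: emeasure_eq_measure2 ennreal_leI)
    finally show ?thesis using c e by (simp add: mult_left_mono flip: ennreal_mult')
  qed
  note small = this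
  have "hausdorff_pre ?n \<delta> Z \<le> 0 + ennreal e" if "e > 0" for e
  proof -
    \<comment> \<open>The first bound makes the sum small, the second keeps the cubes below diameter \<open>\<delta>\<close>.\<close>
    define e' where "e' = min (e / (?c + 1)) ((\<delta> / ?n) ^ ?n)"
    have "e' > 0" using c that \<open>\<delta> > 0\<close> DIM_positive[where 'a='a]
      by (auto simp: e'_def intro!: divide_pos_pos add_nonneg_pos)
    have "?c * e' \<le> (?c + 1) * e'" using \<open>e' > 0\<close> by simp
    also have "\<dots> \<le> (?c + 1) * (e / (?c + 1))"
      using c by (intro mult_left_mono) (auto simp: e'_def)
    also have "\<dots> = e"
      by (subst times_divide_eq_right, rule nonzero_mult_div_cancel_left) (use c in linarith)
    finally have "ennreal (?c * e') \<le> ennreal e" by (rule ennreal_leI)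
    moreover have "hausdorff_pre ?n \<delta> Z \<le> ennreal (?c * e')"
      using \<open>e' > 0\<close> by (rule small) (simp add: e'_def)
    ultimately show ?thesis by simp
  qed
  then have "hausdorff_pre ?n \<delta> Z \<le> 0" by (rule ennreal_le_epsilon)
  then show ?thesis by simp
qed

text \<open>
  For balls the Hausdorff size equals the volume. By Vitali's theorem disjoint small balls exhaust
  \<open>A\<close> up to a null set inside a slightly larger open set.
\<close>

lemma hausdorff_outer_le_lborel_bounded:
  fixes A :: "'a::euclidean_space set"
  assumes A: "A \<in> sets borel" "bounded A"
  shows "hausdorff_outer DIM('a) A \<le> emeasure lborel A"
proof -
  let ?n = "DIM('a)"
  have "hausdorff_pre ?n \<delta> A \<le> emeasure lborel A + ennreal e" if "\<delta> > 0" "e > 0" for \<delta> e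
  proof -
    obtain U where U: "open U" "A \<subseteq> U" "emeasure lborel (U - A) < e"
      using outer_regular_lborel[of A e] A \<open>e > 0\<close> by auto
    define K where "K = {p :: 'a \<times> real. 0 < snd p \<and> snd p \<le> \<delta> / 2 \<and> ball (fst p) (snd p) \<subseteq> U}"
    have "\<exists>p. p \<in> K \<and> x \<in> ball (fst p) (snd p) \<and> snd p < r" if "x \<in> A" "0 < r" for x r
    proof -
      have "x \<in> U" using \<open>x \<in> A\<close> U(2) by (rule subsetD[rotated])
      then obtain s where s: "s > 0" "ball x s \<subseteq> U" using openE[OF U(1)] by metis
      define t where "t = min (min s (\<delta> / 2)) (r / 2)"
      have "t > 0" "t \<le> s" "t \<le> \<delta> / 2" "t < r" using s \<open>\<delta> > 0\<close> \<open>r > 0\<close> by (auto simp: t_def)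
      then have "(x, t) \<in> K" using s subset_ball[of t s x] by (auto simp: K_def)
      then show ?thesis using \<open>t > 0\<close> \<open>t < r\<close> by (intro exI[of _ "(x, t)"]) auto
    qed
    from Vitali_covering_theorem_balls[OF this] obtain C where C: "countable C" "C \<subseteq> K"
        "pairwise (\<lambda>i j. disjnt (ball (fst i) (snd i)) (ball (fst j) (snd j))) C"
        "negligible (A - (\<Union>i\<in>C. ball (fst i) (snd i)))"
      by blast
    define \<C> where "\<C> = (\<lambda>p. ball (fst p) (snd p)) ` C"
    have ball: "bounded B \<and> diameter B \<le> \<delta>" "hausdorff_size ?n B \<le> emeasure lborel B" "open B" "B \<subseteq> U" if BC: "B \<in> \<C>" for B
    proof -
      obtain x r where B: "B = ball x r" "r > 0" "r \<le> \<delta> / 2" "ball x r \<subseteq> U"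
        using BC C(2) by (auto simp: \<C>_def K_def)
      then show "bounded B \<and> diameter B \<le> \<delta>" "open B" "B \<subseteq> U" by auto
      show "hausdorff_size ?n B \<le> emeasure lborel B"
        using B by (simp add: hausdorff_size_def emeasure_ball)
    qed
    have Cc: "countable \<C>" using C(1) by (simp add: \<C>_def)
    have dis: "disjoint \<C>"
    proof -
      have "ball (fst p) (snd p) \<inter> ball (fst q) (snd q) = {}"
        if "p \<in> C" "q \<in> C" "ball (fst p) (snd p) \<noteq> ball (fst q) (snd q)" for p q
        using that C(3) unfolding pairwise_def disjnt_def by metis
      then show ?thesis unfolding disjoint_def \<C>_def by blast
    qed
    have "hausdorff_pre ?n \<delta> (\<Union>\<C>) \<le> (\<integral>\<^sup>+B. hausdorff_size ?n B \<partial>count_space \<C>)"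
      using ball Cc \<open>\<delta> > 0\<close> by (intro hausdorff_pre_countable_cover) auto
    also have "\<dots> \<le> (\<integral>\<^sup>+B. emeasure lborel B \<partial>count_space \<C>)"
      using ball by (intro nn_integral_mono) auto
    also have "\<dots> = emeasure lborel (\<Union>\<C>)"
      using Cc dis ball by (intro nn_integral_emeasure_disjoint_family) auto
    also have "\<dots> \<le> emeasure lborel U"
      using U(1) ball(4) by (intro emeasure_mono Sup_least) auto
    also have "\<dots> = emeasure lborel A + emeasure lborel (U - A)"
      using U A by (subst plus_emeasure) (auto intro: arg_cong[of _ _ "emeasure lborel"])
    also have "\<dots> \<le> emeasure lborel A + ennreal e"
      using U(3) by (intro add_left_mono) simp
    finally have 1: "hausdorff_pre ?n \<delta> (\<Union>\<C>) \<le> emeasure lborel A + ennreal e" .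
    have 2: "hausdorff_pre ?n \<delta> (A - \<Union>\<C>) = 0"
      using C(4) A \<open>\<delta> > 0\<close> by (intro hausdorff_pre_negligible) (auto simp: \<C>_def bounded_diff)
    have "hausdorff_pre ?n \<delta> A \<le> hausdorff_pre ?n \<delta> (\<Union>n. binaryset (\<Union>\<C>) (A - \<Union>\<C>) n)"
      by (intro hausdorff_pre_mono) (auto simp: UN_binaryset_eq)
    also have "\<dots> \<le> (\<Sum>n. hausdorff_pre ?n \<delta> (binaryset (\<Union>\<C>) (A - \<Union>\<C>) n))"
      by (rule hausdorff_pre_UN)
    also have "\<dots> = hausdorff_pre ?n \<delta> (\<Union>\<C>) + hausdorff_pre ?n \<delta> (A - \<Union>\<C>)"
      using hausdorff_pre_negligible[of "{}::'a set" \<delta>] \<open>\<delta> > 0\<close> by (intro suminf_binaryset_eq) auto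
    finally show ?thesis using 1 2 by simp
  qed
  note approx = this
  have "hausdorff_pre ?n \<delta> A \<le> emeasure lborel A" if "\<delta> > 0" for \<delta>
    by (rule ennreal_le_epsilon) (rule approx[OF that])
  then show ?thesis unfolding hausdorff_outer_def by (intro SUP_least) auto
qed

theorem hausdorff_measure_eq_lborel:
  "(hausdorff_measure DIM('a) :: 'a::euclidean_space measure) = lborel"
proof (rule measure_eqI)
  fix A :: "'a set" assume "A \<in> sets (hausdorff_measure DIM('a))"
  then have A[measurable]: "A \<in> sets borel" by simp
  define B where "B n = A \<inter> ball 0 (real n)" for n
  have B: "B n \<in> sets borel" "bounded (B n)" for n by (auto simp: B_def bounded_Int)
  have "incseq B" by (auto simp: B_def incseq_def)
  have UB: "(\<Union>n. B n) = A"
    using reals_Archimedean2 by (auto simp: B_def)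
  have eq: "emeasure (hausdorff_measure DIM('a)) (B n) = emeasure lborel (B n)" for n
    using lborel_le_hausdorff_outer[OF B(1)] hausdorff_outer_le_lborel_bounded[OF B]
    by (simp add: emeasure_hausdorff_measure B antisym)
  have "emeasure (hausdorff_measure DIM('a)) A = (SUP n. emeasure (hausdorff_measure DIM('a)) (B n))"
    using B \<open>incseq B\<close> by (subst SUP_emeasure_incseq) (auto simp: UB)
  also have "\<dots> = emeasure lborel A"
    unfolding eq using B \<open>incseq B\<close> by (subst SUP_emeasure_incseq) (auto simp: UB)
  finally show "emeasure (hausdorff_measure DIM('a)) A = emeasure lborel A" .
qed simp

corollary hausdorff_outer_eq_lborel:
  fixes A :: "'a::euclidean_space set"
  assumes "A \<in> sets borel"
  shows "hausdorff_outer DIM('a) A = emeasure lborel A"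
  using assms by (simp flip: emeasure_hausdorff_measure add: hausdorff_measure_eq_lborel)

section \<open>Scalings, isometries and radial projection\<close>

lemma dist_scaleR: "dist (c *\<^sub>R x) (c *\<^sub>R y) = \<bar>c\<bar> * dist x (y :: 'a::real_normed_vector)"
  by (simp add: dist_norm flip: scaleR_diff_right)

lemma hausdorff_outer_scaleR_image:
  fixes A :: "'a::real_normed_vector set"
  assumes "c > 0"
  shows "hausdorff_outer d ((*\<^sub>R) c ` A) = ennreal (c ^ d) * hausdorff_outer d A"
proof (rule antisym)
  show "hausdorff_outer d ((*\<^sub>R) c ` A) \<le> ennreal (c ^ d) * hausdorff_outer d A"
    using assms by (intro hausdorff_outer_Lipschitz_image) (auto simp: dist_scaleR)
  have "(*\<^sub>R) (1 / c) ` (*\<^sub>R) c ` A = A" using assms by (auto simp: image_comp)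
  then have "hausdorff_outer d A \<le> ennreal ((1 / c) ^ d) * hausdorff_outer d ((*\<^sub>R) c ` A)"
    using hausdorff_outer_Lipschitz_image[of "1 / c" "(*\<^sub>R) c ` A" "(*\<^sub>R) (1 / c)" d] assms
    by (simp add: dist_scaleR)
  then have "ennreal (c ^ d) * hausdorff_outer d A
      \<le> ennreal (c ^ d) * (ennreal ((1 / c) ^ d) * hausdorff_outer d ((*\<^sub>R) c ` A))"
    by (rule mult_left_mono) simp
  also have "\<dots> = ennreal (c ^ d * (1 / c) ^ d) * hausdorff_outer d ((*\<^sub>R) c ` A)"
    using assms by (simp add: ennreal_mult' mult.assoc)
  also have "c ^ d * (1 / c) ^ d = 1" using assms by (simp flip: power_mult_distrib)
  finally show "ennreal (c ^ d) * hausdorff_outer d A \<le> hausdorff_outer d ((*\<^sub>R) c ` A)" by simp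
qed

lemma sets_borel_scaleR_image:
  fixes A :: "'a::real_normed_vector set"
  assumes "A \<in> sets borel" "c \<noteq> 0"
  shows "(*\<^sub>R) c ` A \<in> sets borel"
proof -
  have eq: "(*\<^sub>R) c ` A = (*\<^sub>R) (1 / c) -` A"
    using assms(2) by (force simp: image_iff)
  have "(*\<^sub>R) (1 / c) \<in> borel_measurable (borel :: 'a measure)"
    by (intro borel_measurable_continuous_onI continuous_intros)
  from measurable_sets_borel[OF this assms(1)] show ?thesis by (simp add: eq)
qed

lemma emeasure_lborel_scaleR_image:
  fixes A :: "'a::euclidean_space set"
  assumes "A \<in> sets borel" "c > 0"
  shows "emeasure lborel ((*\<^sub>R) c ` A) = ennreal (c ^ DIM('a)) * emeasure lborel A"
  using hausdorff_outer_scaleR_image[of c "DIM('a)" A] assms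
  by (simp add: hausdorff_outer_eq_lborel sets_borel_scaleR_image)

text \<open>
  Comparing both sides with Hausdorff measure avoids any change of variables, also between
  different Euclidean types of the same dimension.
\<close>

lemma emeasure_lborel_isometry_image:
  fixes f :: "'a::euclidean_space \<Rightarrow> 'b::euclidean_space"
  assumes "DIM('a) = DIM('b)" "\<And>x y. dist (f x) (f y) = dist x y"
    and "A \<in> sets borel" "f ` A \<in> sets borel"
  shows "emeasure lborel (f ` A) = emeasure lborel A"
  using hausdorff_outer_isometry_image[of f "DIM('a)" A] hausdorff_outer_eq_lborel[of A]
    hausdorff_outer_eq_lborel[of "f ` A"] assms by simp

lemma borel_measurable_sgn_vec [measurable]:
  "(sgn :: 'a::euclidean_space \<Rightarrow> 'a) \<in> borel_measurable borel"
proof -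
  have "(\<lambda>x::'a. x /\<^sub>R norm x) \<in> borel_measurable borel" by measurable
  then show ?thesis by (simp add: sgn_div_norm)
qed

text \<open>
  The cone of radius 1 over a set of directions. For \<open>B\<close> in the unit sphere, its volume times the
  dimension is the classical surface measure of \<open>B\<close>.
\<close>

definition unit_cone :: "'a::real_normed_vector set \<Rightarrow> 'a set" where
  "unit_cone B = {x. x \<noteq> 0 \<and> norm x \<le> 1 \<and> sgn x \<in> B}"

lemma sets_unit_cone [measurable]:
  fixes B :: "'a::euclidean_space set"
  assumes [measurable]: "B \<in> sets borel"
  shows "unit_cone B \<in> sets borel"
  unfolding unit_cone_def by measurable

lemma emeasure_unit_cone_finite: "emeasure lborel (unit_cone (B :: 'a::euclidean_space set)) < \<infinity>"
proof -
  have "emeasure lborel (unit_cone B) \<le> emeasure lborel (cball (0 :: 'a) 1)"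
    by (intro emeasure_mono) (auto simp: unit_cone_def)
  also have "\<dots> < \<infinity>" by (rule emeasure_lborel_cball_finite)
  finally show ?thesis .
qed

text \<open>
  Expanding the squares, the difference is
  \<open>(a - b)\<^sup>2 + 2 * (a * b - \<rho>\<^sup>2) * (1 - x \<bullet> z)\<close>, and both terms are nonnegative.
\<close>

lemma dist_unit_vectors_le:
  fixes x z :: "'a::real_inner"
  assumes "norm x = 1" "norm z = 1" "\<rho> \<ge> 0" "a \<ge> \<rho>" "b \<ge> \<rho>"
  shows "\<rho> * dist x z \<le> dist (a *\<^sub>R x) (b *\<^sub>R z)"
proof -
  have c: "x \<bullet> z \<le> 1" using norm_cauchy_schwarz[of x z] assms by simp
  have xx: "x \<bullet> x = 1" "z \<bullet> z = 1" using assms by (simp_all add: dot_square_norm)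
  have "\<rho> * \<rho> \<le> a * b" using assms by (intro mult_mono) auto
  then have "0 \<le> 2 * (a * b - \<rho> * \<rho>) * (1 - x \<bullet> z)" using c by (intro mult_nonneg_nonneg) auto
  moreover have "(dist (a *\<^sub>R x) (b *\<^sub>R z))\<^sup>2 - (\<rho> * dist x z)\<^sup>2
      = (a - b)\<^sup>2 + 2 * (a * b - \<rho> * \<rho>) * (1 - x \<bullet> z)"
    unfolding dist_norm power_mult_distrib power2_norm_eq_inner
    by (simp add: inner_diff_left inner_diff_right xx inner_commute algebra_simps power2_eq_square)
  ultimately have "(\<rho> * dist x z)\<^sup>2 \<le> (dist (a *\<^sub>R x) (b *\<^sub>R z))\<^sup>2"
    using zero_le_power2[of "a - b"] by linarith
  then show ?thesis by (rule power2_le_imp_le) simp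
qed

lemma dist_sgn_le:
  fixes x z :: "'a::real_inner"
  assumes "norm x \<ge> \<rho>" "norm z \<ge> \<rho>" "\<rho> > 0"
  shows "dist (sgn x) (sgn z) \<le> (1 / \<rho>) * dist x z"
proof -
  have "x \<noteq> 0" "z \<noteq> 0" using assms by auto
  then have "norm x *\<^sub>R sgn x = x" "norm z *\<^sub>R sgn z = z" "norm (sgn x) = 1" "norm (sgn z) = 1"
    by (simp_all add: sgn_div_norm)
  then have "\<rho> * dist (sgn x) (sgn z) \<le> dist x z"
    using dist_unit_vectors_le[of "sgn x" "sgn z" \<rho> "norm x" "norm z"] assms by simp
  then show ?thesis using assms by (simp add: field_simps)
qed

lemma sgn_scaleR_pos: "c > 0 \<Longrightarrow> sgn (c *\<^sub>R x) = sgn (x :: 'a::real_normed_vector)"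
  by (simp add: sgn_scaleR)

section \<open>The gnomonic chart of the sphere\<close>

text \<open>
  Coordinates adapted to the direction \<open>m\<close>: a bijection \<open>\<phi>\<close> names the remaining coordinates by
  a type with one element less. Central projection of the open half-space \<open>x $ m > 0\<close> from the
  origin to the hyperplane \<open>x $ m = 1\<close>, called \<open>gnom\<close> below, is a chart of the upper hemisphere.
  Its virtue is that it maps cones over subsets of the sphere to cones over flat sets, whose
  volume is elementary, while near the pole it almost preserves distances.
\<close>

locale gnomonic =
  fixes m :: "'n::finite" and \<phi> :: "'k::finite \<Rightarrow> 'n"
  assumes \<phi>: "bij_betw \<phi> UNIV (- {m})"
begin

definition proj :: "real ^ 'n \<Rightarrow> real ^ 'k" where "proj x = (\<chi> j. x $ \<phi> j)"

definition point :: "real ^ 'k \<Rightarrow> real \<Rightarrow> real ^ 'n" where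
  "point y t = (\<chi> i. if i = m then t else y $ inv_into UNIV \<phi> i)"

definition gnom :: "real ^ 'n \<Rightarrow> real ^ 'k" where "gnom x = (1 / x $ m) *\<^sub>R proj x"

lemma card: "CARD('n) = CARD('k) + 1"
proof -
  have "CARD('k) = card (- {m})" using \<phi> by (rule bij_betw_same_card)
  moreover have "CARD('n) = card (insert m (- {m}))" by (rule arg_cong[of _ _ card]) auto
  ultimately show ?thesis by simp
qed

lemma \<phi>_neq [simp]: "\<phi> j \<noteq> m"
  using \<phi> by (auto simp: bij_betw_def)

lemma inv_\<phi> [simp]: "inv_into UNIV \<phi> (\<phi> j) = j"
  using \<phi> by (simp add: bij_betw_def)

lemma \<phi>_inv: "i \<noteq> m \<Longrightarrow> \<phi> (inv_into UNIV \<phi> i) = i"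
  using \<phi> by (auto simp: bij_betw_def f_inv_into_f)

lemma proj_point [simp]: "proj (point y t) = y" and point_m [simp]: "point y t $ m = t"
  by (simp_all add: proj_def point_def vec_eq_iff)

lemma point_proj [simp]: "point (proj x) (x $ m) = x"
  by (auto simp: proj_def point_def vec_eq_iff \<phi>_inv)

lemma point_scaleR: "point (c *\<^sub>R y) (c * t) = c *\<^sub>R point y t"
  by (simp add: point_def vec_eq_iff)

lemma point_diff: "point y t - point z s = point (y - z) (t - s)"
  by (simp add: point_def vec_eq_iff)

lemma norm_point: "(norm (point y t))\<^sup>2 = (norm y)\<^sup>2 + t\<^sup>2"
proof -
  have "(norm (point y t))\<^sup>2 = (\<Sum>i\<in>UNIV. (point y t $ i)\<^sup>2)"
    unfolding power2_norm_eq_inner inner_vec_def by (simp add: power2_eq_square)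
  also have "\<dots> = t\<^sup>2 + (\<Sum>i\<in>-{m}. (point y t $ i)\<^sup>2)"
    by (subst sum.remove[of _ m]) (auto simp: Compl_eq_Diff_UNIV)
  also have "(\<Sum>i\<in>-{m}. (point y t $ i)\<^sup>2) = (\<Sum>j\<in>UNIV. (point y t $ \<phi> j)\<^sup>2)"
    using \<phi> by (rule sum.reindex_bij_betw[symmetric])
  also have "\<dots> = (norm y)\<^sup>2"
    unfolding power2_norm_eq_inner inner_vec_def by (simp add: power2_eq_square point_def)
  finally show ?thesis by simp
qed

lemma norm_proj_le: "norm (proj x) \<le> norm x"
proof -
  have "(norm (proj x))\<^sup>2 \<le> (norm x)\<^sup>2" using norm_point[of "proj x" "x $ m"] by simp
  then show ?thesis by (simp add: power2_le_iff_abs_le)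
qed

lemma continuous_on_proj: "continuous_on S proj"
  unfolding proj_def by (intro continuous_intros)

lemma continuous_on_point: "continuous_on S (\<lambda>p. point (fst p) (snd p))"
proof -
  have "continuous_on S (\<lambda>p. if i = m then snd p else fst p $ inv_into UNIV \<phi> i)" for i
    by (cases "i = m") (auto intro!: continuous_intros)
  then show ?thesis unfolding point_def by (intro continuous_intros)
qed

lemma measurable_proj [measurable]: "proj \<in> borel_measurable borel"
  by (intro borel_measurable_continuous_onI continuous_on_proj)

lemma measurable_point [measurable (raw)]:
  assumes "f \<in> borel_measurable M" "g \<in> borel_measurable M"
  shows "(\<lambda>x. point (f x) (g x)) \<in> borel_measurable M"
proof -
  have point: "(\<lambda>p. point (fst p) (snd p)) \<in> borel_measurable borel"
    by (intro borel_measurable_continuous_onI continuous_on_point)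
  have "(\<lambda>x. (f x, g x)) \<in> borel_measurable M"
    using assms by (rule borel_measurable_Pair)
  from measurable_compose[OF this point] show ?thesis by simp
qed

lemma point_eq_scaleR_gnom: "x $ m \<noteq> 0 \<Longrightarrow> (x $ m) *\<^sub>R point (gnom x) 1 = x"
  unfolding point_scaleR[symmetric] by (simp add: gnom_def)

lemma sgn_point_gnom:
  assumes "x $ m > 0"
  shows "sgn (point (gnom x) 1) = sgn x"
  using sgn_scaleR_pos[OF assms, of "point (gnom x) 1"] assms by (simp add: point_eq_scaleR_gnom)

lemma gnom_sgn: "x $ m > 0 \<Longrightarrow> gnom (sgn x) = gnom x"
  by (auto simp: gnom_def proj_def sgn_div_norm vec_eq_iff field_simps)

lemma gnom_point: "t \<noteq> 0 \<Longrightarrow> gnom (point y t) = (1 / t) *\<^sub>R y"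
  by (simp add: gnom_def)

lemma gnom_image_eq:
  assumes "B \<subseteq> sphere 0 1 \<inter> {x. x $ m > 0}"
  shows "gnom ` B = {y. sgn (point y 1) \<in> B}"
proof (intro set_eqI iffI)
  fix y assume "y \<in> gnom ` B"
  then obtain x where x: "x \<in> B" "y = gnom x" by blast
  then have "norm x = 1" "x $ m > 0" using assms by auto
  then have "sgn (point y 1) = x" using sgn_point_gnom[of x] x by (simp add: sgn_div_norm)
  then show "y \<in> {y. sgn (point y 1) \<in> B}" using x by simp
next
  fix y assume "y \<in> {y. sgn (point y 1) \<in> B}"
  moreover have "gnom (sgn (point y 1)) = y" using gnom_sgn[of "point y 1"] by (simp add: gnom_point)
  ultimately show "y \<in> gnom ` B" by force
qed

lemma sets_gnom_image:
  assumes [measurable]: "B \<in> sets borel" and "B \<subseteq> sphere 0 1 \<inter> {x. x $ m > 0}"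
  shows "gnom ` B \<in> sets borel"
  unfolding gnom_image_eq[OF assms(2)] by measurable

text \<open>
  Up to the hyperplane the two unit vectors are stretched by factors of at least 1.
\<close>

lemma dist_gnom_ge:
  assumes "norm x = 1" "norm z = 1" "x $ m > 0" "z $ m > 0"
  shows "dist x z \<le> dist (gnom x) (gnom z)"
proof -
  have "x $ m \<le> 1" "z $ m \<le> 1" using component_le_norm_cart[of x m] component_le_norm_cart[of z m] assms by auto
  then have "1 * dist x z \<le> dist ((1 / x $ m) *\<^sub>R x) ((1 / z $ m) *\<^sub>R z)"
    using assms by (intro dist_unit_vectors_le) auto
  also have "(1 / x $ m) *\<^sub>R x = point (gnom x) 1" using point_scaleR[of "1 / x $ m" "proj x" "x $ m"] assms by (simp add: gnom_def)
  also have "(1 / z $ m) *\<^sub>R z = point (gnom z) 1" using point_scaleR[of "1 / z $ m" "proj z" "z $ m"] assms by (simp add: gnom_def)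
  also have "dist (point (gnom x) 1) (point (gnom z) 1) = dist (gnom x) (gnom z)"
    using norm_point[of "gnom x - gnom z" 0] by (simp add: dist_norm point_diff power2_eq_iff_nonneg)
  finally show ?thesis by simp
qed

text \<open>
  The difference of the images splits into a term from moving the point at fixed height, which is
  stretched by at most \<open>1 / h\<close>, and a term from the change of height, which is small because
  near the pole \<open>proj\<close> has norm at most \<open>sqrt (1 - h\<^sup>2)\<close>.
\<close>

lemma dist_gnom_le:
  assumes "norm x = 1" "norm z = 1" "x $ m \<ge> h" "z $ m \<ge> h" "0 < h" "h \<le> 1"
  shows "dist (gnom x) (gnom z) \<le> (1 / h + sqrt (1 - h\<^sup>2) / h\<^sup>2) * dist x z"
proof -
  let ?s = "sqrt (1 - h\<^sup>2)"
  have pos: "x $ m > 0" "z $ m > 0" using assms by auto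
  have "gnom x - gnom z = (1 / x $ m) *\<^sub>R proj (x - z) + ((z $ m - x $ m) / (x $ m * z $ m)) *\<^sub>R proj z"
    using pos by (simp add: gnom_def proj_def vec_eq_iff field_simps)
  then have "dist (gnom x) (gnom z) \<le> norm ((1 / x $ m) *\<^sub>R proj (x - z)) + norm (((z $ m - x $ m) / (x $ m * z $ m)) *\<^sub>R proj z)"
    unfolding dist_norm by (simp only:) (rule norm_triangle_ineq)
  also have "norm ((1 / x $ m) *\<^sub>R proj (x - z)) \<le> (1 / h) * dist x z"
    unfolding norm_scaleR dist_norm
    using norm_proj_le[of "x - z"] assms pos by (intro mult_mono) (auto intro: divide_left_mono)
  also have "norm (((z $ m - x $ m) / (x $ m * z $ m)) *\<^sub>R proj z) \<le> (dist x z / h\<^sup>2) * ?s"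
    unfolding norm_scaleR
  proof (intro mult_mono)
    have "\<bar>(z $ m - x $ m)\<bar> \<le> dist x z"
      using component_le_norm_cart[of "z - x" m] by (simp add: dist_norm norm_minus_commute)
    moreover have "h\<^sup>2 \<le> x $ m * z $ m"
      unfolding power2_eq_square using assms by (intro mult_mono) auto
    ultimately show "\<bar>(z $ m - x $ m) / (x $ m * z $ m)\<bar> \<le> dist x z / h\<^sup>2"
      unfolding abs_divide using pos \<open>0 < h\<close> by (intro frac_le) auto
    have "(norm (proj z))\<^sup>2 = 1 - (z $ m)\<^sup>2" using norm_point[of "proj z" "z $ m"] assms by simp
    also have "\<dots> \<le> 1 - h\<^sup>2" using assms by (simp add: power_mono)
    finally show "norm (proj z) \<le> ?s" by (rule real_le_rsqrt)
  qed (use assms in auto)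
  finally show ?thesis by (simp add: algebra_simps)
qed

text \<open>
  The cone with apex 0 over the flat set \<open>E\<close> placed at height 1.
\<close>

definition truncated_cone :: "(real ^ 'k) set \<Rightarrow> (real ^ 'n) set" where
  "truncated_cone E = {x. 0 < x $ m \<and> x $ m \<le> 1 \<and> gnom x \<in> E}"

text \<open>
  The coordinates form an isometry of \<open>(real ^ 'k) \<times> real\<close> with \<open>real ^ 'n\<close>.
\<close>

lemma distr_point_lborel: "distr (lborel \<Otimes>\<^sub>M lborel) borel (\<lambda>p. point (fst p) (snd p)) = lborel"
proof (rule measure_eqI)
  let ?f = "\<lambda>p. point (fst p) (snd p)"
  fix X assume "X \<in> sets (distr (lborel \<Otimes>\<^sub>M lborel) borel ?f)"
  then have X: "X \<in> sets borel" by simp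
  have f: "?f \<in> borel_measurable borel"
    by (intro borel_measurable_continuous_onI continuous_on_point)
  let ?Y = "?f -` X"
  have Y: "?Y \<in> sets borel" using measurable_sets_borel[OF f X] .
  have surj: "?f ` ?Y = X"
    by (force intro!: image_eqI[where x = "(proj x, x $ m)" for x])
  have "dist (?f p) (?f q) = dist p q" for p q
  proof -
    have "(dist (?f p) (?f q))\<^sup>2 = (dist p q)\<^sup>2"
      by (cases p, cases q) (simp add: dist_norm point_diff norm_point norm_Pair)
    then show ?thesis by (simp add: power2_eq_iff_nonneg)
  qed
  from emeasure_lborel_isometry_image[OF _ this Y]
  have "emeasure lborel ?Y = emeasure lborel X" using X surj card by simp
  then show "emeasure (distr (lborel \<Otimes>\<^sub>M lborel) borel ?f) X = emeasure lborel X"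
    unfolding lborel_prod using f X by (subst emeasure_distr) simp_all
qed simp

lemma nn_integral_slices:
  assumes [measurable]: "f \<in> borel_measurable borel"
  shows "(\<integral>\<^sup>+x. f x \<partial>lborel) = (\<integral>\<^sup>+t. (\<integral>\<^sup>+y. f (point y t) \<partial>lborel) \<partial>lborel)"
proof -
  have "(\<integral>\<^sup>+x. f x \<partial>lborel) = (\<integral>\<^sup>+x. f x \<partial>distr (lborel \<Otimes>\<^sub>M lborel) borel (\<lambda>p. point (fst p) (snd p)))"
    by (simp only: distr_point_lborel)
  also have "\<dots> = (\<integral>\<^sup>+p. f (point (fst p) (snd p)) \<partial>(lborel \<Otimes>\<^sub>M lborel))"
    by (subst nn_integral_distr) auto
  also have "\<dots> = (\<integral>\<^sup>+t. (\<integral>\<^sup>+y. f (point y t) \<partial>lborel) \<partial>lborel)"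
    by (subst lborel_pair.nn_integral_snd[symmetric]) auto
  finally show ?thesis .
qed

lemma emeasure_via_slices:
  assumes [measurable]: "X \<in> sets borel"
  shows "emeasure lborel X = (\<integral>\<^sup>+t. emeasure lborel {y. point y t \<in> X} \<partial>lborel)"
proof -
  have "emeasure lborel X = (\<integral>\<^sup>+x. indicator X x \<partial>lborel)" by simp
  also have "\<dots> = (\<integral>\<^sup>+t. (\<integral>\<^sup>+y. indicator X (point y t) \<partial>lborel) \<partial>lborel)"
    by (rule nn_integral_slices) measurable
  also have "\<dots> = (\<integral>\<^sup>+t. (\<integral>\<^sup>+y. indicator {y. point y t \<in> X} y \<partial>lborel) \<partial>lborel)"
    by (simp add: indicator_def)
  also have "\<dots> = (\<integral>\<^sup>+t. emeasure lborel {y. point y t \<in> X} \<partial>lborel)"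
    by (intro nn_integral_cong nn_integral_indicator) simp
  finally show ?thesis .
qed

lemma nn_integral_power_unit_interval:
  "(\<integral>\<^sup>+t. ennreal (t ^ d) * indicator {0<..1} t \<partial>lborel) = ennreal (1 / (real d + 1))"
proof -
  have "(\<integral>\<^sup>+t. ennreal (t ^ d) * indicator {0<..1} t \<partial>lborel) = (\<integral>\<^sup>+t. ennreal (t ^ d) * indicator {0..1} t \<partial>lborel)"
    by (intro nn_integral_cong_AE AE_I[where N = "{0}"]) (auto simp: indicator_def)
  also have "\<dots> = ennreal (1 ^ Suc d / real (Suc d) - 0 ^ Suc d / real (Suc d))"
    by (rule nn_integral_FTC_Icc) (auto intro!: derivative_eq_intros simp del: power_Suc of_nat_Suc)
  finally show ?thesis by (simp add: add.commute)
qed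

lemma sets_truncated_cone [measurable]:
  assumes [measurable]: "E \<in> sets borel"
  shows "truncated_cone E \<in> sets borel"
  unfolding truncated_cone_def gnom_def by measurable

text \<open>
  The slice at height \<open>t\<close> is a copy of \<open>E\<close> scaled by \<open>t\<close>.
\<close>

lemma emeasure_truncated_cone:
  assumes E[measurable]: "E \<in> sets borel"
  shows "ennreal CARD('n) * emeasure lborel (truncated_cone E) = emeasure lborel E"
proof -
  have "emeasure lborel {y. point y t \<in> truncated_cone E} = emeasure lborel E * (ennreal (t ^ CARD('k)) * indicator {0<..1} t)"
    for t
  proof (cases "0 < t \<and> t \<le> 1")
    case True
    then have "{y. point y t \<in> truncated_cone E} = (*\<^sub>R) t ` E"
      by (force simp: truncated_cone_def gnom_point image_iff)
    then show ?thesis using True emeasure_lborel_scaleR_image[of E t] E by (simp add: mult.commute)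
  qed (auto simp: truncated_cone_def)
  then have "emeasure lborel (truncated_cone E)
      = emeasure lborel E * (\<integral>\<^sup>+t. ennreal (t ^ CARD('k)) * indicator {0<..1} t \<partial>lborel)"
    by (subst emeasure_via_slices) (auto simp: nn_integral_cmult)
  also have "\<dots> = emeasure lborel E * ennreal (1 / CARD('n))"
    unfolding nn_integral_power_unit_interval by (simp add: card add.commute)
  finally have "ennreal CARD('n) * emeasure lborel (truncated_cone E)
      = emeasure lborel E * (ennreal CARD('n) * ennreal (1 / CARD('n)))"
    by (simp add: mult_ac)
  also have "ennreal CARD('n) * ennreal (1 / CARD('n)) = 1"
    by (subst ennreal_mult'[symmetric]) auto
  finally show ?thesis by simp
qed

text \<open>
  On a small cap around the pole, Hausdorff measure of the sphere and cone measure are both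
  compared with the Lebesgue measure of the gnomonic image. The factors tend to 1 as \<open>h\<close> tends to 1.
\<close>

lemma cap_estimates:
  assumes B: "B \<in> sets borel" "B \<subseteq> sphere 0 1 \<inter> {x. x $ m > h}" and h: "0 < h" "h < 1"
  shows "ennreal CARD('n) * emeasure lborel (unit_cone B)
      \<le> ennreal ((1 / h + sqrt (1 - h\<^sup>2) / h\<^sup>2) ^ CARD('k)) * hausdorff_outer CARD('k) B"
    and "hausdorff_outer CARD('k) B
      \<le> ennreal ((1 / h) ^ CARD('n)) * (ennreal CARD('n) * emeasure lborel (unit_cone B))"
proof -
  let ?L = "1 / h + sqrt (1 - h\<^sup>2) / h\<^sup>2"
  let ?E = "gnom ` B"
  have B': "B \<subseteq> sphere 0 1 \<inter> {x. x $ m > 0}" using B(2) h by auto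
  have E [measurable]: "?E \<in> sets borel" by (rule sets_gnom_image[OF B(1) B'])
  \<comment> \<open>Gnomonic distances exceed chordal ones by at most this factor on the cap.\<close>
  have "?L > 0" using h by (intro add_pos_nonneg divide_nonneg_nonneg) (auto simp: power_le_one)
  have EH: "hausdorff_outer CARD('k) ?E = emeasure lborel ?E"
    using hausdorff_outer_eq_lborel[OF E] by simp
  \<comment> \<open>Both cones have apex 0 and the same directions; one is cut off by the sphere, the other by
      the tangent plane, so on the cap the cut-offs differ by a factor of at most \<open>1 / h\<close>.\<close>
  have "unit_cone B \<subseteq> truncated_cone ?E"
  proof
    fix x assume x: "x \<in> unit_cone B"
    then have "norm x > 0" "norm x \<le> 1" "sgn x \<in> B" by (auto simp: unit_cone_def)
    then have "(sgn x) $ m > 0" using B' by auto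
    then have "x $ m > 0" using \<open>norm x > 0\<close> by (simp add: sgn_div_norm field_simps)
    moreover have "x $ m \<le> 1" using component_le_norm_cart[of x m] \<open>norm x \<le> 1\<close> by linarith
    moreover have "gnom x \<in> ?E" using \<open>sgn x \<in> B\<close> gnom_sgn[OF \<open>x $ m > 0\<close>]
      by (intro image_eqI[of _ gnom "sgn x"]) auto
    ultimately show "x \<in> truncated_cone ?E" by (simp add: truncated_cone_def)
  qed
  then have "emeasure lborel (unit_cone B) \<le> emeasure lborel (truncated_cone ?E)"
    by (intro emeasure_mono) auto
  then have "ennreal CARD('n) * emeasure lborel (unit_cone B) \<le> emeasure lborel ?E"
    using mult_left_mono emeasure_truncated_cone[OF E] by (metis zero_le)
  also have "\<dots> \<le> ennreal (?L ^ CARD('k)) * hausdorff_outer CARD('k) B"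
    unfolding EH[symmetric]
    using \<open>?L > 0\<close> B(2) h by (intro hausdorff_outer_Lipschitz_image dist_gnom_le) (auto simp: less_imp_le subset_iff)
  finally show "ennreal CARD('n) * emeasure lborel (unit_cone B)
      \<le> ennreal (?L ^ CARD('k)) * hausdorff_outer CARD('k) B" .
  have "(*\<^sub>R) h ` truncated_cone ?E \<subseteq> unit_cone B"
  proof
    fix z assume "z \<in> (*\<^sub>R) h ` truncated_cone ?E"
    then obtain x where x: "z = h *\<^sub>R x" "0 < x $ m" "x $ m \<le> 1" "gnom x \<in> ?E"
      by (auto simp: truncated_cone_def)
    then have "sgn (point (gnom x) 1) \<in> B" using gnom_image_eq[OF B'] by blast
    then have s: "sgn x \<in> B" using sgn_point_gnom[OF x(2)] by simp
    have "x \<noteq> 0" using x(2) by auto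
    have "h < sgn x $ m" using s B(2) by auto
    then have "h * norm x < x $ m" using \<open>x \<noteq> 0\<close> by (simp add: sgn_div_norm field_simps)
    then have "norm z \<le> 1" using x h by simp
    then show "z \<in> unit_cone B" using x \<open>x \<noteq> 0\<close> s h by (simp add: unit_cone_def sgn_scaleR_pos)
  qed
  then have "emeasure lborel ((*\<^sub>R) h ` truncated_cone ?E) \<le> emeasure lborel (unit_cone B)"
    using B by (intro emeasure_mono) auto
  then have "ennreal (h ^ CARD('n)) * emeasure lborel (truncated_cone ?E) \<le> emeasure lborel (unit_cone B)"
    using h by (simp add: emeasure_lborel_scaleR_image)
  then have "ennreal ((1 / h) ^ CARD('n)) * (ennreal (h ^ CARD('n)) * emeasure lborel (truncated_cone ?E))
      \<le> ennreal ((1 / h) ^ CARD('n)) * emeasure lborel (unit_cone B)"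
    by (rule mult_left_mono) simp
  moreover have "ennreal ((1 / h) ^ CARD('n)) * ennreal (h ^ CARD('n)) = 1"
    using h by (simp flip: ennreal_mult' power_mult_distrib)
  ultimately have le: "emeasure lborel (truncated_cone ?E)
      \<le> ennreal ((1 / h) ^ CARD('n)) * emeasure lborel (unit_cone B)"
    by (simp flip: mult.assoc)
  have "hausdorff_outer CARD('k) B \<le> hausdorff_outer CARD('k) ?E"
  proof -
    have inj: "inj_on gnom B" using dist_gnom_ge B' by (intro inj_onI) (force simp: subset_iff)
    have "hausdorff_outer CARD('k) (inv_into B gnom ` ?E) \<le> ennreal (1 ^ CARD('k)) * hausdorff_outer CARD('k) ?E"
    proof (rule hausdorff_outer_Lipschitz_image)
      fix u v assume "u \<in> ?E" "v \<in> ?E"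
      then obtain x z where xz: "x \<in> B" "z \<in> B" "u = gnom x" "v = gnom z" by blast
      then have "dist x z \<le> dist (gnom x) (gnom z)" using B' by (intro dist_gnom_ge) auto
      then show "dist (inv_into B gnom u) (inv_into B gnom v) \<le> 1 * dist u v"
        using xz inj by simp
    qed simp
    also have "inv_into B gnom ` ?E = B" using inj by simp
    finally show ?thesis by simp
  qed
  also have "\<dots> = ennreal CARD('n) * emeasure lborel (truncated_cone ?E)"
    unfolding EH by (rule emeasure_truncated_cone[OF E, symmetric])
  also have "\<dots> \<le> ennreal CARD('n) * (ennreal ((1 / h) ^ CARD('n)) * emeasure lborel (unit_cone B))"
    using le by (rule mult_left_mono) simp
  finally show "hausdorff_outer CARD('k) B
      \<le> ennreal ((1 / h) ^ CARD('n)) * (ennreal CARD('n) * emeasure lborel (unit_cone B))"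
    by (simp add: mult_ac)
qed

end

section \<open>Hausdorff measure on the unit sphere\<close>

text \<open>
  An index type with one element less than \<open>'n\<close>, so that the tangent hyperplanes of the sphere
  in \<open>real ^ 'n\<close> are modelled by a Euclidean space type. The element 0 only ensures that the type is
  inhabited; the cardinality is right as soon as \<open>'n\<close> has two elements.
\<close>

typedef 'n codim1 = "insert 0 {..<CARD('n) - 1} :: nat set" by blast

instance codim1 :: (type) finite
proof
  have "finite (Rep_codim1 ` (UNIV :: 'a codim1 set))"
    by (rule finite_subset[of _ "insert 0 {..<CARD('a) - 1}"]) (rule image_subsetI, rule Rep_codim1, simp)
  then show "finite (UNIV :: 'a codim1 set)"
    by (rule finite_imageD) (simp add: Rep_codim1_inject inj_on_def)
qed

lemma card_codim1:
  assumes "CARD('n) \<ge> 2"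
  shows "CARD('n codim1) = CARD('n) - 1"
proof -
  have "insert 0 {..<CARD('n) - 1} = {..<CARD('n) - 1}" using assms by auto
  then show ?thesis using type_definition.card[OF type_definition_codim1[where 'n='n]] by simp
qed

lemma ex_gnomonic:
  fixes m :: "'n::finite"
  assumes "CARD('n) \<ge> 2"
  shows "\<exists>\<phi> :: 'n codim1 \<Rightarrow> 'n. gnomonic m \<phi>"
proof -
  have "CARD('n codim1) = card (- {m})"
    by (simp add: card_codim1[OF assms] Compl_eq_Diff_UNIV card_Diff_subset)
  then obtain \<phi> :: "'n codim1 \<Rightarrow> 'n" where "bij_betw \<phi> UNIV (- {m})"
    using finite_same_card_bij[OF finite finite] by blast
  then show ?thesis by (auto simp: gnomonic_def)
qed

lemma tendsto_imp_le_ennreal_mult: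
  fixes a b :: ennreal
  assumes "c \<longlonglongrightarrow> 1" "\<And>n::nat. a \<le> ennreal (c n) * b"
  shows "a \<le> b"
proof -
  have "(\<lambda>n. ennreal (c n) * b) \<longlonglongrightarrow> ennreal 1 * b"
    using assms(1) by (intro tendsto_mult_ennreal tendsto_ennrealI tendsto_const) auto
  then show ?thesis using assms(2) by (intro LIMSEQ_le_const[of _ b]) auto
qed

lemma unit_cone_orthogonal_image:
  fixes f :: "'a::euclidean_space \<Rightarrow> 'a"
  assumes "orthogonal_transformation f"
  shows "unit_cone (f ` B) = f ` unit_cone B"
proof -
  have lin: "linear f" using assms by (rule orthogonal_transformation_linear)
  have n: "norm (f x) = norm x" for x using assms by (rule orthogonal_transformation_norm)
  have s: "sgn (f x) = f (sgn x)" for x by (simp add: sgn_div_norm n linear_scale[OF lin])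
  have inj: "inj f" using assms by (rule orthogonal_transformation_inj)
  have surj: "surj f" using assms by (rule orthogonal_transformation_surj)
  have z: "f x = 0 \<longleftrightarrow> x = 0" for x using n[of x] by (metis norm_eq_zero)
  show ?thesis
  proof (intro set_eqI iffI)
    fix y assume y: "y \<in> unit_cone (f ` B)"
    obtain x where x: "y = f x" using surj by blast
    with y show "y \<in> f ` unit_cone B"
      using inj by (auto simp: unit_cone_def s n z inj_image_mem_iff)
  next
    fix y assume "y \<in> f ` unit_cone B"
    then show "y \<in> unit_cone (f ` B)" by (auto simp: unit_cone_def s n z)
  qed
qed

lemma sets_borel_orthogonal_image:
  fixes f :: "'a::euclidean_space \<Rightarrow> 'a"
  assumes f: "orthogonal_transformation f" and B: "B \<in> sets borel"
  shows "f ` B \<in> sets borel"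
proof -
  have "bij f" using f by (rule orthogonal_transformation_bij)
  then have "f ` B = inv f -` B"
    by (simp add: bij_vimage_eq_inv_image bij_imp_bij_inv inv_inv_eq)
  moreover have "inv f \<in> borel_measurable borel"
    using orthogonal_transformation_linear[OF orthogonal_transformation_inv[OF f]]
    by (intro borel_measurable_continuous_onI linear_continuous_on) (simp add: linear_linear)
  ultimately show ?thesis using B by (simp add: measurable_sets_borel)
qed

text \<open>
  Rotations carry any point of the sphere to the pole, so the cap estimates hold near every point.
  They add up over finitely many small caps, and the factors can be made arbitrarily close to 1.
\<close>

theorem hausdorff_outer_sphere:
  fixes B :: "(real ^ 'n::finite) set"
  assumes N: "CARD('n) \<ge> 2" and B: "B \<in> sets borel" "B \<subseteq> sphere 0 1"
  shows "hausdorff_outer (CARD('n) - 1) B = ennreal CARD('n) * emeasure lborel (unit_cone B)"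
proof -
  define m :: 'n where "m = undefined"
  obtain \<phi> :: "'n codim1 \<Rightarrow> 'n" where "gnomonic m \<phi>" using ex_gnomonic[OF N] by blast
  then interpret gnomonic m \<phi> .
  let ?d = "CARD('n) - 1"
  have d: "CARD('n codim1) = ?d" by (rule card_codim1[OF N])
  let ?H = "emeasure (hausdorff_measure ?d :: (real ^ 'n) measure)"
  let ?C = "\<lambda>B :: (real ^ 'n) set. ennreal CARD('n) * emeasure lborel (unit_cone B)"
  define c1 where "c1 h = (1 / h + sqrt (1 - h\<^sup>2) / h\<^sup>2) ^ ?d" for h :: real
  define c2 where "c2 h = (1 / h) ^ CARD('n)" for h :: real
  have cap: "?C B \<le> ennreal (c1 h) * ?H B \<and> ?H B \<le> ennreal (c2 h) * ?C B"
    if B: "B \<in> sets borel" "B \<subseteq> sphere 0 1 \<inter> {x. x \<bullet> v > h}" and h: "0 < h" "h < 1" and v: "norm v = 1"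
    for B h v
  proof -
    have axis: "norm (axis m 1 :: real ^ 'n) = 1" by simp
    obtain f :: "real ^ 'n \<Rightarrow> real ^ 'n" where f: "orthogonal_transformation f" "f v = axis m 1"
      by (rule orthogonal_transformation_exists_1[OF v axis]) (rule that)
    have iso: "dist (f x) (f y) = dist x y" for x y
      using f(1) by (simp add: orthogonal_transformation_isometry)
    have fB: "f ` B \<in> sets borel" using f(1) B(1) by (rule sets_borel_orthogonal_image)
    have "f x $ m = x \<bullet> v" for x
    proof -
      have "f x \<bullet> f v = x \<bullet> v" using f(1) by (simp add: orthogonal_transformation_def)
      then show ?thesis by (simp add: f(2) inner_axis)
    qed
    moreover have "norm (f x) = norm x" for x using f(1) by (rule orthogonal_transformation_norm)
    ultimately have sub: "f ` B \<subseteq> sphere 0 1 \<inter> {x. x $ m > h}" using B(2) by auto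
    have "emeasure lborel (unit_cone (f ` B)) = emeasure lborel (unit_cone B)"
      unfolding unit_cone_orthogonal_image[OF f(1)]
      using B iso by (intro emeasure_lborel_isometry_image sets_borel_orthogonal_image[OF f(1)]) auto
    moreover have "hausdorff_outer ?d (f ` B) = ?H B"
      using hausdorff_outer_isometry_image[of f ?d B] iso B(1) by (simp add: emeasure_hausdorff_measure)
    ultimately show ?thesis
      using cap_estimates[OF fB sub h] by (simp add: d c1_def c2_def)
  qed
  have main: "?C B \<le> ennreal (c1 h) * ?H B \<and> ?H B \<le> ennreal (c2 h) * ?C B" if h: "0 < h" "h < 1" for h
  proof -
    \<comment> \<open>Finitely many caps cover the sphere; \<open>B\<close> is cut along them, one cap at a time.\<close>
    have cov: "sphere (0 :: real ^ 'n) 1 \<subseteq> (\<Union>v\<in>sphere 0 1. {x. x \<bullet> v > h})"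
    proof
      fix x :: "real ^ 'n" assume x: "x \<in> sphere 0 1"
      then have "x \<bullet> x = 1" by (simp add: dot_square_norm)
      then show "x \<in> (\<Union>v\<in>sphere 0 1. {x. x \<bullet> v > h})" using h x by (intro UN_I[of x]) auto
    qed
    have op: "open {x :: real ^ 'n. x \<bullet> v > h}" for v
      by (intro open_Collect_less continuous_intros)
    obtain V where V: "V \<subseteq> sphere (0 :: real ^ 'n) 1" "finite V" "sphere 0 1 \<subseteq> (\<Union>v\<in>V. {x. x \<bullet> v > h})"
      by (rule compactE_image[OF compact_sphere op cov])
    have "?C B \<le> ennreal (c1 h) * ?H B \<and> ?H B \<le> ennreal (c2 h) * ?C B"
      if "B \<in> sets borel" "B \<subseteq> sphere 0 1 \<inter> (\<Union>v\<in>V. {x. x \<bullet> v > h})" for B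
      using V(2,1) that
    proof (induction V arbitrary: B)
      case empty
      then show ?case by (auto simp: unit_cone_def)
    next
      case (insert v V)
      let ?B1 = "B \<inter> {x. x \<bullet> v > h}" and ?B2 = "B - {x. x \<bullet> v > h}"
      have [measurable]: "B \<in> sets borel" by fact
      have B12: "?B1 \<in> sets borel" "?B2 \<in> sets borel" by measurable
      have 1: "?C ?B1 \<le> ennreal (c1 h) * ?H ?B1 \<and> ?H ?B1 \<le> ennreal (c2 h) * ?C ?B1"
        using insert.prems B12 h by (intro cap) auto
      have 2: "?C ?B2 \<le> ennreal (c1 h) * ?H ?B2 \<and> ?H ?B2 \<le> ennreal (c2 h) * ?C ?B2"
        using insert.prems B12 by (intro insert.IH) auto
      have H: "?H B = ?H ?B1 + ?H ?B2"
        using B12 by (subst plus_emeasure) (simp_all add: Int_Diff_Un, blast)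
      have "emeasure lborel (unit_cone B) = emeasure lborel (unit_cone ?B1) + emeasure lborel (unit_cone ?B2)"
        using B12 by (subst plus_emeasure) (auto simp: unit_cone_def intro!: arg_cong[of _ _ "emeasure lborel"])
      then have C: "?C B = ?C ?B1 + ?C ?B2" by (simp add: distrib_left)
      show ?case unfolding H C distrib_left using 1 2 by (auto intro: add_mono)
    qed
    then show ?thesis using B V(3) by auto
  qed
  \<comment> \<open>Shrinking the caps to points, both distortion factors tend to 1.\<close>
  define hn where "hn n = 1 - 1 / (real n + 2)" for n
  have hn: "0 < hn n" "hn n < 1" for n by (auto simp: hn_def field_simps)
  have lim: "hn \<longlonglongrightarrow> 1"
  proof -
    have "(\<lambda>n. inverse (real (Suc (Suc n)))) \<longlonglongrightarrow> 0"
      using LIMSEQ_inverse_real_of_nat by (rule LIMSEQ_Suc)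
    then have "(\<lambda>n. 1 - inverse (real (Suc (Suc n)))) \<longlonglongrightarrow> 1 - 0" by (intro tendsto_intros)
    then show ?thesis unfolding hn_def by (simp add: inverse_eq_divide add.commute)
  qed
  have "(\<lambda>n. c1 (hn n)) \<longlonglongrightarrow> (1 / 1 + sqrt (1 - 1\<^sup>2) / 1\<^sup>2) ^ ?d"
    unfolding c1_def by (intro tendsto_intros lim) auto
  then have "(\<lambda>n. c1 (hn n)) \<longlonglongrightarrow> 1" by simp
  then have le1: "?C B \<le> ?H B" by (rule tendsto_imp_le_ennreal_mult) (use main[OF hn] in blast)
  have "(\<lambda>n. c2 (hn n)) \<longlonglongrightarrow> (1 / 1) ^ CARD('n)"
    unfolding c2_def by (intro tendsto_intros lim) auto
  then have "(\<lambda>n. c2 (hn n)) \<longlonglongrightarrow> 1" by simp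
  then have le2: "?H B \<le> ?C B" by (rule tendsto_imp_le_ennreal_mult) (use main[OF hn] in blast)
  from le1 le2 show ?thesis using B(1) by (simp add: emeasure_hausdorff_measure antisym)
qed

section \<open>Polar coordinates\<close>

definition sphere_measure :: "(real ^ 'n::finite) measure" where
  "sphere_measure = density (hausdorff_measure (CARD('n) - 1)) (indicator (sphere 0 1))"

lemma measurable_indicator_sphere [measurable]:
  "indicator (sphere (0 :: 'a::euclidean_space) 1) \<in> borel_measurable (hausdorff_measure d)"
  by (rule borel_measurable_indicator) (simp only: sets_hausdorff_measure borel_closed closed_sphere)

lemma sets_sphere_measure [simp, measurable_cong]: "sets sphere_measure = sets borel"
  and space_sphere_measure [simp]: "space sphere_measure = UNIV"
  by (simp_all add: sphere_measure_def)

lemma nn_integral_sphere_measure: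
  fixes f :: "real ^ 'n::finite \<Rightarrow> ennreal"
  assumes "f \<in> borel_measurable borel"
  shows "(\<integral>\<^sup>+\<theta>. f \<theta> \<partial>sphere_measure) = (\<integral>\<^sup>+\<theta>\<in>sphere 0 1. f \<theta> \<partial>hausdorff_measure (CARD('n) - 1))"
  using assms unfolding sphere_measure_def by (subst nn_integral_density) (auto simp: mult.commute)

lemma AE_sphere_measure: "AE \<theta> in (sphere_measure :: (real ^ 'n::finite) measure). norm \<theta> = 1"
  unfolding sphere_measure_def by (subst AE_density) (auto simp: indicator_def)

lemma emeasure_sphere_measure:
  fixes B :: "(real ^ 'n::finite) set"
  assumes N: "CARD('n) \<ge> 2" and B: "B \<in> sets borel"
  shows "emeasure sphere_measure B = ennreal CARD('n) * emeasure lborel (unit_cone B)"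
proof -
  have SB: "sphere 0 1 \<inter> B \<in> sets borel"
    using B borel_closed[OF closed_sphere] by (rule sets.Int[rotated])
  have "emeasure sphere_measure B = emeasure (hausdorff_measure (CARD('n) - 1)) (sphere 0 1 \<inter> B)"
    unfolding sphere_measure_def using B by (subst emeasure_density) (auto simp flip: indicator_inter_arith)
  also have "\<dots> = ennreal CARD('n) * emeasure lborel (unit_cone (sphere 0 1 \<inter> B))"
    unfolding emeasure_hausdorff_measure[OF SB] by (rule hausdorff_outer_sphere[OF N SB]) simp
  also have "unit_cone (sphere 0 1 \<inter> B) = unit_cone B"
    by (auto simp: unit_cone_def norm_sgn)
  finally show ?thesis .
qed

lemma emeasure_sphere_measure_finite:
  fixes B :: "(real ^ 'n::finite) set"
  assumes N: "CARD('n) \<ge> 2" and B: "B \<in> sets borel"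
  shows "emeasure sphere_measure B < \<infinity>"
  unfolding emeasure_sphere_measure[OF assms]
  using emeasure_unit_cone_finite[of B] by (simp add: ennreal_mult_less_top)

definition radial_measure :: "nat \<Rightarrow> real measure" where
  "radial_measure d = density lborel (\<lambda>r. ennreal (r ^ d) * indicator {0<..} r)"

lemma sets_radial_measure [simp, measurable_cong]: "sets (radial_measure d) = sets borel"
  and space_radial_measure [simp]: "space (radial_measure d) = UNIV"
  by (simp_all add: radial_measure_def)

lemma emeasure_radial_measure_atMost:
  "emeasure (radial_measure d) {..a} = ennreal (max 0 a ^ Suc d / real (Suc d))"
proof (cases "a \<ge> 0")
  case True
  have "emeasure (radial_measure d) {..a} = (\<integral>\<^sup>+r. ennreal (r ^ d) * indicator {0..a} r \<partial>lborel)"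
    unfolding radial_measure_def
    by (subst emeasure_density, simp, simp, intro nn_integral_cong_AE AE_I[where N = "{0}"])
       (auto simp: indicator_def split: if_splits)
  also have "\<dots> = ennreal (a ^ Suc d / real (Suc d) - 0 ^ Suc d / real (Suc d))"
    using True by (intro nn_integral_FTC_Icc) (auto intro!: derivative_eq_intros simp del: power_Suc of_nat_Suc)
  finally show ?thesis using True by simp
next
  case False
  then have "ennreal (r ^ d) * indicator {0<..} r * indicator {..a} r = 0" for r
    by (auto simp: indicator_def)
  note z = this
  have "emeasure (radial_measure d) {..a} = (\<integral>\<^sup>+(r::real). 0 \<partial>lborel)"
    unfolding radial_measure_def by (subst emeasure_density, simp, simp, simp only: z)
  then show ?thesis using False by simp
qed

lemma sigma_finite_radial_measure: "sigma_finite_measure (radial_measure d)"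
proof
  show "\<exists>A. countable A \<and> A \<subseteq> sets (radial_measure d) \<and> \<Union> A = space (radial_measure d)
      \<and> (\<forall>a\<in>A. emeasure (radial_measure d) a \<noteq> \<infinity>)"
    by (intro exI[of _ "range (\<lambda>n::nat. {..real n})"])
       (auto simp: emeasure_radial_measure_atMost real_arch_simple)
qed

text \<open>
  For \<open>A = {..a}\<close> the sector is the unit cone over \<open>B\<close> scaled by \<open>a\<close>, so its volume is the solid
  angle times \<open>a ^ CARD('n) / CARD('n)\<close>.
\<close>

lemma emeasure_polar_sector:
  fixes B :: "(real ^ 'n::finite) set"
  assumes N: "CARD('n) \<ge> 2" and B [measurable]: "B \<in> sets borel" and A: "A \<in> sets borel"
  shows "emeasure (radial_measure (CARD('n) - 1)) A * emeasure sphere_measure B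
    = emeasure lborel {x. x \<noteq> 0 \<and> norm x \<in> A \<and> sgn x \<in> B}"
proof -
  let ?d = "CARD('n) - 1"
  let ?D = "density lborel (indicator {x. x \<noteq> 0 \<and> sgn x \<in> B}) :: (real ^ 'n) measure"
  let ?M = "distr ?D borel norm"
  let ?R = "scale_measure (emeasure sphere_measure B) (radial_measure ?d)"
  have M: "emeasure ?M A = emeasure lborel {x. x \<noteq> 0 \<and> norm x \<in> A \<and> sgn x \<in> B}" if [measurable]: "A \<in> sets borel" for A
  proof -
    have nA: "norm -` A \<in> sets (lborel :: (real ^ 'n) measure)"
      using measurable_sets_borel[OF borel_measurable_norm that] by simp
    have "emeasure ?M A = emeasure ?D (norm -` A)" by (subst emeasure_distr) auto
    also have "\<dots> = (\<integral>\<^sup>+x. indicator {x. x \<noteq> 0 \<and> norm x \<in> A \<and> sgn x \<in> B} x \<partial>lborel)"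
      by (subst emeasure_density, simp, rule nA, intro nn_integral_cong) (auto simp: indicator_def)
    also have "\<dots> = emeasure lborel {x. x \<noteq> 0 \<and> norm x \<in> A \<and> sgn x \<in> B}"
      by (rule nn_integral_indicator) measurable
    finally show ?thesis .
  qed
  have eq: "emeasure ?R {..a} = emeasure ?M {..a}" for a
  proof (cases "a > 0")
    case True
    have "{x. x \<noteq> 0 \<and> norm x \<in> {..a} \<and> sgn x \<in> B} = (*\<^sub>R) a ` unit_cone B"
    proof (intro set_eqI iffI)
      fix x assume "x \<in> {x. x \<noteq> 0 \<and> norm x \<in> {..a} \<and> sgn x \<in> B}"
      then have "(1 / a) *\<^sub>R x \<in> unit_cone B" "x = a *\<^sub>R ((1 / a) *\<^sub>R x)"
        using True sgn_scaleR_pos[of "1 / a" x] by (auto simp: unit_cone_def)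
      then show "x \<in> (*\<^sub>R) a ` unit_cone B" by blast
    qed (use True in \<open>auto simp: unit_cone_def sgn_scaleR_pos mult_le_cancel_left1\<close>)
    then have "emeasure ?M {..a} = ennreal (a ^ CARD('n)) * emeasure lborel (unit_cone B)"
      using True by (simp add: M emeasure_lborel_scaleR_image)
    also have "ennreal (a ^ CARD('n)) = ennreal (a ^ CARD('n) / CARD('n)) * ennreal CARD('n)"
      by (subst ennreal_mult'[symmetric]) (use True in auto)
    also have "ennreal (a ^ CARD('n) / CARD('n)) * ennreal CARD('n) * emeasure lborel (unit_cone B) = emeasure ?R {..a}"
      using True N by (simp add: emeasure_sphere_measure emeasure_radial_measure_atMost mult_ac)
    finally show ?thesis by simp
  next
    case False
    then have "{x::real ^ 'n. x \<noteq> 0 \<and> norm x \<in> {..a} \<and> sgn x \<in> B} = {}"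
      by (auto simp: not_less) (metis norm_le_zero_iff order_trans)
    then have "emeasure ?M {..a} = 0" by (subst M) (simp_all only: emeasure_empty, simp)
    then show ?thesis using False by (simp add: emeasure_radial_measure_atMost)
  qed
  \<comment> \<open>For fixed \<open>B\<close> both sides are measures in \<open>A\<close>. They agree on the half-lines \<open>{..a}\<close>, hence on all
      Borel sets.\<close>
  have "?R = ?M"
  proof (rule measure_eqI_generator_eq[where E = "range atMost" and A = "\<lambda>n::nat. {..real n}" and \<Omega> = UNIV])
    show "Int_stable (range (atMost :: real \<Rightarrow> real set))"
      by (auto simp: Int_stable_def)
    show "sets ?R = sigma_sets UNIV (range atMost)" "sets ?M = sigma_sets UNIV (range atMost)"
      by (simp_all add: borel_eq_atMost)
    show "emeasure ?R {..real n} \<noteq> \<infinity>" for n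
      using emeasure_sphere_measure_finite[OF N B]
      by (simp add: emeasure_radial_measure_atMost ennreal_mult_eq_top_iff)
    fix X :: "real set" assume "X \<in> range atMost"
    then obtain a where "X = {..a}" by blast
    then show "emeasure ?R X = emeasure ?M X" by (simp only: eq)
  qed (auto simp: real_arch_simple)
  then have "emeasure ?R A = emeasure ?M A" by simp
  then show ?thesis using A by (simp add: M mult.commute)
qed

theorem nn_integral_polar:
  fixes f :: "real ^ 'n::finite \<Rightarrow> ennreal"
  assumes N: "CARD('n) \<ge> 2" and [measurable]: "f \<in> borel_measurable borel"
  shows "(\<integral>\<^sup>+x. f x \<partial>lborel) = (\<integral>\<^sup>+\<theta>. (\<integral>\<^sup>+r. ennreal (r ^ (CARD('n) - 1)) * indicator {0<..} r * f (r *\<^sub>R \<theta>) \<partial>lborel) \<partial>sphere_measure)"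
proof -
  let ?R = "radial_measure (CARD('n) - 1)"
  let ?S = "sphere_measure :: (real ^ 'n) measure"
  let ?D = "density lborel (indicator (- {0})) :: (real ^ 'n) measure"
  let ?M = "distr ?D (?R \<Otimes>\<^sub>M ?S) (\<lambda>x. (norm x, sgn x))"
  interpret R: sigma_finite_measure ?R by (rule sigma_finite_radial_measure)
  interpret S: finite_measure ?S
    by (rule finite_measureI) (use emeasure_sphere_measure_finite[OF N, of UNIV] in simp)
  interpret pair_sigma_finite ?R ?S ..
  have [measurable]: "(\<lambda>x. (norm x, sgn x)) \<in> ?D \<rightarrow>\<^sub>M ?R \<Otimes>\<^sub>M ?S" by measurable
  have eq: "?R \<Otimes>\<^sub>M ?S = ?M"
  proof (rule pair_measure_eqI)
    fix A B assume "A \<in> sets ?R" "B \<in> sets ?S"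
    then have [measurable]: "A \<in> sets borel" "B \<in> sets borel" by simp_all
    have [measurable]: "{x::real ^ 'n. norm x \<in> A \<and> sgn x \<in> B} \<in> sets borel" by measurable
    have "emeasure ?M (A \<times> B) = emeasure ?D {x. norm x \<in> A \<and> sgn x \<in> B}"
      by (subst emeasure_distr) (auto intro!: arg_cong[of _ _ "emeasure ?D"])
    also have "\<dots> = (\<integral>\<^sup>+x. indicator {x. x \<noteq> 0 \<and> norm x \<in> A \<and> sgn x \<in> B} x \<partial>lborel)"
      by (subst emeasure_density, simp, simp, intro nn_integral_cong) (simp add: indicator_def)
    also have "\<dots> = emeasure lborel {x. x \<noteq> 0 \<and> norm x \<in> A \<and> sgn x \<in> B}"
      by (rule nn_integral_indicator) measurable
    finally show "emeasure ?R A * emeasure ?S B = emeasure ?M (A \<times> B)"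
      using emeasure_polar_sector[OF N, of B A] by simp
  qed (simp_all add: sigma_finite_radial_measure S.sigma_finite_measure_axioms)
  have [measurable]: "(\<lambda>(r, \<theta>). f (r *\<^sub>R \<theta>)) \<in> borel_measurable (?R \<Otimes>\<^sub>M ?S)"
    by measurable
  have "(\<integral>\<^sup>+x. f x \<partial>lborel) = (\<integral>\<^sup>+x. indicator (- {0}) x * f (norm x *\<^sub>R sgn x) \<partial>lborel)"
  proof (intro nn_integral_cong_AE AE_I[where N = "{0}"])
    have "norm x *\<^sub>R sgn x = x" for x :: "real ^ 'n" by (cases "x = 0") (simp_all add: sgn_div_norm)
    then show "{x \<in> space lborel. f x \<noteq> indicator (- {0}) x * f (norm x *\<^sub>R sgn x)} \<subseteq> {0}"
      by (auto simp: indicator_def)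
  qed auto
  also have "\<dots> = (\<integral>\<^sup>+x. f (norm x *\<^sub>R sgn x) \<partial>?D)"
    by (subst nn_integral_density) auto
  also have "\<dots> = (\<integral>\<^sup>+p. (\<lambda>(r, \<theta>). f (r *\<^sub>R \<theta>)) p \<partial>(?R \<Otimes>\<^sub>M ?S))"
    by (subst eq, subst nn_integral_distr) auto
  also have "\<dots> = (\<integral>\<^sup>+\<theta>. (\<integral>\<^sup>+r. f (r *\<^sub>R \<theta>) \<partial>?R) \<partial>?S)"
    by (subst nn_integral_snd[symmetric]) auto
  also have "\<dots> = (\<integral>\<^sup>+\<theta>. (\<integral>\<^sup>+r. ennreal (r ^ (CARD('n) - 1)) * indicator {0<..} r * f (r *\<^sub>R \<theta>) \<partial>lborel) \<partial>?S)"
    unfolding radial_measure_def by (intro nn_integral_cong nn_integral_density) auto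
  finally show ?thesis .
qed

section \<open>The weight in polar coordinates\<close>

lemma open_upper_half: "open (upper_half m)"
  unfolding upper_half_def by (intro open_Collect_less continuous_intros)

lemma sets_upper_half [measurable]: "upper_half m \<in> sets borel"
  by (rule borel_open[OF open_upper_half])

lemma borel_measurable_weight [measurable]: "weight m \<alpha> p \<in> borel_measurable borel"
  unfolding weight_def[abs_def] by measurable

lemma weight_nonneg: "weight m \<alpha> p x \<ge> 0"
  by (simp add: weight_def)

lemma weight_scaleR:
  assumes "r > 0" "norm \<theta> = 1" "\<theta> $ m \<ge> 0"
  shows "weight m \<alpha> p (r *\<^sub>R \<theta>) = r powr (p + \<alpha>) * (\<theta> $ m) powr \<alpha>"
  using assms by (simp add: weight_def powr_mult powr_add)

text \<open>
  The factor that \<open>weight m \<alpha> p\<close> leaves on the half-sphere in polar coordinates. It is the same for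
  every \<open>p\<close>, which is what allows different powers of the norm to be compared ray by ray.
\<close>

definition angular_measure :: "'n::finite \<Rightarrow> real \<Rightarrow> (real ^ 'n) measure" where
  "angular_measure m \<alpha> = density sphere_measure (\<lambda>\<theta>. ennreal ((\<theta> $ m) powr \<alpha>) * indicator (upper_half m) \<theta>)"

lemma sets_angular_measure [simp, measurable_cong]: "sets (angular_measure m \<alpha>) = sets borel"
  and space_angular_measure [simp]: "space (angular_measure m \<alpha>) = UNIV"
  by (simp_all add: angular_measure_def)

lemma AE_angular_measure: "AE \<theta> in angular_measure m \<alpha>. norm \<theta> = 1 \<and> \<theta> \<in> upper_half m"
  unfolding angular_measure_def
  by (subst AE_density) (use AE_sphere_measure in \<open>auto simp: indicator_def elim!: eventually_mono\<close>)

lemma nn_integral_weight_polar: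
  fixes \<Omega> :: "(real ^ 'n::finite) set"
  assumes N: "CARD('n) \<ge> 2" and \<Omega>[measurable]: "\<Omega> \<in> sets borel" and sub: "\<Omega> \<subseteq> upper_half m"
  shows "(\<integral>\<^sup>+x\<in>\<Omega>. ennreal (weight m \<alpha> p x) \<partial>lborel)
    = (\<integral>\<^sup>+\<theta>. (\<integral>\<^sup>+r. ennreal (r powr (p + \<alpha> + CARD('n) - 1)) * indicator {0<..} r * indicator \<Omega> (r *\<^sub>R \<theta>) \<partial>lborel)
        \<partial>angular_measure m \<alpha>)"
proof -
  let ?g = "\<lambda>\<theta> r. ennreal (r powr (p + \<alpha> + CARD('n) - 1)) * indicator {0<..} r * indicator \<Omega> (r *\<^sub>R \<theta>)"
  let ?w = "\<lambda>\<theta>. ennreal ((\<theta> $ m) powr \<alpha>) * indicator (upper_half m) \<theta>"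
  have [measurable]: "(\<lambda>\<theta>. \<integral>\<^sup>+r. ?g \<theta> r \<partial>lborel) \<in> borel_measurable borel"
    by measurable
  have "(\<integral>\<^sup>+x\<in>\<Omega>. ennreal (weight m \<alpha> p x) \<partial>lborel)
    = (\<integral>\<^sup>+\<theta>. (\<integral>\<^sup>+r. ennreal (r ^ (CARD('n) - 1)) * indicator {0<..} r
        * (ennreal (weight m \<alpha> p (r *\<^sub>R \<theta>)) * indicator \<Omega> (r *\<^sub>R \<theta>)) \<partial>lborel) \<partial>sphere_measure)"
    by (rule nn_integral_polar[OF N]) measurable
  also have "\<dots> = (\<integral>\<^sup>+\<theta>. ?w \<theta> * (\<integral>\<^sup>+r. ?g \<theta> r \<partial>lborel) \<partial>sphere_measure)"
  proof (rule nn_integral_cong_AE, use AE_sphere_measure in eventually_elim)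
    fix \<theta> :: "real ^ 'n" assume \<theta>: "norm \<theta> = 1"
    have "(\<integral>\<^sup>+r. ennreal (r ^ (CARD('n) - 1)) * indicator {0<..} r
        * (ennreal (weight m \<alpha> p (r *\<^sub>R \<theta>)) * indicator \<Omega> (r *\<^sub>R \<theta>)) \<partial>lborel)
      = (\<integral>\<^sup>+r. ?w \<theta> * ?g \<theta> r \<partial>lborel)"
    proof (rule nn_integral_cong)
      fix r :: real
      show "ennreal (r ^ (CARD('n) - 1)) * indicator {0<..} r
          * (ennreal (weight m \<alpha> p (r *\<^sub>R \<theta>)) * indicator \<Omega> (r *\<^sub>R \<theta>)) = ?w \<theta> * ?g \<theta> r"
      proof (cases "r > 0 \<and> r *\<^sub>R \<theta> \<in> \<Omega>")
        case True
        then have r: "r > 0" "r *\<^sub>R \<theta> \<in> \<Omega>" by auto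
        then have "r *\<^sub>R \<theta> \<in> upper_half m" using sub by blast
        then have up: "\<theta> $ m > 0" using r(1) by (simp add: upper_half_def zero_less_mult_iff)
        have "r ^ (CARD('n) - 1) * weight m \<alpha> p (r *\<^sub>R \<theta>)
            = (\<theta> $ m) powr \<alpha> * (r powr (CARD('n) - 1) * r powr (p + \<alpha>))"
          using r up \<theta> N by (simp add: weight_scaleR powr_realpow[symmetric] of_nat_diff)
        also have "r powr (CARD('n) - 1) * r powr (p + \<alpha>) = r powr (p + \<alpha> + CARD('n) - 1)"
          using N by (simp add: powr_add[symmetric] of_nat_diff algebra_simps)
        finally show ?thesis
          using r up by (simp add: upper_half_def ennreal_mult'[symmetric] weight_nonneg)
      qed (auto simp: indicator_def)
    qed
    also have "\<dots> = ?w \<theta> * (\<integral>\<^sup>+r. ?g \<theta> r \<partial>lborel)"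
      by (rule nn_integral_cmult) measurable
    finally show "(\<integral>\<^sup>+r. ennreal (r ^ (CARD('n) - 1)) * indicator {0<..} r
        * (ennreal (weight m \<alpha> p (r *\<^sub>R \<theta>)) * indicator \<Omega> (r *\<^sub>R \<theta>)) \<partial>lborel)
      = ?w \<theta> * (\<integral>\<^sup>+r. ?g \<theta> r \<partial>lborel)" .
  qed
  also have "\<dots> = (\<integral>\<^sup>+\<theta>. (\<integral>\<^sup>+r. ?g \<theta> r \<partial>lborel) \<partial>angular_measure m \<alpha>)"
    unfolding angular_measure_def by (rule nn_integral_density[symmetric]) measurable
  finally show ?thesis .
qed

text \<open>
  The exponent is stated as \<open>c - 1\<close> because \<open>c\<close> is the homogeneity degree of the result.
\<close>

lemma nn_integral_powr_interval:
  assumes "c > 0" "R \<ge> 0"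
  shows "(\<integral>\<^sup>+r. ennreal (r powr (c - 1)) * indicator {0<..<R} r \<partial>lborel) = ennreal (R powr c / c)"
proof -
  have "((\<lambda>r. r powr (c - 1)) has_integral (R powr c / c)) {0..R}"
    using has_integral_powr_from_0[of "c - 1" R] assms by simp
  from nn_integral_has_integral_lebesgue[OF _ this]
  have "(\<integral>\<^sup>+r. ennreal (r powr (c - 1) * indicator {0..R} r) \<partial>lborel) = ennreal (R powr c / c)"
    by (simp add: mult.commute)
  moreover have "(\<integral>\<^sup>+r. ennreal (r powr (c - 1)) * indicator {0<..<R} r \<partial>lborel)
      = (\<integral>\<^sup>+r. ennreal (r powr (c - 1) * indicator {0..R} r) \<partial>lborel)"
    by (intro nn_integral_cong_AE AE_I[where N = "{0, R}"]) (auto simp: indicator_def emeasure_lborel_countable)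
  ultimately show ?thesis by simp
qed

lemma nn_integral_weight_half_ball:
  fixes m :: "'n::finite" and p \<alpha> R :: real
  assumes N: "CARD('n) \<ge> 2" and c: "p + CARD('n) + \<alpha> > 0" and R: "R > 0"
  shows "(\<integral>\<^sup>+x\<in>ball 0 R \<inter> upper_half m. ennreal (weight m \<alpha> p x) \<partial>lborel)
    = ennreal (R powr (p + CARD('n) + \<alpha>) / (p + CARD('n) + \<alpha>)) * emeasure (angular_measure m \<alpha>) UNIV"
proof -
  let ?c = "p + CARD('n) + \<alpha>"
  have "(\<integral>\<^sup>+x\<in>ball 0 R \<inter> upper_half m. ennreal (weight m \<alpha> p x) \<partial>lborel)
    = (\<integral>\<^sup>+\<theta>. (\<integral>\<^sup>+r. ennreal (r powr (p + \<alpha> + CARD('n) - 1)) * indicator {0<..} r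
        * indicator (ball 0 R \<inter> upper_half m) (r *\<^sub>R \<theta>) \<partial>lborel) \<partial>angular_measure m \<alpha>)"
    by (rule nn_integral_weight_polar[OF N]) auto
  also have "\<dots> = (\<integral>\<^sup>+\<theta>. ennreal (R powr ?c / ?c) \<partial>angular_measure m \<alpha>)"
  proof (rule nn_integral_cong_AE, use AE_angular_measure in eventually_elim)
    fix \<theta> :: "real ^ 'n" assume \<theta>: "norm \<theta> = 1 \<and> \<theta> \<in> upper_half m"
    have "(\<integral>\<^sup>+r. ennreal (r powr (p + \<alpha> + CARD('n) - 1)) * indicator {0<..} r
        * indicator (ball 0 R \<inter> upper_half m) (r *\<^sub>R \<theta>) \<partial>lborel)
      = (\<integral>\<^sup>+r. ennreal (r powr (?c - 1)) * indicator {0<..<R} r \<partial>lborel)"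
      using \<theta> by (intro nn_integral_cong) (auto simp: indicator_def upper_half_def add_ac)
    then show "(\<integral>\<^sup>+r. ennreal (r powr (p + \<alpha> + CARD('n) - 1)) * indicator {0<..} r
        * indicator (ball 0 R \<inter> upper_half m) (r *\<^sub>R \<theta>) \<partial>lborel) = ennreal (R powr ?c / ?c)"
      using nn_integral_powr_interval[of ?c R] c R by simp
  qed
  also have "\<dots> = ennreal (R powr ?c / ?c) * emeasure (angular_measure m \<alpha>) UNIV"
    by simp
  finally show ?thesis .
qed

lemma nn_integral_powr_sqrt_power:
  assumes "\<alpha> > - 1"
  shows "(\<integral>\<^sup>+t. ennreal (t powr \<alpha> * sqrt (1 - t\<^sup>2) ^ d) * indicator {0<..<1} t \<partial>lborel)
    = ennreal (Beta ((\<alpha> + 1) / 2) (real d / 2 + 1) / 2)"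
proof -
  let ?I = "\<integral>\<^sup>+t. ennreal (t powr \<alpha> * sqrt (1 - t\<^sup>2) ^ d) * indicator {0<..<1} t \<partial>lborel"
  have "((\<lambda>t. t powr ((\<alpha> + 1) / 2 - 1) * (1 - t) powr (real d / 2)) has_integral
      Beta ((\<alpha> + 1) / 2) (real d / 2 + 1)) {0..1}"
    using has_integral_Beta_real[of "(\<alpha> + 1) / 2" "real d / 2 + 1"] assms by simp
  from nn_integral_has_integral_lebesgue[OF _ this]
  have "ennreal (Beta ((\<alpha> + 1) / 2) (real d / 2 + 1))
      = nn_integral lborel (\<lambda>t. ennreal (t powr ((\<alpha> + 1) / 2 - 1) * (1 - t) powr (real d / 2) * indicator {0^2..1^2} t))"
    by (simp add: mult_ac ennreal_mult' ennreal_indicator)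
  \<comment> \<open>substitute \<open>t = x\<^sup>2\<close> in the Beta integral\<close>
  also have "\<dots> = (\<integral>\<^sup>+x. ennreal ((x\<^sup>2) powr ((\<alpha> + 1) / 2 - 1) * (1 - x\<^sup>2) powr (real d / 2) * (2 * x) * indicator {0..1} x) \<partial>lborel)"
    by (subst nn_integral_substitution[where g = "\<lambda>x. x ^ 2" and g' = "\<lambda>x. 2 * x"])
       (auto intro!: derivative_eq_intros continuous_intros simp: set_borel_measurable_def)
  also have "\<dots> = (\<integral>\<^sup>+x. 2 * (ennreal (x powr \<alpha> * sqrt (1 - x\<^sup>2) ^ d) * indicator {0<..<1} x) \<partial>lborel)"
  proof (intro nn_integral_cong_AE AE_I[where N = "{0, 1}"])
    have "(x\<^sup>2) powr ((\<alpha> + 1) / 2 - 1) * (1 - x\<^sup>2) powr (real d / 2) * (2 * x) = 2 * (x powr \<alpha> * sqrt (1 - x\<^sup>2) ^ d)"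
      if x: "0 < x" "x < 1" for x :: real
    proof -
      have "x\<^sup>2 < 1" using x by (simp add: power_less_one_iff)
      then have "(1 - x\<^sup>2) powr (real d / 2) = sqrt (1 - x\<^sup>2) ^ d"
        by (simp add: powr_half_sqrt[symmetric] powr_realpow[symmetric] powr_powr)
      moreover have "(x\<^sup>2) powr ((\<alpha> + 1) / 2 - 1) * x = x powr \<alpha>"
      proof -
        have "(x\<^sup>2) powr ((\<alpha> + 1) / 2 - 1) = x powr (2 * ((\<alpha> + 1) / 2 - 1))"
          using x by (simp add: powr_numeral[symmetric] powr_powr del: powr_numeral)
        also have "2 * ((\<alpha> + 1) / 2 - 1) = \<alpha> - 1" by simp
        finally have "(x\<^sup>2) powr ((\<alpha> + 1) / 2 - 1) = x powr (\<alpha> - 1)" .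
        moreover have "x powr (\<alpha> - 1) * x powr 1 = x powr \<alpha>" by (subst powr_add[symmetric]) simp
        moreover have "x powr 1 = x" using x by simp
        ultimately show ?thesis by (simp only:)
      qed
      ultimately show ?thesis by (simp add: mult_ac)
    qed
    note id = this
    have "ennreal ((x\<^sup>2) powr ((\<alpha> + 1) / 2 - 1) * (1 - x\<^sup>2) powr (real d / 2) * (2 * x) * indicator {0..1} x)
        = 2 * (ennreal (x powr \<alpha> * sqrt (1 - x\<^sup>2) ^ d) * indicator {0<..<1} x)" if "x \<noteq> 0" "x \<noteq> 1" for x
    proof (cases "0 < x \<and> x < 1")
      case True
      then have "(x\<^sup>2) powr ((\<alpha> + 1) / 2 - 1) * (1 - x\<^sup>2) powr (real d / 2) * (2 * x) = 2 * (x powr \<alpha> * sqrt (1 - x\<^sup>2) ^ d)"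
        by (intro id) auto
      moreover have "ennreal (2 * (x powr \<alpha> * sqrt (1 - x\<^sup>2) ^ d)) = ennreal 2 * ennreal (x powr \<alpha> * sqrt (1 - x\<^sup>2) ^ d)"
        by (rule ennreal_mult') simp
      ultimately have "ennreal ((x\<^sup>2) powr ((\<alpha> + 1) / 2 - 1) * (1 - x\<^sup>2) powr (real d / 2) * (2 * x))
          = ennreal 2 * ennreal (x powr \<alpha> * sqrt (1 - x\<^sup>2) ^ d)"
        by (simp only:)
      then show ?thesis using True by simp
    qed (use that in \<open>auto simp: indicator_def\<close>)
    then show "{x \<in> space lborel. ennreal ((x\<^sup>2) powr ((\<alpha> + 1) / 2 - 1) * (1 - x\<^sup>2) powr (real d / 2) * (2 * x) * indicator {0..1} x)
        \<noteq> 2 * (ennreal (x powr \<alpha> * sqrt (1 - x\<^sup>2) ^ d) * indicator {0<..<1} x)} \<subseteq> {0, 1}"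
      by blast
  qed (auto simp: emeasure_lborel_countable)
  also have "\<dots> = 2 * ?I" by (rule nn_integral_cmult) simp
  finally have "ennreal (1 / 2) * ennreal (Beta ((\<alpha> + 1) / 2) (real d / 2 + 1)) = ennreal (1 / 2) * (ennreal 2 * ?I)"
    by simp
  also have "\<dots> = ennreal (1 / 2 * 2) * ?I" by (simp only: mult.assoc[symmetric] ennreal_mult'[symmetric])
  also have "\<dots> = ?I" by simp
  also have "ennreal (1 / 2) * ennreal (Beta ((\<alpha> + 1) / 2) (real d / 2 + 1)) = ennreal (Beta ((\<alpha> + 1) / 2) (real d / 2 + 1) / 2)"
    by (subst ennreal_mult'[symmetric]) auto
  finally show ?thesis by (rule sym)
qed

text \<open>
  In polar coordinates the weighted volume of the unit half-ball is the total angular mass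
  divided by \<open>CARD('n) + \<alpha>\<close>. Slicing the half-ball by the hyperplanes \<open>x $ m = t\<close>, on the other hand,
  turns the volume into a Beta integral of \<open>t powr \<alpha>\<close> against volumes of balls in dimension
  \<open>CARD('n) - 1\<close>.
\<close>

theorem emeasure_angular_measure:
  fixes m :: "'n::finite"
  assumes N: "CARD('n) \<ge> 2" and \<alpha>: "\<alpha> > 0"
  shows "emeasure (angular_measure m \<alpha>) UNIV = ennreal (Beta ((real CARD('n) - 1) / 2) ((\<alpha> + 1) / 2)
      * (pi powr ((real CARD('n) - 1) / 2) / Gamma ((real CARD('n) - 1) / 2)))"
    (is "?M = ennreal ?K")
proof -
  obtain \<phi> :: "'n codim1 \<Rightarrow> 'n" where "gnomonic m \<phi>" using ex_gnomonic[OF N] by blast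
  then interpret gnomonic m \<phi> .
  let ?d = "CARD('n codim1)"
  have d: "real ?d = real CARD('n) - 1" "?d \<ge> 1" using card_codim1[OF N] N by auto
  let ?H = "ball (0 :: real ^ 'n) 1 \<inter> upper_half m"
  have H: "?H \<in> sets borel" by (intro borel_open open_Int open_ball open_upper_half)
  let ?c = "CARD('n) + \<alpha>"
  let ?B = "Beta ((\<alpha> + 1) / 2) (real ?d / 2 + 1) / 2"
  have "ennreal (1 / ?c) * ?M = (\<integral>\<^sup>+x. ennreal (weight m \<alpha> 0 x) * indicator ?H x \<partial>lborel)"
    using nn_integral_weight_half_ball[OF N, of 0 \<alpha> 1 m] \<alpha> by (simp add: add_pos_nonneg)
  also have "\<dots> = (\<integral>\<^sup>+t. (\<integral>\<^sup>+y. ennreal (weight m \<alpha> 0 (point y t)) * indicator ?H (point y t) \<partial>lborel) \<partial>lborel)"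
    by (rule nn_integral_slices) (use H in measurable)
  also have "\<dots> = (\<integral>\<^sup>+t. ennreal (unit_ball_vol ?d) * (ennreal (t powr \<alpha> * sqrt (1 - t\<^sup>2) ^ ?d) * indicator {0<..<1} t) \<partial>lborel)"
  proof (rule nn_integral_cong)
    fix t :: real
    show "(\<integral>\<^sup>+y. ennreal (weight m \<alpha> 0 (point y t)) * indicator ?H (point y t) \<partial>lborel)
      = ennreal (unit_ball_vol ?d) * (ennreal (t powr \<alpha> * sqrt (1 - t\<^sup>2) ^ ?d) * indicator {0<..<1} t)"
    proof (cases "0 < t \<and> t < 1")
      case True
      then have t2: "t\<^sup>2 < 1" by (simp add: power_less_one_iff)
      have "ennreal (weight m \<alpha> 0 (point y t)) * indicator ?H (point y t)
          = ennreal (t powr \<alpha>) * indicator (ball 0 (sqrt (1 - t\<^sup>2))) y" for y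
      proof -
        have "point y t \<noteq> 0" using True point_m[of y t] by (metis less_irrefl zero_index)
        have "norm (point y t) < 1 \<longleftrightarrow> (norm (point y t))\<^sup>2 < 1"
          by (simp add: abs_square_less_1)
        also have "\<dots> \<longleftrightarrow> (norm y)\<^sup>2 < 1 - t\<^sup>2" unfolding norm_point by auto
        also have "\<dots> \<longleftrightarrow> norm y < sqrt (1 - t\<^sup>2)"
          using real_less_rsqrt[of "norm y" "1 - t\<^sup>2"] real_sqrt_less_iff[of "(norm y)\<^sup>2" "1 - t\<^sup>2"] by auto
        finally show ?thesis
          using True \<open>point y t \<noteq> 0\<close> by (auto simp: weight_def indicator_def upper_half_def)
      qed
      then have "(\<integral>\<^sup>+y. ennreal (weight m \<alpha> 0 (point y t)) * indicator ?H (point y t) \<partial>lborel)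
          = ennreal (t powr \<alpha>) * emeasure lborel (ball (0 :: real ^ 'n codim1) (sqrt (1 - t\<^sup>2)))"
        by (simp add: nn_integral_cmult_indicator)
      also have "emeasure lborel (ball (0 :: real ^ 'n codim1) (sqrt (1 - t\<^sup>2)))
          = ennreal (unit_ball_vol ?d * sqrt (1 - t\<^sup>2) ^ ?d)"
        using t2 by (subst emeasure_ball) auto
      finally show ?thesis using True t2 by (simp add: ennreal_mult'[symmetric] mult_ac)
    next
      case False
      have "point y t \<notin> ?H" for y
      proof
        assume "point y t \<in> ?H"
        then have "0 < t" "norm (point y t) < 1" by (auto simp: upper_half_def)
        moreover have "t \<le> norm (point y t)" using component_le_norm_cart[of "point y t" m] by simp
        ultimately show False using False by auto
      qed
      then show ?thesis using False by simp
    qed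
  qed
  also have "\<dots> = ennreal (unit_ball_vol ?d) * ennreal ?B"
    using \<alpha> by (subst nn_integral_cmult) (simp_all add: nn_integral_powr_sqrt_power)
  finally have eq: "ennreal (1 / ?c) * ?M = ennreal (unit_ball_vol ?d) * ennreal ?B" .
  have one: "ennreal ?c * ennreal (1 / ?c) = 1"
    using \<alpha> by (subst ennreal_mult'[symmetric]) (auto simp: add_nonneg_eq_0_iff)
  have "?M = (ennreal ?c * ennreal (1 / ?c)) * ?M" by (simp only: one mult_1_left)
  also have "\<dots> = ennreal ?c * (ennreal (unit_ball_vol ?d) * ennreal ?B)"
    by (simp only: mult.assoc eq)
  also have "\<dots> = ennreal (?c * (unit_ball_vol ?d * ?B))"
  proof -
    have "0 \<le> ?c" "0 \<le> unit_ball_vol ?d" using \<alpha> by simp_all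
    then show ?thesis by (simp only: ennreal_mult')
  qed
  also have "?c * (unit_ball_vol ?d * ?B) = ?K"
  proof -
    have G: "Gamma (real ?d / 2) > 0" "Gamma (real ?d / 2 + 1) > 0" "Gamma (?c / 2) > 0"
      using d(2) \<alpha> by (auto intro!: Gamma_real_pos)
    have sum: "(\<alpha> + 1) / 2 + (real ?d / 2 + 1) = ?c / 2 + 1" using d(1) by (simp add: field_simps)
    have Gp: "Gamma (?c / 2 + 1) = ?c / 2 * Gamma (?c / 2)"
      using \<alpha> by (intro Gamma_plus1) (auto elim!: nonpos_Ints_cases)
    have B: "?B = Gamma ((\<alpha> + 1) / 2) * Gamma (real ?d / 2 + 1) / (?c * Gamma (?c / 2))"
      unfolding Beta_def sum Gp by simp
    have sum': "real ?d / 2 + (\<alpha> + 1) / 2 = ?c / 2" using d(1) by (simp add: field_simps)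
    have B': "Beta (real ?d / 2) ((\<alpha> + 1) / 2) = Gamma (real ?d / 2) * Gamma ((\<alpha> + 1) / 2) / Gamma (?c / 2)"
      unfolding Beta_def sum' by simp
    have cancel: "c * (p / g2 * (g * g2 / (c * g3))) = g1 * g / g3 * (p / g1)"
      if "c \<noteq> 0" "g1 \<noteq> 0" "g2 \<noteq> 0" "g3 \<noteq> 0" for c p g g1 g2 g3 :: real
      using that by simp
    show ?thesis
      unfolding d(1)[symmetric] B B' unit_ball_vol_def using \<alpha>
      by (intro cancel G[THEN less_imp_neq, THEN not_sym]) auto
  qed
  finally show ?thesis .
qed

section \<open>Weighted perimeter and weighted volume\<close>

lemma emeasure_density_indicator:
  assumes "A \<in> sets M" "B \<in> sets M"
  shows "emeasure (density M (indicator A)) B = emeasure M (A \<inter> B)"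
  using assms by (subst emeasure_density) (auto simp flip: indicator_inter_arith)

lemma emeasure_sphere_measure_hausdorff:
  fixes B :: "(real ^ 'n::finite) set"
  assumes B: "B \<in> sets borel" and sub: "B \<subseteq> sphere 0 1"
  shows "emeasure sphere_measure B = hausdorff_outer (CARD('n) - 1) B"
proof -
  have "sphere (0 :: real ^ 'n) 1 \<inter> B = B" using sub by blast
  moreover have "sphere (0 :: real ^ 'n) 1 \<in> sets borel" by (rule borel_closed[OF closed_sphere])
  ultimately show ?thesis
    unfolding sphere_measure_def using B by (subst emeasure_density_indicator) (simp_all add: emeasure_hausdorff_measure)
qed

text \<open>
  Outside the ball of radius \<open>\<rho>\<close> the map \<open>sgn\<close> is Lipschitz with constant \<open>1 / \<rho>\<close>, so \<open>A\<close> has at least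
  \<open>\<rho> ^ (CARD('n) - 1)\<close> times the measure of its shadow on the sphere. Stated for measures, this
  passes to integrals of any function of the direction.
\<close>

lemma radial_projection_le:
  fixes A :: "(real ^ 'n::finite) set"
  assumes A [measurable]: "A \<in> sets borel" and pA [measurable]: "sgn ` A \<in> sets borel"
    and \<rho>: "\<rho> > 0" "\<And>x. x \<in> A \<Longrightarrow> \<rho> \<le> norm x"
    and g [measurable]: "g \<in> borel_measurable borel"
  shows "ennreal (\<rho> ^ (CARD('n) - 1)) * (\<integral>\<^sup>+\<theta>\<in>sgn ` A. g \<theta> \<partial>sphere_measure)
    \<le> (\<integral>\<^sup>+x\<in>A. g (sgn x) \<partial>hausdorff_measure (CARD('n) - 1))"
proof -
  let ?d = "CARD('n) - 1"
  let ?H = "hausdorff_measure ?d :: (real ^ 'n) measure"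
  let ?M1 = "distr (density ?H (indicator A)) borel sgn"
  let ?M2 = "scale_measure (ennreal (\<rho> ^ ?d)) (density sphere_measure (indicator (sgn ` A)))"
  have sgnm: "sgn \<in> density ?H (indicator A) \<rightarrow>\<^sub>M borel"
    using borel_measurable_sgn_vec by (simp cong: measurable_cong_sets)
  have nz: "x \<noteq> 0" if "x \<in> A" for x using \<rho> that by force
  have "?M2 \<le> ?M1"
  proof (subst le_measure)
    show "\<forall>E\<in>sets ?M2. emeasure ?M2 E \<le> emeasure ?M1 E"
    proof
      fix E assume "E \<in> sets ?M2"
      then have E [measurable]: "E \<in> sets borel" by simp
      have sE: "sgn -` E \<in> sets (borel :: (real ^ 'n) measure)"
        using measurable_sets_borel[OF borel_measurable_sgn_vec E] .
      have AE: "A \<inter> sgn -` E \<in> sets borel" using sE by simp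
      have im: "sgn ` (A \<inter> sgn -` E) = sgn ` A \<inter> E" by blast
      have "emeasure ?M2 E = ennreal (\<rho> ^ ?d) * hausdorff_outer ?d (sgn ` (A \<inter> sgn -` E))"
      proof -
        have "emeasure (density sphere_measure (indicator (sgn ` A))) E = emeasure sphere_measure (sgn ` A \<inter> E)"
          by (rule emeasure_density_indicator) simp_all
        also have "\<dots> = hausdorff_outer ?d (sgn ` A \<inter> E)"
          using nz by (intro emeasure_sphere_measure_hausdorff) (auto simp: norm_sgn)
        finally show ?thesis by (simp only: im emeasure_scale_measure)
      qed
      also have "\<dots> \<le> ennreal (\<rho> ^ ?d) * (ennreal ((1 / \<rho>) ^ ?d) * hausdorff_outer ?d (A \<inter> sgn -` E))"
        using \<rho> by (intro mult_left_mono hausdorff_outer_Lipschitz_image dist_sgn_le) auto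
      also have "\<dots> = ennreal (\<rho> ^ ?d * (1 / \<rho>) ^ ?d) * hausdorff_outer ?d (A \<inter> sgn -` E)"
        using \<rho> by (simp add: ennreal_mult' mult.assoc)
      also have "\<rho> ^ ?d * (1 / \<rho>) ^ ?d = 1" using \<rho> by (simp flip: power_mult_distrib)
      also have "hausdorff_outer ?d (A \<inter> sgn -` E) = emeasure ?H (A \<inter> sgn -` E)"
        by (rule emeasure_hausdorff_measure[OF AE, symmetric])
      also have "\<dots> = emeasure ?M1 E"
        using sE by (subst emeasure_distr[OF sgnm]) (simp_all add: emeasure_density_indicator)
      finally show "emeasure ?M2 E \<le> emeasure ?M1 E" by simp
    qed
  qed simp
  then have "nn_integral ?M2 g \<le> nn_integral ?M1 g"
    by (intro nn_integral_mono_measure) simp_all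
  also have "nn_integral ?M1 g = (\<integral>\<^sup>+x. g (sgn x) \<partial>density ?H (indicator A))"
    by (rule nn_integral_distr[OF sgnm]) simp
  also have "\<dots> = (\<integral>\<^sup>+x. indicator A x * g (sgn x) \<partial>?H)"
  proof (rule nn_integral_density)
    have "(\<lambda>x. g (sgn x)) \<in> borel_measurable borel" by measurable
    then show "(\<lambda>x. g (sgn x)) \<in> borel_measurable ?H" by (simp cong: measurable_cong_sets)
  qed simp
  also have "nn_integral ?M2 g = ennreal (\<rho> ^ ?d) * (\<integral>\<^sup>+\<theta>\<in>sgn ` A. g \<theta> \<partial>sphere_measure)"
    by (simp add: nn_integral_scale_measure nn_integral_density mult.commute)
  finally show ?thesis by (simp add: mult.commute)
qed

text \<open>
  Continuous images of Borel sets need not be Borel, but those of countable unions of compact sets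
  are.
\<close>

lemma sets_sgn_image_shell:
  fixes F :: "'a::euclidean_space set"
  assumes F: "closed F" and a: "a > 0"
  shows "sgn ` (F \<inter> {x. a \<le> norm x \<and> norm x < b}) \<in> sets borel"
proof -
  \<comment> \<open>The half-open shell is a countable union of compact ones.\<close>
  let ?C = "\<lambda>n. F \<inter> {x. a \<le> norm x \<and> norm x \<le> b - 1 / real (Suc n)}"
  have "F \<inter> {x. a \<le> norm x \<and> norm x < b} = (\<Union>n. ?C n)"
  proof (intro set_eqI iffI)
    fix x assume x: "x \<in> F \<inter> {x. a \<le> norm x \<and> norm x < b}"
    then obtain n where "1 / real (Suc n) < b - norm x" using nat_approx_posE[of "b - norm x"] by auto
    then have "x \<in> ?C n" using x by simp
    then show "x \<in> (\<Union>n. ?C n)" by blast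
  next
    fix x assume "x \<in> (\<Union>n. ?C n)"
    then obtain n where "x \<in> F" "a \<le> norm x" "norm x \<le> b - 1 / real (Suc n)" by blast
    moreover have "1 / real (Suc n) > 0" by simp
    ultimately have "norm x < b" by linarith
    then show "x \<in> F \<inter> {x. a \<le> norm x \<and> norm x < b}"
      using \<open>x \<in> F\<close> \<open>a \<le> norm x\<close> by simp
  qed
  then have "sgn ` (F \<inter> {x. a \<le> norm x \<and> norm x < b}) = (\<Union>n. sgn ` ?C n)"
    by (simp only: image_UN)
  moreover have "sgn ` ?C n \<in> sets borel" for n
  proof -
    have "bounded (?C n)" by (auto simp: bounded_iff intro!: exI[of _ "b - 1 / real (Suc n)"])
    moreover have "closed (?C n)"
      using F by (intro closed_Int closed_Collect_conj closed_Collect_le continuous_intros)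
    ultimately have "compact (?C n)" by (simp add: compact_eq_bounded_closed)
    moreover have "continuous_on (?C n) sgn"
      using a by (intro continuous_on_sgn continuous_on_id) auto
    ultimately have "compact (sgn ` ?C n)" by (intro compact_continuous_image)
    then show ?thesis by (intro borel_closed compact_imp_closed)
  qed
  ultimately show ?thesis by simp
qed

lemma powr_ge_on_shell:
  fixes e :: real
  assumes "s > 0" "\<rho> > 1" "s \<le> r" "r \<le> \<rho> * s"
  shows "\<rho> powr (- \<bar>e\<bar>) * s powr e \<le> r powr e"
proof (cases "e \<ge> 0")
  case True
  have "\<rho> powr (- \<bar>e\<bar>) \<le> \<rho> powr 0" using assms by (intro powr_mono) auto
  then have "\<rho> powr (- \<bar>e\<bar>) * s powr e \<le> 1 * s powr e" using assms by (intro mult_right_mono) auto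
  also have "\<dots> \<le> r powr e" using True assms by (simp add: powr_mono2)
  finally show ?thesis .
next
  case False
  then have "\<rho> powr (- \<bar>e\<bar>) * s powr e = (\<rho> * s) powr e" using assms by (simp add: powr_mult)
  also have "\<dots> \<le> r powr e" using False assms by (intro powr_mono2') auto
  finally show ?thesis .
qed

text \<open>
  In a thin shell the norm is constant up to the factor \<open>\<rho>\<close>, so the weight is, up to
  \<open>\<rho> powr \<bar>k + \<alpha>\<bar>\<close>, a constant times a function of the direction. The exponent of \<open>s\<close> collects
  \<open>k + \<alpha>\<close> from the weight and \<open>CARD('n) - 1\<close> from the projection.
\<close>

lemma perimeter_shell_ge:
  fixes A :: "(real ^ 'n::finite) set"
  assumes N: "CARD('n) \<ge> 2" and A: "A \<in> sets borel" "sgn ` A \<in> sets borel"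
    and \<rho>: "\<rho> > 1" "s > 0" and shell: "\<And>x. x \<in> A \<Longrightarrow> s \<le> norm x \<and> norm x \<le> \<rho> * s"
  shows "ennreal (\<rho> powr (- \<bar>k + \<alpha>\<bar>) * s powr (k + CARD('n) + \<alpha> - 1)) * emeasure (angular_measure m \<alpha>) (sgn ` A)
    \<le> (\<integral>\<^sup>+x\<in>A. ennreal (weight m \<alpha> k x) \<partial>hausdorff_measure (CARD('n) - 1))"
proof -
  let ?d = "CARD('n) - 1"
  let ?H = "hausdorff_measure ?d :: (real ^ 'n) measure"
  let ?w = "\<lambda>\<theta>. ennreal ((\<theta> $ m) powr \<alpha>) * indicator (upper_half m) \<theta>"
  let ?c = "\<rho> powr (- \<bar>k + \<alpha>\<bar>) * s powr (k + \<alpha>)"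
  have wm [measurable]: "?w \<in> borel_measurable borel" by measurable
  have "emeasure (angular_measure m \<alpha>) (sgn ` A) = (\<integral>\<^sup>+\<theta>\<in>sgn ` A. ?w \<theta> \<partial>sphere_measure)"
    unfolding angular_measure_def using A by (subst emeasure_density) auto
  moreover have "\<rho> powr (- \<bar>k + \<alpha>\<bar>) * s powr (k + CARD('n) + \<alpha> - 1) = ?c * s ^ ?d"
    using \<rho> N by (simp add: powr_realpow[symmetric] powr_add[symmetric] of_nat_diff algebra_simps)
  ultimately have "ennreal (\<rho> powr (- \<bar>k + \<alpha>\<bar>) * s powr (k + CARD('n) + \<alpha> - 1)) * emeasure (angular_measure m \<alpha>) (sgn ` A)
      = ennreal ?c * (ennreal (s ^ ?d) * (\<integral>\<^sup>+\<theta>\<in>sgn ` A. ?w \<theta> \<partial>sphere_measure))"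
    using \<rho> by (simp add: ennreal_mult' mult.assoc)
  also have "\<dots> \<le> ennreal ?c * (\<integral>\<^sup>+x\<in>A. ?w (sgn x) \<partial>?H)"
    using A \<rho> shell by (intro mult_left_mono radial_projection_le) auto
  also have "\<dots> = (\<integral>\<^sup>+x. ennreal ?c * (?w (sgn x) * indicator A x) \<partial>?H)"
  proof (rule nn_integral_cmult[symmetric])
    have "(\<lambda>x. ?w (sgn x) * indicator A x) \<in> borel_measurable borel" using A(1) by measurable
    then show "(\<lambda>x. ?w (sgn x) * indicator A x) \<in> borel_measurable ?H" by (simp cong: measurable_cong_sets)
  qed
  also have "\<dots> \<le> (\<integral>\<^sup>+x\<in>A. ennreal (weight m \<alpha> k x) \<partial>?H)"
  proof (rule nn_integral_mono)
    fix x :: "real ^ 'n"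
    show "ennreal ?c * (?w (sgn x) * indicator A x) \<le> ennreal (weight m \<alpha> k x) * indicator A x"
    proof (cases "x \<in> A \<and> sgn x \<in> upper_half m")
      case True
      then have x: "s \<le> norm x" "norm x \<le> \<rho> * s" "sgn x $ m > 0" using shell by (auto simp: upper_half_def)
      then have nx: "norm x > 0" using \<rho> by linarith
      then have "weight m \<alpha> k (norm x *\<^sub>R sgn x) = norm x powr (k + \<alpha>) * (sgn x $ m) powr \<alpha>"
        using x by (intro weight_scaleR) (auto simp: norm_sgn)
      moreover have "norm x *\<^sub>R sgn x = x" using nx by (simp add: sgn_div_norm)
      ultimately have w: "weight m \<alpha> k x = norm x powr (k + \<alpha>) * (sgn x $ m) powr \<alpha>" by simp
      have "?c * (sgn x $ m) powr \<alpha> \<le> weight m \<alpha> k x"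
        unfolding w using powr_ge_on_shell[of s \<rho> "norm x" "k + \<alpha>"] \<rho> x by (intro mult_right_mono) auto
      then show ?thesis using True \<rho> by (simp add: ennreal_mult'[symmetric] ennreal_leI)
    qed (auto simp: indicator_def)
  qed
  finally show ?thesis .
qed

lemma ray_leaves_through_frontier:
  fixes \<Omega> :: "'a::euclidean_space set"
  assumes "open \<Omega>" "0 < r" "r *\<^sub>R \<theta> \<in> \<Omega>" "r < R" "R *\<^sub>R \<theta> \<notin> \<Omega>"
  shows "\<exists>t>r. t *\<^sub>R \<theta> \<in> frontier \<Omega>"
proof -
  let ?S = "(\<lambda>t. t *\<^sub>R \<theta>) ` {r..R}"
  have "connected ?S" by (intro connected_continuous_image continuous_intros) auto
  moreover have "r *\<^sub>R \<theta> \<in> ?S \<inter> \<Omega>" "R *\<^sub>R \<theta> \<in> ?S - \<Omega>" using assms by auto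
  then have "?S \<inter> \<Omega> \<noteq> {}" "?S - \<Omega> \<noteq> {}" by blast+
  ultimately have "?S \<inter> frontier \<Omega> \<noteq> {}" by (rule connected_Int_frontier)
  then obtain t where t: "r \<le> t" "t *\<^sub>R \<theta> \<in> frontier \<Omega>" by auto
  have "t \<noteq> r" using t(2) assms(1,3) by (auto simp: frontier_def interior_open)
  then show ?thesis using t by force
qed

text \<open>
  If a ray stayed in \<open>\<Omega>\<close> from some point on, its contribution to the weighted volume would be
  infinite, as \<open>r powr (a - 1)\<close> with \<open>a > 0\<close> is not integrable at infinity.
\<close>

lemma AE_ray_leaves:
  fixes \<Omega> :: "(real ^ 'n::finite) set" and l \<alpha> :: real
  assumes N: "CARD('n) \<ge> 2" and \<Omega>: "\<Omega> \<in> sets borel" "\<Omega> \<subseteq> upper_half m"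
    and a: "l + CARD('n) + \<alpha> > 0" and fin: "(\<integral>\<^sup>+x\<in>\<Omega>. ennreal (weight m \<alpha> l x) \<partial>lborel) < \<infinity>"
  shows "AE \<theta> in angular_measure m \<alpha>. \<forall>r. \<exists>R>r. R *\<^sub>R \<theta> \<notin> \<Omega>"
proof -
  let ?a = "l + CARD('n) + \<alpha>"
  let ?I = "\<lambda>\<theta>. \<integral>\<^sup>+r. ennreal (r powr (l + \<alpha> + CARD('n) - 1)) * indicator {0<..} r * indicator \<Omega> (r *\<^sub>R \<theta>) \<partial>lborel"
  note \<Omega>(1) [measurable]
  have "?I \<in> borel_measurable borel" by measurable
  moreover have "integral\<^sup>N (angular_measure m \<alpha>) ?I \<noteq> \<infinity>"
    using fin nn_integral_weight_polar[OF N \<Omega>, of \<alpha> l] by simp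
  ultimately have "AE \<theta> in angular_measure m \<alpha>. ?I \<theta> \<noteq> \<infinity>"
    by (intro nn_integral_PInf_AE) (simp_all cong: measurable_cong_sets)
  then show ?thesis
  proof eventually_elim
    fix \<theta> assume I: "?I \<theta> \<noteq> \<infinity>"
    show "\<forall>r. \<exists>R>r. R *\<^sub>R \<theta> \<notin> \<Omega>"
    proof (rule ccontr)
      assume "\<not> (\<forall>r. \<exists>R>r. R *\<^sub>R \<theta> \<notin> \<Omega>)"
      then obtain r0 where r0: "\<And>r. r > r0 \<Longrightarrow> r *\<^sub>R \<theta> \<in> \<Omega>" by (meson not_le)
      define r1 where "r1 = max r0 0 + 1"
      have r1: "r1 > 0" "\<And>r. r \<ge> r1 \<Longrightarrow> r *\<^sub>R \<theta> \<in> \<Omega>" using r0 by (auto simp: r1_def)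
      have le: "ennreal (M powr ?a / ?a) \<le> ?I \<theta> + ennreal (r1 powr ?a / ?a)" if "M > 0" for M
      proof -
        have "ennreal (M powr ?a / ?a) = (\<integral>\<^sup>+r. ennreal (r powr (?a - 1)) * indicator {0<..<M} r \<partial>lborel)"
          using a that by (intro nn_integral_powr_interval[symmetric]) auto
        also have "\<dots> \<le> (\<integral>\<^sup>+r. (ennreal (r powr (l + \<alpha> + CARD('n) - 1)) * indicator {0<..} r * indicator \<Omega> (r *\<^sub>R \<theta>))
            + ennreal (r powr (?a - 1)) * indicator {0<..<r1} r \<partial>lborel)"
          using r1 by (intro nn_integral_mono) (auto simp: indicator_def add_ac not_less)
        also have "\<dots> = ?I \<theta> + (\<integral>\<^sup>+r. ennreal (r powr (?a - 1)) * indicator {0<..<r1} r \<partial>lborel)"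
          by (rule nn_integral_add) measurable
        also have "(\<integral>\<^sup>+r. ennreal (r powr (?a - 1)) * indicator {0<..<r1} r \<partial>lborel) = ennreal (r1 powr ?a / ?a)"
          using a r1 by (intro nn_integral_powr_interval) auto
        finally show ?thesis .
      qed
      obtain v where v: "?I \<theta> = ennreal v" "v \<ge> 0" using I by (cases "?I \<theta>") auto
      define u where "u = v + r1 powr ?a / ?a"
      have u: "u \<ge> 0" "?I \<theta> + ennreal (r1 powr ?a / ?a) = ennreal u"
        using v a by (simp_all add: u_def)
      \<comment> \<open>chosen so that the truncated ray integral, \<open>M powr a / a\<close>, exceeds the bound \<open>u\<close>\<close>
      define M where "M = (?a * (u + 1)) powr (1 / ?a)"
      have "M > 0" using a u by (simp add: M_def)
      have "M powr ?a = ?a * (u + 1)" using a u by (simp add: M_def powr_powr)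
      then have "M powr ?a / ?a = u + 1" using a by simp
      then show False using le[OF \<open>M > 0\<close>] u by (simp add: ennreal_le_iff del: ennreal_plus)
    qed
  qed
qed

lemma ennreal_le_suminf:
  fixes f :: "nat \<Rightarrow> ennreal"
  shows "f n \<le> (\<Sum>i. f i)"
  using sum_le_suminf[of f "{n}"] by simp

lemma powr_shell_unique:
  assumes "\<rho> > 1" "r > 0" "\<rho> powr real_of_int j \<le> r" "r < \<rho> powr (real_of_int j + 1)"
  shows "\<lfloor>log \<rho> r\<rfloor> = j"
  using assms by (intro floor_unique) (simp_all add: le_log_iff log_less_iff)

text \<open>
  A substitute for the divergence theorem applied to the field \<open>norm x powr (k - 1) * x $ m powr \<alpha>\<close>
  times \<open>x\<close>, whose divergence is \<open>k + CARD('n) + \<alpha> - 1\<close> times the weight with exponent \<open>k - 1\<close>. Along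
  a ray that leaves \<open>\<Omega>\<close>, the integral of \<open>c * r powr (c - 1)\<close> over the part in \<open>\<Omega>\<close> is at most
  \<open>T powr c\<close>, where \<open>T\<close> is the distance of the last frontier point on the ray (or the supremum
  of these distances). Discretising \<open>T\<close> by the shells \<open>\<rho> powr j \<le> norm x < \<rho> powr (j + 1)\<close> bounds
  this by a sum over all shells whose shadow contains the direction, and the shadows are
  controlled by the perimeter.
\<close>

lemma perimeter_ge_volume_shells:
  fixes \<Omega> :: "(real ^ 'n::finite) set" and k \<alpha> \<rho> :: real
  assumes N: "CARD('n) \<ge> 2" and \<Omega>: "open \<Omega>" "\<Omega> \<subseteq> upper_half m"
    and c: "k + CARD('n) + \<alpha> - 1 > 0" and \<rho>: "\<rho> > 1"
    and leaves: "AE \<theta> in angular_measure m \<alpha>. \<forall>r. \<exists>R>r. R *\<^sub>R \<theta> \<notin> \<Omega>"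
  shows "ennreal (k + CARD('n) + \<alpha> - 1) * (\<integral>\<^sup>+x\<in>\<Omega>. ennreal (weight m \<alpha> (k - 1) x) \<partial>lborel)
    \<le> ennreal (\<rho> powr (k + CARD('n) + \<alpha> - 1 + \<bar>k + \<alpha>\<bar>)) * weighted_perimeter m \<alpha> k \<Omega>"
proof -
  let ?c = "k + CARD('n) + \<alpha> - 1"
  let ?H = "hausdorff_measure (CARD('n) - 1) :: (real ^ 'n) measure"
  let ?ang = "angular_measure m \<alpha>"
  \<comment> \<open>The shells are indexed by all integers \<open>j\<close>, since the frontier may reach both 0 and
      infinity; \<open>int_decode\<close> turns the sums over \<open>j\<close> into series.\<close>
  define z where "z = int_decode"
  define s where "s j = \<rho> powr (real_of_int j)" for j :: int
  define A where "A n = frontier \<Omega> \<inter> {x. s (z n) \<le> norm x \<and> norm x < s (z n + 1)}" for n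
  have s: "s j > 0" "s (j + 1) = \<rho> * s j" for j using \<rho> by (simp_all add: s_def powr_add)
  have \<Omega>m [measurable]: "\<Omega> \<in> sets borel" using \<Omega>(1) by (rule borel_open)
  have Am: "A n \<in> sets borel" for n
  proof -
    have "{x :: real ^ 'n. s (z n) \<le> norm x \<and> norm x < s (z n + 1)} \<in> sets borel" by measurable
    with borel_closed[OF frontier_closed] show ?thesis unfolding A_def by (rule sets.Int)
  qed
  have sAm [measurable]: "sgn ` A n \<in> sets borel" for n
    unfolding A_def by (intro sets_sgn_image_shell frontier_closed s)
  have disj: "disjoint_family A"
  proof (unfold disjoint_family_on_def, intro ballI impI)
    fix i j :: nat assume "i \<noteq> j"
    have "\<lfloor>log \<rho> (norm x)\<rfloor> = z n" if "x \<in> A n" for x n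
    proof (rule powr_shell_unique)
      have "s (z n) \<le> norm x" using that by (simp add: A_def)
      with s(1)[of "z n"] show "norm x > 0" by (rule less_le_trans)
    qed (use that \<rho> in \<open>auto simp: A_def s_def\<close>)
    moreover have "z i \<noteq> z j" using \<open>i \<noteq> j\<close> by (simp add: z_def inj_eq inj_int_decode)
    ultimately show "A i \<inter> A j = {}" by (metis disjoint_iff)
  qed
  let ?w = "\<lambda>x. ennreal (weight m \<alpha> k x)"
  have wH: "?w \<in> borel_measurable ?H" by (simp cong: measurable_cong_sets)
  have sum_le: "(\<Sum>n. \<integral>\<^sup>+x\<in>A n. ?w x \<partial>?H) \<le> weighted_perimeter m \<alpha> k \<Omega>"
  proof -
    have fr: "frontier \<Omega> \<in> sets ?H" by (simp add: borel_closed frontier_closed)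
    have "(\<Sum>n. \<integral>\<^sup>+x\<in>A n. ?w x \<partial>?H) = (\<Sum>n. emeasure (density ?H ?w) (A n))"
      using Am wH by (simp add: emeasure_density)
    also have "\<dots> = emeasure (density ?H ?w) (\<Union>n. A n)"
      using Am disj by (intro suminf_emeasure) auto
    also have "\<dots> \<le> emeasure (density ?H ?w) (frontier \<Omega>)"
      using fr by (intro emeasure_mono) (auto simp: A_def)
    also have "\<dots> = weighted_perimeter m \<alpha> k \<Omega>"
      unfolding weighted_perimeter_def using fr wH by (simp add: emeasure_density)
    finally show ?thesis .
  qed
  have shell: "ennreal (\<rho> powr (- \<bar>k + \<alpha>\<bar>) * s (z n) powr ?c) * emeasure ?ang (sgn ` A n)
      \<le> (\<integral>\<^sup>+x\<in>A n. ?w x \<partial>?H)" for n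
    using Am sAm \<rho> s by (intro perimeter_shell_ge[OF N]) (auto simp: A_def)
  let ?I = "\<lambda>\<theta>. \<integral>\<^sup>+r. ennreal (r powr (k - 1 + \<alpha> + CARD('n) - 1)) * indicator {0<..} r * indicator \<Omega> (r *\<^sub>R \<theta>) \<partial>lborel"
  have Im [measurable]: "?I \<in> borel_measurable borel" by measurable
  have ray: "AE \<theta> in ?ang. ennreal ?c * ?I \<theta> \<le> (\<Sum>n. ennreal (s (z n + 1) powr ?c) * indicator (sgn ` A n) \<theta>)"
    using leaves AE_angular_measure[of m \<alpha>]
  proof eventually_elim
    fix \<theta> assume leaves: "\<forall>r. \<exists>R>r. R *\<^sub>R \<theta> \<notin> \<Omega>" and \<theta>: "norm \<theta> = 1 \<and> \<theta> \<in> upper_half m"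
    \<comment> \<open>Behind each \<open>r\<close> with \<open>r *\<^sub>R \<theta> \<in> \<Omega>\<close> there is a frontier point on the same ray, so
        \<open>{0<..<s (j + 1)}\<close> contains \<open>r\<close> for some shell \<open>j\<close> whose projection contains \<open>\<theta>\<close>.\<close>
    have "?I \<theta> \<le> (\<integral>\<^sup>+r. (\<Sum>n. indicator (sgn ` A n) \<theta> * (ennreal (r powr (?c - 1)) * indicator {0<..<s (z n + 1)} r)) \<partial>lborel)"
    proof (rule nn_integral_mono)
      fix r :: real
      show "ennreal (r powr (k - 1 + \<alpha> + CARD('n) - 1)) * indicator {0<..} r * indicator \<Omega> (r *\<^sub>R \<theta>)
        \<le> (\<Sum>n. indicator (sgn ` A n) \<theta> * (ennreal (r powr (?c - 1)) * indicator {0<..<s (z n + 1)} r))"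
      proof (cases "r > 0 \<and> r *\<^sub>R \<theta> \<in> \<Omega>")
        case True
        obtain R where "R > r" "R *\<^sub>R \<theta> \<notin> \<Omega>" using leaves by blast
        then obtain t where t: "t > r" "t *\<^sub>R \<theta> \<in> frontier \<Omega>"
          using ray_leaves_through_frontier[OF \<Omega>(1), of r \<theta> R] True by blast
        define j where "j = \<lfloor>log \<rho> t\<rfloor>"
        have j: "s j \<le> t" "t < s (j + 1)"
          using floor_correct[of "log \<rho> t"] t True \<rho> unfolding s_def j_def[symmetric]
          by (auto simp: le_log_iff log_less_iff)
        define n where "n = int_encode j"
        have n: "z n = j" by (simp add: n_def z_def)
        have "t *\<^sub>R \<theta> \<in> A n" using t j True \<theta> by (simp add: A_def n)
        moreover have "sgn (t *\<^sub>R \<theta>) = \<theta>" using t True \<theta> by (simp add: sgn_scaleR_pos sgn_div_norm)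
        ultimately have "\<theta> \<in> sgn ` A n" by (metis image_eqI)
        then have "ennreal (r powr (k - 1 + \<alpha> + CARD('n) - 1)) * indicator {0<..} r * indicator \<Omega> (r *\<^sub>R \<theta>)
          = indicator (sgn ` A n) \<theta> * (ennreal (r powr (?c - 1)) * indicator {0<..<s (z n + 1)} r)"
          using True t j n by (simp add: algebra_simps)
        also have "\<dots> \<le> (\<Sum>n. indicator (sgn ` A n) \<theta> * (ennreal (r powr (?c - 1)) * indicator {0<..<s (z n + 1)} r))"
          by (rule ennreal_le_suminf)
        finally show ?thesis .
      qed (auto simp: indicator_def)
    qed
    also have "\<dots> = (\<Sum>n. \<integral>\<^sup>+r. indicator (sgn ` A n) \<theta> * (ennreal (r powr (?c - 1)) * indicator {0<..<s (z n + 1)} r) \<partial>lborel)"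
      by (rule nn_integral_suminf) measurable
    also have "\<dots> = (\<Sum>n. indicator (sgn ` A n) \<theta> * ennreal (s (z n + 1) powr ?c / ?c))"
    proof (rule suminf_cong)
      fix n
      have "(\<integral>\<^sup>+r. indicator (sgn ` A n) \<theta> * (ennreal (r powr (?c - 1)) * indicator {0<..<s (z n + 1)} r) \<partial>lborel)
        = indicator (sgn ` A n) \<theta> * (\<integral>\<^sup>+r. ennreal (r powr (?c - 1)) * indicator {0<..<s (z n + 1)} r \<partial>lborel)"
        by (rule nn_integral_cmult) measurable
      also have "(\<integral>\<^sup>+r. ennreal (r powr (?c - 1)) * indicator {0<..<s (z n + 1)} r \<partial>lborel) = ennreal (s (z n + 1) powr ?c / ?c)"
        using c s(1)[of "z n + 1"] by (intro nn_integral_powr_interval) auto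
      finally show "(\<integral>\<^sup>+r. indicator (sgn ` A n) \<theta> * (ennreal (r powr (?c - 1)) * indicator {0<..<s (z n + 1)} r) \<partial>lborel)
        = indicator (sgn ` A n) \<theta> * ennreal (s (z n + 1) powr ?c / ?c)" .
    qed
    finally have "ennreal ?c * ?I \<theta> \<le> ennreal ?c * (\<Sum>n. indicator (sgn ` A n) \<theta> * ennreal (s (z n + 1) powr ?c / ?c))"
      by (rule mult_left_mono) simp
    also have "\<dots> = (\<Sum>n. ennreal ?c * (indicator (sgn ` A n) \<theta> * ennreal (s (z n + 1) powr ?c / ?c)))"
      by (rule ennreal_suminf_cmult[symmetric])
    also have "\<dots> = (\<Sum>n. ennreal (s (z n + 1) powr ?c) * indicator (sgn ` A n) \<theta>)"
    proof (rule suminf_cong)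
      fix n
      have "ennreal ?c * ennreal (s (z n + 1) powr ?c / ?c) = ennreal (s (z n + 1) powr ?c)"
        using c by (subst ennreal_mult'[symmetric]) auto
      then show "ennreal ?c * (indicator (sgn ` A n) \<theta> * ennreal (s (z n + 1) powr ?c / ?c))
        = ennreal (s (z n + 1) powr ?c) * indicator (sgn ` A n) \<theta>"
        by (auto simp: indicator_def)
    qed
    finally show "ennreal ?c * ?I \<theta> \<le> (\<Sum>n. ennreal (s (z n + 1) powr ?c) * indicator (sgn ` A n) \<theta>)" .
  qed
  have "ennreal ?c * (\<integral>\<^sup>+x\<in>\<Omega>. ennreal (weight m \<alpha> (k - 1) x) \<partial>lborel) = ennreal ?c * (\<integral>\<^sup>+\<theta>. ?I \<theta> \<partial>?ang)"
    by (subst nn_integral_weight_polar[OF N \<Omega>m \<Omega>(2)]) (rule refl)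
  also have "\<dots> = (\<integral>\<^sup>+\<theta>. ennreal ?c * ?I \<theta> \<partial>?ang)"
    by (rule nn_integral_cmult[symmetric]) (use Im in \<open>simp cong: measurable_cong_sets\<close>)
  also have "\<dots> \<le> (\<integral>\<^sup>+\<theta>. (\<Sum>n. ennreal (s (z n + 1) powr ?c) * indicator (sgn ` A n) \<theta>) \<partial>?ang)"
    using ray by (rule nn_integral_mono_AE)
  also have "\<dots> = (\<Sum>n. ennreal (s (z n + 1) powr ?c) * emeasure ?ang (sgn ` A n))"
    by (subst nn_integral_suminf) (simp_all add: nn_integral_cmult_indicator)
  also have "\<dots> = (\<Sum>n. ennreal (\<rho> powr (?c + \<bar>k + \<alpha>\<bar>)) * (ennreal (\<rho> powr (- \<bar>k + \<alpha>\<bar>) * s (z n) powr ?c) * emeasure ?ang (sgn ` A n)))"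
  proof (rule suminf_cong)
    fix n
    have "s (z n + 1) powr ?c = \<rho> powr ?c * s (z n) powr ?c"
      unfolding s(2) by (rule powr_mult)
    also have "\<rho> powr ?c = \<rho> powr (?c + \<bar>k + \<alpha>\<bar>) * \<rho> powr (- \<bar>k + \<alpha>\<bar>)"
      by (subst powr_add[symmetric]) simp
    finally have "s (z n + 1) powr ?c = \<rho> powr (?c + \<bar>k + \<alpha>\<bar>) * (\<rho> powr (- \<bar>k + \<alpha>\<bar>) * s (z n) powr ?c)"
      by (simp only: mult.assoc)
    then have "ennreal (s (z n + 1) powr ?c) = ennreal (\<rho> powr (?c + \<bar>k + \<alpha>\<bar>)) * ennreal (\<rho> powr (- \<bar>k + \<alpha>\<bar>) * s (z n) powr ?c)"
      by (simp only: ennreal_mult'[OF powr_ge_zero])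
    then show "ennreal (s (z n + 1) powr ?c) * emeasure ?ang (sgn ` A n)
      = ennreal (\<rho> powr (?c + \<bar>k + \<alpha>\<bar>)) * (ennreal (\<rho> powr (- \<bar>k + \<alpha>\<bar>) * s (z n) powr ?c) * emeasure ?ang (sgn ` A n))"
      by (simp only: mult.assoc)
  qed
  also have "\<dots> = ennreal (\<rho> powr (?c + \<bar>k + \<alpha>\<bar>)) * (\<Sum>n. ennreal (\<rho> powr (- \<bar>k + \<alpha>\<bar>) * s (z n) powr ?c) * emeasure ?ang (sgn ` A n))"
    by (rule ennreal_suminf_cmult)
  also have "\<dots> \<le> ennreal (\<rho> powr (?c + \<bar>k + \<alpha>\<bar>)) * (\<Sum>n. \<integral>\<^sup>+x\<in>A n. ?w x \<partial>?H)"
    using shell by (intro mult_left_mono suminf_le) auto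
  also have "\<dots> \<le> ennreal (\<rho> powr (?c + \<bar>k + \<alpha>\<bar>)) * weighted_perimeter m \<alpha> k \<Omega>"
    using sum_le by (rule mult_left_mono) simp
  finally show ?thesis .
qed

text \<open>
  Let the ratio \<open>\<rho>\<close> of the shells tend to 1.
\<close>

theorem perimeter_ge_volume:
  fixes \<Omega> :: "(real ^ 'n::finite) set" and k l \<alpha> :: real
  assumes N: "CARD('n) \<ge> 2" and \<Omega>: "open \<Omega>" "\<Omega> \<subseteq> upper_half m"
    and c: "k + CARD('n) + \<alpha> - 1 > 0" and a: "l + CARD('n) + \<alpha> > 0"
    and fin: "(\<integral>\<^sup>+x\<in>\<Omega>. ennreal (weight m \<alpha> l x) \<partial>lborel) < \<infinity>"
  shows "ennreal (k + CARD('n) + \<alpha> - 1) * (\<integral>\<^sup>+x\<in>\<Omega>. ennreal (weight m \<alpha> (k - 1) x) \<partial>lborel)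
    \<le> weighted_perimeter m \<alpha> k \<Omega>"
proof -
  let ?e = "k + CARD('n) + \<alpha> - 1 + \<bar>k + \<alpha>\<bar>"
  define \<rho> where "\<rho> n = 1 + inverse (real (Suc n))" for n
  have "\<rho> \<longlonglongrightarrow> 1 + 0"
    unfolding \<rho>_def by (intro tendsto_intros LIMSEQ_inverse_real_of_nat)
  then have "(\<lambda>n. \<rho> n powr ?e) \<longlonglongrightarrow> 1 powr ?e" by (intro tendsto_intros) auto
  then have "(\<lambda>n. \<rho> n powr ?e) \<longlonglongrightarrow> 1" by simp
  then show ?thesis
  proof (rule tendsto_imp_le_ennreal_mult)
    fix n
    have "\<rho> n > 1" by (simp add: \<rho>_def)
    then show "ennreal (k + CARD('n) + \<alpha> - 1) * (\<integral>\<^sup>+x\<in>\<Omega>. ennreal (weight m \<alpha> (k - 1) x) \<partial>lborel)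
        \<le> ennreal (\<rho> n powr ?e) * weighted_perimeter m \<alpha> k \<Omega>"
      using AE_ray_leaves[OF N borel_open[OF \<Omega>(1)] \<Omega>(2) a fin]
      by (intro perimeter_ge_volume_shells[OF N \<Omega> c])
  qed
qed

section \<open>Half-balls\<close>

text \<open>
  The bathtub principle: moving mass from \<open>\<Omega> - B\<close> to \<open>B - \<Omega>\<close>, where the norm is smaller, keeps the
  integral of the weight with exponent \<open>l\<close> and does not increase the one with the larger exponent \<open>q\<close>.
\<close>

lemma half_ball_minimizes_moment:
  fixes \<Omega> :: "(real ^ 'n::finite) set" and l q \<alpha> R :: real
  assumes \<Omega>: "\<Omega> \<in> sets borel" "\<Omega> \<subseteq> upper_half m" and "R > 0" and lq: "l \<le> q"
    and eq: "(\<integral>\<^sup>+x\<in>\<Omega>. ennreal (weight m \<alpha> l x) \<partial>lborel) = (\<integral>\<^sup>+x\<in>ball 0 R \<inter> upper_half m. ennreal (weight m \<alpha> l x) \<partial>lborel)"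
    and fin: "(\<integral>\<^sup>+x\<in>\<Omega>. ennreal (weight m \<alpha> l x) \<partial>lborel) < \<infinity>"
  shows "(\<integral>\<^sup>+x\<in>ball 0 R \<inter> upper_half m. ennreal (weight m \<alpha> q x) \<partial>lborel) \<le> (\<integral>\<^sup>+x\<in>\<Omega>. ennreal (weight m \<alpha> q x) \<partial>lborel)"
proof -
  let ?B = "ball 0 R \<inter> upper_half m :: (real ^ 'n) set"
  have B: "?B \<in> sets borel" by (intro borel_open open_Int open_ball open_upper_half)
  define M where "M p = density lborel (\<lambda>x. ennreal (weight m \<alpha> p x))" for p
  have M: "emeasure (M p) X = (\<integral>\<^sup>+x\<in>X. ennreal (weight m \<alpha> p x) \<partial>lborel)" if "X \<in> sets borel" for p X
    unfolding M_def using that by (subst emeasure_density) auto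
  have split: "emeasure (M p) X = emeasure (M p) (X \<inter> Y) + emeasure (M p) (X - Y)"
    if "X \<in> sets borel" "Y \<in> sets borel" for p X Y
    using that by (subst plus_emeasure) (auto simp: M_def Int_Diff_Un)
  have cmult: "(\<integral>\<^sup>+x. c * (ennreal (weight m \<alpha> l x) * indicator X x) \<partial>lborel)
      = c * (\<integral>\<^sup>+x\<in>X. ennreal (weight m \<alpha> l x) \<partial>lborel)" if [measurable]: "X \<in> sets borel" for X c
    by (rule nn_integral_cmult) measurable
  let ?s = "R powr (q - l)"
  have w: "weight m \<alpha> q x = norm x powr (q - l) * weight m \<alpha> l x" for x :: "real ^ 'n"
    by (cases "x = 0") (simp_all add: weight_def powr_diff)
  \<comment> \<open>The ratio \<open>norm x powr (q - l)\<close> of the two weights is at most \<open>R powr (q - l)\<close> inside the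
      ball and at least that outside.\<close>
  have in_le: "emeasure (M q) (?B - \<Omega>) \<le> ennreal ?s * emeasure (M l) (?B - \<Omega>)"
  proof -
    have "emeasure (M q) (?B - \<Omega>) \<le> (\<integral>\<^sup>+x. ennreal ?s * (ennreal (weight m \<alpha> l x) * indicator (?B - \<Omega>) x) \<partial>lborel)"
      unfolding M[OF sets.Diff[OF B \<Omega>(1)]]
    proof (rule nn_integral_mono)
      fix x :: "real ^ 'n"
      have "norm x powr (q - l) * weight m \<alpha> l x \<le> ?s * weight m \<alpha> l x" if "x \<in> ?B"
        using that lq by (intro mult_right_mono powr_mono2) (auto simp: weight_nonneg)
      then show "ennreal (weight m \<alpha> q x) * indicator (?B - \<Omega>) x
          \<le> ennreal ?s * (ennreal (weight m \<alpha> l x) * indicator (?B - \<Omega>) x)"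
        unfolding w by (auto simp: indicator_def ennreal_mult'[symmetric] intro!: ennreal_leI)
    qed
    also have "\<dots> = ennreal ?s * emeasure (M l) (?B - \<Omega>)"
      unfolding M[OF sets.Diff[OF B \<Omega>(1)]] by (rule cmult[OF sets.Diff[OF B \<Omega>(1)]])
    finally show ?thesis .
  qed
  have out_ge: "ennreal ?s * emeasure (M l) (\<Omega> - ?B) \<le> emeasure (M q) (\<Omega> - ?B)"
  proof -
    have "ennreal ?s * emeasure (M l) (\<Omega> - ?B) = (\<integral>\<^sup>+x. ennreal ?s * (ennreal (weight m \<alpha> l x) * indicator (\<Omega> - ?B) x) \<partial>lborel)"
      unfolding M[OF sets.Diff[OF \<Omega>(1) B]] by (rule cmult[OF sets.Diff[OF \<Omega>(1) B], symmetric])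
    also have "\<dots> \<le> emeasure (M q) (\<Omega> - ?B)"
      unfolding M[OF sets.Diff[OF \<Omega>(1) B]]
    proof (rule nn_integral_mono)
      fix x :: "real ^ 'n"
      have "?s * weight m \<alpha> l x \<le> norm x powr (q - l) * weight m \<alpha> l x" if "x \<in> \<Omega> - ?B"
      proof -
        have "norm x \<ge> R" using that \<Omega>(2) by auto
        then show ?thesis using lq \<open>R > 0\<close> by (intro mult_right_mono powr_mono2) (auto simp: weight_nonneg)
      qed
      then show "ennreal ?s * (ennreal (weight m \<alpha> l x) * indicator (\<Omega> - ?B) x)
          \<le> ennreal (weight m \<alpha> q x) * indicator (\<Omega> - ?B) x"
        unfolding w by (auto simp: indicator_def ennreal_mult'[symmetric] intro!: ennreal_leI)
    qed
    finally show ?thesis .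
  qed
  have BI: "\<Omega> \<inter> ?B = ?B \<inter> \<Omega>" by (rule Int_commute)
  have "emeasure (M l) ?B = emeasure (M l) \<Omega>" by (simp only: M[OF B] M[OF \<Omega>(1)] eq)
  then have "emeasure (M l) (?B \<inter> \<Omega>) + emeasure (M l) (?B - \<Omega>) = emeasure (M l) (?B \<inter> \<Omega>) + emeasure (M l) (\<Omega> - ?B)"
    by (simp only: split[OF B \<Omega>(1), of l] split[OF \<Omega>(1) B, of l] BI)
  moreover have "emeasure (M l) (?B \<inter> \<Omega>) \<noteq> \<infinity>"
  proof -
    have "emeasure (M l) (?B \<inter> \<Omega>) \<le> emeasure (M l) \<Omega>"
      using \<Omega>(1) by (intro emeasure_mono) (auto simp: M_def)
    then show ?thesis using fin M[OF \<Omega>(1)] by (auto simp: top_unique)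
  qed
  ultimately have same: "emeasure (M l) (?B - \<Omega>) = emeasure (M l) (\<Omega> - ?B)"
    unfolding ennreal_add_left_cancel by simp
  have "emeasure (M q) ?B = emeasure (M q) (?B \<inter> \<Omega>) + emeasure (M q) (?B - \<Omega>)"
    by (rule split[OF B \<Omega>(1)])
  also have "\<dots> \<le> emeasure (M q) (?B \<inter> \<Omega>) + emeasure (M q) (\<Omega> - ?B)"
    using in_le out_ge unfolding same by (intro add_left_mono) (rule order_trans)
  also have "\<dots> = emeasure (M q) \<Omega>"
    by (simp only: split[OF \<Omega>(1) B, of q] BI)
  finally show ?thesis by (simp only: M[OF B] M[OF \<Omega>(1)])
qed

lemma nn_integral_hausdorff_scaleR:
  fixes f :: "'a::euclidean_space \<Rightarrow> ennreal"
  assumes "R > 0" and f: "f \<in> borel_measurable borel"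
  shows "(\<integral>\<^sup>+x. f x \<partial>hausdorff_measure d) = ennreal (R ^ d) * (\<integral>\<^sup>+x. f (R *\<^sub>R x) \<partial>hausdorff_measure d)"
proof -
  let ?H = "hausdorff_measure d :: 'a measure"
  have m: "(*\<^sub>R) R \<in> ?H \<rightarrow>\<^sub>M borel"
    by (simp cong: measurable_cong_sets)
  have "?H = scale_measure (ennreal (R ^ d)) (distr ?H borel ((*\<^sub>R) R))"
  proof (rule measure_eqI)
    fix E assume "E \<in> sets ?H"
    then have E: "E \<in> sets borel" by simp
    have vim: "(*\<^sub>R) R -` E = (*\<^sub>R) (1 / R) ` E"
      using \<open>R > 0\<close> by (force simp: image_iff)
    have "emeasure (scale_measure (ennreal (R ^ d)) (distr ?H borel ((*\<^sub>R) R))) E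
        = ennreal (R ^ d) * hausdorff_outer d ((*\<^sub>R) (1 / R) ` E)"
      using E m sets_borel_scaleR_image[OF E, of "1 / R"] \<open>R > 0\<close>
      by (simp add: emeasure_distr vim emeasure_hausdorff_measure)
    also have "\<dots> = ennreal (R ^ d) * (ennreal ((1 / R) ^ d) * hausdorff_outer d E)"
      using \<open>R > 0\<close> by (subst hausdorff_outer_scaleR_image) auto
    also have "\<dots> = ennreal (R ^ d * (1 / R) ^ d) * hausdorff_outer d E"
      using \<open>R > 0\<close> by (simp add: ennreal_mult' mult.assoc)
    also have "R ^ d * (1 / R) ^ d = 1" using \<open>R > 0\<close> by (simp flip: power_mult_distrib)
    finally show "emeasure ?H E = emeasure (scale_measure (ennreal (R ^ d)) (distr ?H borel ((*\<^sub>R) R))) E"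
      using E by (simp add: emeasure_hausdorff_measure)
  qed simp
  then have "(\<integral>\<^sup>+x. f x \<partial>?H) = (\<integral>\<^sup>+x. f x \<partial>scale_measure (ennreal (R ^ d)) (distr ?H borel ((*\<^sub>R) R)))"
    by (rule arg_cong)
  also have "\<dots> = ennreal (R ^ d) * (\<integral>\<^sup>+x. f x \<partial>distr ?H borel ((*\<^sub>R) R))"
    using f by (intro nn_integral_scale_measure) (simp cong: measurable_cong_sets)
  also have "(\<integral>\<^sup>+x. f x \<partial>distr ?H borel ((*\<^sub>R) R)) = (\<integral>\<^sup>+x. f (R *\<^sub>R x) \<partial>?H)"
    using f by (intro nn_integral_distr m) simp
  finally show ?thesis .
qed

lemma nn_integral_weight_half_sphere:
  fixes m :: "'n::finite"
  shows "(\<integral>\<^sup>+x\<in>sphere 0 1 \<inter> upper_half m. ennreal (weight m \<alpha> k x) \<partial>hausdorff_measure (CARD('n) - 1))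
    = emeasure (angular_measure m \<alpha>) UNIV"
proof -
  have "emeasure (angular_measure m \<alpha>) UNIV = (\<integral>\<^sup>+\<theta>. ennreal ((\<theta> $ m) powr \<alpha>) * indicator (upper_half m) \<theta> \<partial>sphere_measure)"
    unfolding angular_measure_def by (subst emeasure_density) auto
  also have "\<dots> = (\<integral>\<^sup>+\<theta>\<in>sphere 0 1. (ennreal ((\<theta> $ m) powr \<alpha>) * indicator (upper_half m) \<theta>) \<partial>hausdorff_measure (CARD('n) - 1))"
    by (rule nn_integral_sphere_measure) measurable
  also have "\<dots> = (\<integral>\<^sup>+x\<in>sphere 0 1 \<inter> upper_half m. ennreal (weight m \<alpha> k x) \<partial>hausdorff_measure (CARD('n) - 1))"
    by (intro nn_integral_cong) (auto simp: weight_def indicator_def)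
  finally show ?thesis by simp
qed

lemma frontier_half_ball:
  assumes "R > 0" "x \<in> upper_half m"
  shows "x \<in> frontier (ball 0 R \<inter> upper_half m) \<longleftrightarrow> norm x = R"
proof -
  have op: "open (ball 0 R \<inter> upper_half m)" by (intro open_Int open_ball open_upper_half)
  have "x \<in> closure (ball 0 R \<inter> upper_half m) \<longleftrightarrow> norm x \<le> R"
  proof
    assume "x \<in> closure (ball 0 R \<inter> upper_half m)"
    then have "x \<in> closure (ball 0 R)" using closure_mono[of "ball 0 R \<inter> upper_half m" "ball 0 R"] by blast
    then show "norm x \<le> R" using \<open>R > 0\<close> by simp
  next
    assume "norm x \<le> R"
    then have "x \<in> upper_half m \<inter> closure (ball 0 R)" using assms by simp
    then show "x \<in> closure (ball 0 R \<inter> upper_half m)"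
      using open_Int_closure_subset[OF open_upper_half, of m "ball 0 R"] by (auto simp: Int_commute)
  qed
  then show ?thesis using assms unfolding frontier_def interior_open[OF op] by auto
qed

lemma frontier_half_ball_subset:
  "frontier (ball 0 R \<inter> upper_half m) \<subseteq> {x. x $ m \<ge> 0}"
proof -
  have "closure (ball 0 R \<inter> upper_half m) \<subseteq> {x. x $ m \<ge> 0}"
    by (intro closure_minimal closed_Collect_le continuous_intros) (auto simp: upper_half_def)
  then show ?thesis by (auto simp: frontier_def)
qed

text \<open>
  The flat part of the boundary lies in \<open>x $ m = 0\<close>, where the weight vanishes; the spherical
  part is the unit half-sphere scaled by \<open>R\<close>.
\<close>

lemma weighted_perimeter_half_ball:
  fixes m :: "'n::finite" and k \<alpha> R :: real
  assumes N: "CARD('n) \<ge> 2" and R: "R > 0"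
  shows "weighted_perimeter m \<alpha> k (ball 0 R \<inter> upper_half m)
    = ennreal (R powr (k + CARD('n) + \<alpha> - 1)) * emeasure (angular_measure m \<alpha>) UNIV"
proof -
  let ?d = "CARD('n) - 1"
  let ?H = "hausdorff_measure ?d :: (real ^ 'n) measure"
  let ?f = "\<lambda>x. ennreal (weight m \<alpha> k x) * indicator (sphere 0 R \<inter> upper_half m) x"
  have SU: "sphere 0 r \<inter> upper_half m \<in> sets borel" for r
    by (intro sets.Int borel_closed[OF closed_sphere] sets_upper_half)
  have wm: "(\<lambda>x. ennreal (weight m \<alpha> k x) * indicator X x) \<in> borel_measurable borel"
    if [measurable]: "X \<in> sets borel" for X
    by measurable
  have "weighted_perimeter m \<alpha> k (ball 0 R \<inter> upper_half m) = (\<integral>\<^sup>+x. ?f x \<partial>?H)"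
    unfolding weighted_perimeter_def
  proof (rule nn_integral_cong)
    fix x :: "real ^ 'n"
    show "ennreal (weight m \<alpha> k x) * indicator (frontier (ball 0 R \<inter> upper_half m)) x = ?f x"
    proof (cases "x \<in> upper_half m")
      case True
      then show ?thesis using frontier_half_ball[OF R True] by (simp add: indicator_def)
    next
      case False
      then have "x $ m = 0" if "x \<in> frontier (ball 0 R \<inter> upper_half m)"
        using that frontier_half_ball_subset[of R m] by (auto simp: upper_half_def)
      then show ?thesis using False by (auto simp: indicator_def weight_def)
    qed
  qed
  also have "\<dots> = ennreal (R ^ ?d) * (\<integral>\<^sup>+x. ?f (R *\<^sub>R x) \<partial>?H)"
    by (intro nn_integral_hausdorff_scaleR R wm SU)
  also have "(\<integral>\<^sup>+x. ?f (R *\<^sub>R x) \<partial>?H) = (\<integral>\<^sup>+x. ennreal (R powr (k + \<alpha>)) * (ennreal (weight m \<alpha> k x) * indicator (sphere 0 1 \<inter> upper_half m) x) \<partial>?H)"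
  proof (rule nn_integral_cong)
    fix x :: "real ^ 'n"
    have iff: "R *\<^sub>R x \<in> sphere 0 R \<inter> upper_half m \<longleftrightarrow> x \<in> sphere 0 1 \<inter> upper_half m"
      using R by (simp add: upper_half_def zero_less_mult_iff)
    show "?f (R *\<^sub>R x) = ennreal (R powr (k + \<alpha>)) * (ennreal (weight m \<alpha> k x) * indicator (sphere 0 1 \<inter> upper_half m) x)"
    proof (cases "x \<in> sphere 0 1 \<inter> upper_half m")
      case True
      then have "weight m \<alpha> k (R *\<^sub>R x) = R powr (k + \<alpha>) * weight m \<alpha> k x"
        using R weight_scaleR[of R x m \<alpha> k] by (auto simp: upper_half_def weight_def)
      then show ?thesis using True iff by (simp add: ennreal_mult')
    qed (use iff in simp)
  qed
  also have "\<dots> = ennreal (R powr (k + \<alpha>)) * (\<integral>\<^sup>+x\<in>sphere 0 1 \<inter> upper_half m. ennreal (weight m \<alpha> k x) \<partial>?H)"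
  proof (rule nn_integral_cmult)
    have "(\<lambda>x. ennreal (weight m \<alpha> k x) * indicator (sphere 0 1 \<inter> upper_half m) x) \<in> borel_measurable borel"
      by (intro wm SU)
    then show "(\<lambda>x. ennreal (weight m \<alpha> k x) * indicator (sphere 0 1 \<inter> upper_half m) x) \<in> borel_measurable ?H"
      by (simp cong: measurable_cong_sets)
  qed
  also have "(\<integral>\<^sup>+x\<in>sphere 0 1 \<inter> upper_half m. ennreal (weight m \<alpha> k x) \<partial>?H) = emeasure (angular_measure m \<alpha>) UNIV"
    by (rule nn_integral_weight_half_sphere)
  finally have "weighted_perimeter m \<alpha> k (ball 0 R \<inter> upper_half m)
      = (ennreal (R ^ ?d) * ennreal (R powr (k + \<alpha>))) * emeasure (angular_measure m \<alpha>) UNIV"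
    by (simp only: mult.assoc)
  also have "ennreal (R ^ ?d) * ennreal (R powr (k + \<alpha>)) = ennreal (R ^ ?d * R powr (k + \<alpha>))"
    using R by (intro ennreal_mult'[symmetric]) auto
  also have "R ^ ?d * R powr (k + \<alpha>) = R powr (k + CARD('n) + \<alpha> - 1)"
    using R N by (simp add: powr_realpow[symmetric] powr_add[symmetric] of_nat_diff algebra_simps)
  finally show ?thesis .
qed

lemma weighted_volume_eq_nn_integral:
  fixes \<Omega> :: "(real ^ 'n::finite) set"
  assumes [measurable]: "\<Omega> \<in> sets borel"
  shows "weighted_volume m \<alpha> l \<Omega> = enn2real (\<integral>\<^sup>+x\<in>\<Omega>. ennreal (weight m \<alpha> l x) \<partial>lborel)"
proof -
  have "weighted_volume m \<alpha> l \<Omega> = enn2real (\<integral>\<^sup>+x. ennreal (indicator \<Omega> x *\<^sub>R weight m \<alpha> l x) \<partial>lborel)"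
    unfolding weighted_volume_def set_lebesgue_integral_def
    by (rule integral_eq_nn_integral) (auto simp: weight_nonneg)
  also have "(\<integral>\<^sup>+x. ennreal (indicator \<Omega> x *\<^sub>R weight m \<alpha> l x) \<partial>lborel) = (\<integral>\<^sup>+x\<in>\<Omega>. ennreal (weight m \<alpha> l x) \<partial>lborel)"
    by (intro nn_integral_cong) (auto simp: indicator_def)
  finally show ?thesis .
qed

lemma nn_integral_weight_finite:
  fixes \<Omega> :: "(real ^ 'n::finite) set"
  assumes "set_integrable lborel \<Omega> (weight m \<alpha> l)"
  shows "(\<integral>\<^sup>+x\<in>\<Omega>. ennreal (weight m \<alpha> l x) \<partial>lborel) < \<infinity>"
proof -
  have "(\<integral>\<^sup>+x\<in>\<Omega>. ennreal (weight m \<alpha> l x) \<partial>lborel) = (\<integral>\<^sup>+x. ennreal (norm (indicator \<Omega> x *\<^sub>R weight m \<alpha> l x)) \<partial>lborel)"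
    by (intro nn_integral_cong) (auto simp: indicator_def weight_nonneg)
  also have "\<dots> < \<infinity>"
    using assms unfolding set_integrable_def integrable_iff_bounded by blast
  finally show ?thesis .
qed

lemma C_rad_numerator:
  fixes m :: "'n::finite"
  assumes "emeasure (angular_measure m \<alpha>) UNIV = ennreal K" "K \<ge> 0"
  shows "(LINT x : sphere 0 1 \<inter> upper_half m | hausdorff_measure (CARD('n) - 1). weight m \<alpha> k x) = K"
proof -
  let ?S = "sphere 0 1 \<inter> upper_half m :: (real ^ 'n) set"
  let ?H = "hausdorff_measure (CARD('n) - 1) :: (real ^ 'n) measure"
  have SU: "?S \<in> sets borel"
    by (intro sets.Int borel_closed[OF closed_sphere] sets_upper_half)
  have "(\<lambda>x. indicator X x *\<^sub>R weight m \<alpha> k x) \<in> borel_measurable borel"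
    if [measurable]: "X \<in> sets borel" for X
    by measurable
  from this[OF SU] have "(\<lambda>x. indicator ?S x *\<^sub>R weight m \<alpha> k x) \<in> borel_measurable ?H" by (simp cong: measurable_cong_sets)
  then have "(LINT x : ?S | ?H. weight m \<alpha> k x) = enn2real (\<integral>\<^sup>+x. ennreal (indicator ?S x *\<^sub>R weight m \<alpha> k x) \<partial>?H)"
    unfolding set_lebesgue_integral_def by (rule integral_eq_nn_integral) (auto simp: weight_nonneg)
  also have "(\<integral>\<^sup>+x. ennreal (indicator ?S x *\<^sub>R weight m \<alpha> k x) \<partial>?H) = (\<integral>\<^sup>+x\<in>?S. ennreal (weight m \<alpha> k x) \<partial>?H)"
    by (intro nn_integral_cong) (auto simp: indicator_def)
  finally show ?thesis using assms by (simp only: nn_integral_weight_half_sphere enn2real_ennreal)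
qed

section \<open>The isoperimetric inequality\<close>

text \<open>
  Write \<open>a = l + CARD('n) + \<alpha>\<close> and \<open>c = k + CARD('n) + \<alpha> - 1\<close>. The half-ball of radius \<open>R\<close> has volume
  \<open>K * R powr a / a\<close> and perimeter \<open>K * R powr c\<close>, where \<open>K\<close> is the angular mass. This gives the formula for the
  constant and the case of equality. A general \<open>\<Omega>\<close> is compared with the half-ball of equal volume: its
  perimeter is at least \<open>c\<close> times its integral of the weight with exponent \<open>k - 1\<close>, and as \<open>l \<le> k - 1\<close>,
  that integral is at least the one over the half-ball.
\<close>

theorem theorem1p1:
  fixes m :: "'n::finite" and k l \<alpha> :: real
  assumes "CARD('n) \<ge> 2"
    and "\<alpha> > 0"
    and "l + real CARD('n) + \<alpha> > 0"
    and "l + 1 \<le> k"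
  shows "(\<forall>\<Omega> :: (real ^ 'n) set.
            smooth_in_half m \<Omega> \<and> set_integrable lborel \<Omega> (weight m \<alpha> l) \<longrightarrow>
            weighted_perimeter m \<alpha> k \<Omega> \<ge>
              ennreal (C_rad m \<alpha> k l *
                weighted_volume m \<alpha> l \<Omega>
                  powr ((k + real CARD('n) + \<alpha> - 1) / (l + real CARD('n) + \<alpha>))))
       \<and> C_rad m \<alpha> k l =
           (l + \<alpha> + real CARD('n))
              powr ((k + real CARD('n) + \<alpha> - 1) / (l + real CARD('n) + \<alpha>))
           * (Beta ((real CARD('n) - 1) / 2) ((\<alpha> + 1) / 2)
                * (pi powr ((real CARD('n) - 1) / 2) / Gamma ((real CARD('n) - 1) / 2)))
              powr ((l - k + 1) / (l + real CARD('n) + \<alpha>))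
       \<and> (\<forall>R > 0.
            weighted_perimeter m \<alpha> k (ball 0 R \<inter> upper_half m) =
              ennreal (C_rad m \<alpha> k l *
                weighted_volume m \<alpha> l (ball 0 R \<inter> upper_half m)
                  powr ((k + real CARD('n) + \<alpha> - 1) / (l + real CARD('n) + \<alpha>))))"
proof -
  let ?N = "real CARD('n)"
  define a where "a = l + ?N + \<alpha>"
  define c where "c = k + ?N + \<alpha> - 1"
  define K where "K = Beta ((?N - 1) / 2) ((\<alpha> + 1) / 2) * (pi powr ((?N - 1) / 2) / Gamma ((?N - 1) / 2))"
  have N: "CARD('n) \<ge> 2" by fact
  have N1: "(?N - 1) / 2 > 0" using N by simp
  have a: "a > 0" and c: "c > 0" using assms by (simp_all add: a_def c_def)
  have "Gamma ((?N - 1) / 2) > 0" "Gamma ((\<alpha> + 1) / 2) > 0" "Gamma ((?N - 1) / 2 + (\<alpha> + 1) / 2) > 0"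
    using N1 assms(2) by (intro Gamma_real_pos add_pos_pos; simp)+
  then have K: "K > 0" unfolding K_def Beta_def by (intro mult_pos_pos divide_pos_pos) simp_all
  have mass: "emeasure (angular_measure m \<alpha>) UNIV = ennreal K"
    unfolding K_def using N assms(2) by (rule emeasure_angular_measure)
  have hb: "ball 0 R \<inter> upper_half m \<in> sets borel" for R :: real
    by (intro borel_open open_Int open_ball open_upper_half)
  have hvol: "(\<integral>\<^sup>+x\<in>ball 0 R \<inter> upper_half m. ennreal (weight m \<alpha> l x) \<partial>lborel) = ennreal (R powr a / a * K)"
    if "R > 0" for R
  proof -
    have "R powr a / a \<ge> 0" using a by simp
    then show ?thesis
      using nn_integral_weight_half_ball[OF N _ that, of l \<alpha> m] a unfolding a_def[symmetric] mass
      by (simp only: ennreal_mult')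
  qed
  have vol: "weighted_volume m \<alpha> l (ball 0 R \<inter> upper_half m) = R powr a / a * K" if "R > 0" for R
    using that a K unfolding weighted_volume_eq_nn_integral[OF hb] hvol[OF that] by simp
  have C: "C_rad m \<alpha> k l = K / (K / a) powr (c / a)"
    unfolding C_rad_def C_rad_numerator[OF mass less_imp_le[OF K]]
    by (simp add: vol a_def[symmetric] c_def[symmetric])
  \<comment> \<open>Both sides of the isoperimetric inequality are computed on the half-ball of volume \<open>V\<close>:
      the right-hand side equals the perimeter \<open>K * R powr c\<close> of that half-ball.\<close>
  have CV: "C_rad m \<alpha> k l * V powr (c / a) = K * R powr c" if "R > 0" "V = R powr a / a * K" for V R
  proof -
    have "V = R powr a * (K / a)" using that by simp
    then have "V powr (c / a) = (R powr a) powr (c / a) * (K / a) powr (c / a)"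
      by (simp only: powr_mult)
    also have "(R powr a) powr (c / a) = R powr c" using a by (simp add: powr_powr)
    finally have "V powr (c / a) = R powr c * (K / a) powr (c / a)" .
    moreover have "(K / a) powr (c / a) > 0" using a K by simp
    ultimately show ?thesis unfolding C by simp
  qed
  have ineq: "weighted_perimeter m \<alpha> k \<Omega> \<ge> ennreal (C_rad m \<alpha> k l * weighted_volume m \<alpha> l \<Omega> powr (c / a))"
    if \<Omega>: "smooth_in_half m \<Omega>" and int: "set_integrable lborel \<Omega> (weight m \<alpha> l)" for \<Omega> :: "(real ^ 'n) set"
  proof -
    have op: "open \<Omega>" and sub: "\<Omega> \<subseteq> upper_half m" using \<Omega> by (simp_all add: smooth_in_half_def)
    have \<Omega>m: "\<Omega> \<in> sets borel" using op by (rule borel_open)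
    define V where "V = weighted_volume m \<alpha> l \<Omega>"
    have fin: "(\<integral>\<^sup>+x\<in>\<Omega>. ennreal (weight m \<alpha> l x) \<partial>lborel) < \<infinity>"
      using int by (rule nn_integral_weight_finite)
    then have V: "(\<integral>\<^sup>+x\<in>\<Omega>. ennreal (weight m \<alpha> l x) \<partial>lborel) = ennreal V" "V \<ge> 0"
      unfolding V_def weighted_volume_eq_nn_integral[OF \<Omega>m] by simp_all
    show ?thesis
    proof (cases "V = 0")
      case True
      then show ?thesis by (simp add: V_def)
    next
      case False
      \<comment> \<open>the radius for which the half-ball has the same weighted volume as \<open>\<Omega>\<close>\<close>
      define R where "R = (a * V / K) powr (1 / a)"
      have R: "R > 0" using False V a K by (simp add: R_def)
      have "R powr a = a * V / K" using False V a K by (simp add: R_def powr_powr)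
      then have VR: "V = R powr a / a * K" using a K by simp
      let ?J = "\<lambda>X. \<integral>\<^sup>+x\<in>X. ennreal (weight m \<alpha> (k - 1) x) \<partial>lborel"
      have "?J (ball 0 R \<inter> upper_half m) \<le> ?J \<Omega>"
        using assms(4) V(1) hvol[OF R] VR by (intro half_ball_minimizes_moment[OF \<Omega>m sub R _ _ fin]) auto
      then have "ennreal c * ?J (ball 0 R \<inter> upper_half m) \<le> ennreal c * ?J \<Omega>"
        by (rule mult_left_mono) simp
      also have "\<dots> \<le> weighted_perimeter m \<alpha> k \<Omega>"
        using perimeter_ge_volume[OF N op sub _ assms(3) fin, of k] c by (simp add: c_def)
      finally have "ennreal c * ?J (ball 0 R \<inter> upper_half m) \<le> weighted_perimeter m \<alpha> k \<Omega>" .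
      moreover have "ennreal c * ?J (ball 0 R \<inter> upper_half m) = ennreal (K * R powr c)"
      proof -
        have e: "k - 1 + ?N + \<alpha> = c" by (simp add: c_def)
        have "?J (ball 0 R \<inter> upper_half m) = ennreal (R powr c / c) * ennreal K"
          using nn_integral_weight_half_ball[OF N, of "k - 1" \<alpha> R m] c R unfolding e mass by simp
        then have "ennreal c * ?J (ball 0 R \<inter> upper_half m) = ennreal (c * (R powr c / c * K))"
          using c by (simp only: ennreal_mult' less_imp_le divide_nonneg_pos powr_ge_zero)
        then show ?thesis using c by (simp add: mult.commute)
      qed
      ultimately show ?thesis using CV[OF R VR] by (simp add: V_def)
    qed
  qed
  have closed: "C_rad m \<alpha> k l = a powr (c / a) * K powr ((l - k + 1) / a)"
  proof -
    have "(l - k + 1) / a = 1 - c / a" using a by (simp add: c_def a_def field_simps)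
    then have "K powr ((l - k + 1) / a) = K / K powr (c / a)" using K by (simp add: powr_diff)
    then show ?thesis unfolding C using a K by (simp add: powr_divide)
  qed
  have ball: "weighted_perimeter m \<alpha> k (ball 0 R \<inter> upper_half m)
      = ennreal (C_rad m \<alpha> k l * weighted_volume m \<alpha> l (ball 0 R \<inter> upper_half m) powr (c / a))" if "R > 0" for R
  proof -
    have "weighted_perimeter m \<alpha> k (ball 0 R \<inter> upper_half m) = ennreal (R powr c) * ennreal K"
      using weighted_perimeter_half_ball[OF N that, of m \<alpha> k] unfolding c_def[symmetric] mass .
    also have "\<dots> = ennreal (K * R powr c)"
      by (simp only: ennreal_mult'[OF powr_ge_zero] mult.commute[of K])
    finally show ?thesis by (simp only: CV[OF that vol[OF that]])
  qed
  have "l + \<alpha> + ?N = a" by (simp add: a_def)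
  then show ?thesis
    using ineq closed ball unfolding a_def[symmetric] c_def[symmetric] K_def[symmetric] by simp
qed

end
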